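(* Let $\{\mathcal{T}_k\}_k$ be the sequence of periodic triangulations of $\Omega=(0,1)^2$ for which $\mathcal{T}_1$ is the "double diagonal" triangulation of a square. Then the unit level set $\varphi_{\mathcal{T}_1}^{-1}(1)\subset\mathbb{R}^2$ is (the boundary of) the regular octagon centered at the origin with a vertex at $(1,0)$, and the Wulff shape of $\varphi_{\mathcal{T}_1}$ is, up to dilation, the rotation by $\pi/8$ of the (filled) octagon bounded by $\varphi_{\mathcal{T}_1}^{-1}(1)$.
   Context: The double diagonal triangulation $\mathcal{T}_1$ of $(0,1)^2$ consists of the four open triangles into which the two diagonals divide the unit square. For $k\in\mathbb{N}$, $\mathcal{T}_k=\bigcup_{i_1,i_2=0}^{k-1}\frac1k(\mathcal{T}_1+(i_1,i_2))$. $\mathcal{S}_{\mathcal{T}_k}(\Omega)$ is the class of open sets obtained as interiors of unions of closures of triangles of $\mathcal{T}_k$; $\mathrm{Per}_{\mathcal{T}_k}(E)=\mathrm{Per}(E,\Omega)$ (Euclidean perimeter in $\Omega$) if $E\in\mathcal{S}_{\mathcal{T}_k}(\Omega)$ and $+\infty$ otherwise. $\varphi_{\mathcal{T}_1}:\mathbb{R}^2\to[0,\infty)$ is the continuous, positively one-homogeneous function such that $\mathrm{Per}_{\mathcal{T}_k}$ $\Gamma$-converges as $k\to\infty$, with respect to $L^1$ convergence of sets (i.e. $\mathcal{L}^2(E_k\triangle E)\to0$), to the functional $A\mapsto\int_{\partial^*A}\varphi_{\mathcal{T}_1}(\nu_A)\,d\mathcal{H}^1$ (equal to $+\infty$ on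 sets not of finite perimeter), where $\partial^*A$ is the reduced boundary of $A$ and $\nu_A=D\mathbb{1}_A/|D\mathbb{1}_A|$. Such a function exists. The Wulff shape of $\varphi$ is $\{x\in\mathbb{R}^2: x\cdot\nu\le\varphi(\nu)\text{ for all }\nu\in S^1\}$, equivalently (up to translation and dilation) the set minimizing the anisotropic perimeter $\int_{\partial^*A}\varphi(\nu_A)\,d\mathcal{H}^1$ among sets $A\subset\mathbb{R}^2$ of fixed area. *)

theory Defs
  imports "HOL-Analysis.Analysis"
begin

definition test_field :: "'a::euclidean_space set \<Rightarrow> ('a \<Rightarrow> 'a) \<Rightarrow> bool" where
  "test_field \<Omega> T \<longleftrightarrow>
     (\<exists>T' :: 'a \<Rightarrow> 'a \<Rightarrow>\<^sub>L 'a. (\<forall>x. (T has_derivative blinfun_apply (T' x)) (at x)) \<and> continuous_on UNIV T') \<and>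
     compact (closure {x. T x \<noteq> 0}) \<and> closure {x. T x \<noteq> 0} \<subseteq> \<Omega>"

definition divergence :: "('a::euclidean_space \<Rightarrow> 'a) \<Rightarrow> 'a \<Rightarrow> real" where
  "divergence T x = (\<Sum>b\<in>Basis. frechet_derivative T (at x) b \<bullet> b)"

text \<open>De Giorgi perimeter of \<open>E\<close> in the open set \<open>\<Omega>\<close>. The field \<open>T = 0\<close> is admissible, so the
  truncation of negative numbers by \<^const>\<open>ennreal\<close> does not affect the supremum.\<close>

definition perimeter :: "'a::euclidean_space set \<Rightarrow> 'a set \<Rightarrow> ennreal" where
  "perimeter E \<Omega> =
     (SUP T\<in>{T. test_field \<Omega> T \<and> (\<forall>x. norm (T x) \<le> 1)}. ennreal (LINT x:E|lebesgue. divergence T x))"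

text \<open>\<open>(\<mu>, \<nu>)\<close> is the polar decomposition of the distributional derivative of the indicator
  function of \<open>A\<close> in \<open>\<Omega>\<close>: the derivative is the vector measure \<open>\<nu> \<mu>\<close>, its total variation is \<open>\<mu>\<close>.
  For open \<open>\<Omega>\<close> the measure \<open>\<mu>\<close> is unique and \<open>\<nu>\<close> is unique \<open>\<mu>\<close>-almost everywhere; both exist exactly
  if \<open>perimeter A \<Omega>\<close> is finite. Measures on \<open>\<Omega>\<close> are Borel measures on the whole space that do not
  charge the complement of \<open>\<Omega>\<close>.\<close>

definition polar_decomposition ::
    "'a::euclidean_space set \<Rightarrow> 'a set \<Rightarrow> 'a measure \<Rightarrow> ('a \<Rightarrow> 'a) \<Rightarrow> bool" where
  "polar_decomposition \<Omega> A \<mu> \<nu> \<longleftrightarrow>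
     sets \<mu> = sets borel \<and> finite_measure \<mu> \<and> emeasure \<mu> (- \<Omega>) = 0 \<and>
     \<nu> \<in> borel_measurable borel \<and> (AE x in \<mu>. norm (\<nu> x) = 1) \<and>
     (\<forall>T. test_field \<Omega> T \<longrightarrow>
        (LINT x:A|lebesgue. divergence T x) = - (LINT x|\<mu>. T x \<bullet> \<nu> x))"

definition total_variation :: "'a::euclidean_space set \<Rightarrow> 'a set \<Rightarrow> 'a measure" where
  "total_variation \<Omega> A = (THE \<mu>. \<exists>\<nu>. polar_decomposition \<Omega> A \<mu> \<nu>)"

definition indicator_derivative :: "'a::euclidean_space set \<Rightarrow> 'a set \<Rightarrow> 'a set \<Rightarrow> 'a" where
  "indicator_derivative \<Omega> A B =
     (THE d. \<exists>\<mu> \<nu>. polar_decomposition \<Omega> A \<mu> \<nu> \<and> d = (LINT x:B|\<mu>. \<nu> x))"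

definition mean_normal :: "'a::euclidean_space set \<Rightarrow> 'a set \<Rightarrow> 'a \<Rightarrow> real \<Rightarrow> 'a" where
  "mean_normal \<Omega> A x r =
     indicator_derivative \<Omega> A (ball x r) /\<^sub>R measure (total_variation \<Omega> A) (ball x r)"

definition normal_vector :: "'a::euclidean_space set \<Rightarrow> 'a set \<Rightarrow> 'a \<Rightarrow> 'a" where
  "normal_vector \<Omega> A x = Lim (at_right 0) (mean_normal \<Omega> A x)"

definition reduced_boundary :: "'a::euclidean_space set \<Rightarrow> 'a set \<Rightarrow> 'a set" where
  "reduced_boundary \<Omega> A =
     {x \<in> \<Omega>. (\<forall>r>0. measure (total_variation \<Omega> A) (ball x r) > 0) \<and>
        (\<exists>n. norm n = 1 \<and> (mean_normal \<Omega> A x \<longlongrightarrow> n) (at_right 0))}"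

definition hausdorff1_pre :: "real \<Rightarrow> 'a::metric_space set \<Rightarrow> ennreal" where
  "hausdorff1_pre \<delta> A =
     (INF C\<in>{C :: nat \<Rightarrow> 'a set. A \<subseteq> (\<Union>i. C i) \<and> (\<forall>i. bounded (C i) \<and> diameter (C i) \<le> \<delta>)}.
        (\<Sum>i. ennreal (diameter (C i))))"

definition hausdorff1_outer :: "'a::metric_space set \<Rightarrow> ennreal" where
  "hausdorff1_outer A = (SUP \<delta>\<in>{0<..}. hausdorff1_pre \<delta> A)"

text \<open>One-dimensional Hausdorff measure. The outer measure is a metric outer measure, hence countably
  additive on Borel sets, so that \<^const>\<open>measure_of\<close> keeps its values there.\<close>

definition hausdorff1 :: "'a::metric_space measure" where
  "hausdorff1 = measure_of UNIV (sets borel) hausdorff1_outer"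

definition anisotropic_perimeter ::
    "'a::euclidean_space set \<Rightarrow> ('a \<Rightarrow> real) \<Rightarrow> 'a set \<Rightarrow> ennreal" where
  "anisotropic_perimeter \<Omega> \<phi> A =
     (if perimeter A \<Omega> < \<infinity>
      then \<integral>\<^sup>+x\<in>reduced_boundary \<Omega> A. ennreal (\<phi> (normal_vector \<Omega> A x)) \<partial>hausdorff1
      else \<infinity>)"

definition measurable_subsets :: "'a::euclidean_space set \<Rightarrow> 'a set set" where
  "measurable_subsets \<Omega> = {A \<in> sets lebesgue. A \<subseteq> \<Omega>}"

definition L1_converges :: "(nat \<Rightarrow> 'a::euclidean_space set) \<Rightarrow> 'a set \<Rightarrow> bool" where
  "L1_converges E A \<longleftrightarrow> (\<lambda>k. emeasure lebesgue (sym_diff (E k) A)) \<longlonglongrightarrow> 0"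

definition gamma_converges ::
    "'a::euclidean_space set \<Rightarrow> (nat \<Rightarrow> 'a set \<Rightarrow> ennreal) \<Rightarrow> ('a set \<Rightarrow> ennreal) \<Rightarrow> bool" where
  "gamma_converges \<Omega> F G \<longleftrightarrow>
     (\<forall>A \<in> measurable_subsets \<Omega>.
        (\<forall>E. (\<forall>k. E k \<in> measurable_subsets \<Omega>) \<and> L1_converges E A \<longrightarrow>
             G A \<le> liminf (\<lambda>k. F k (E k))) \<and>
        (\<exists>E. (\<forall>k. E k \<in> measurable_subsets \<Omega>) \<and> L1_converges E A \<and>
             limsup (\<lambda>k. F k (E k)) \<le> G A))"

definition unit_square :: "(real^2) set" where
  "unit_square = {x. 0 < x $ 1 \<and> x $ 1 < 1 \<and> 0 < x $ 2 \<and> x $ 2 < 1}"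

definition double_diagonal :: "(real^2) set set" where
  "double_diagonal =
     (\<lambda>(p, q). interior (convex hull {vector [1/2, 1/2], p, q})) `
       {(vector [0, 0], vector [1, 0]), (vector [1, 0], vector [1, 1]),
        (vector [1, 1], vector [0, 1]), (vector [0, 1], vector [0, 0])}"

text \<open>The \<open>k\<close>-th triangulation generated by \<open>\<T>\<close>; the index \<open>k = 0\<close> gives the empty family and is
  irrelevant for limits.\<close>

definition periodic_triangulation :: "(real^2) set set \<Rightarrow> nat \<Rightarrow> (real^2) set set" where
  "periodic_triangulation \<T> k =
     (\<Union>i\<in>{..<k}. \<Union>j\<in>{..<k}.
        (\<lambda>t. (\<lambda>x. (1 / real k) *\<^sub>R (x + vector [real i, real j])) ` t) ` \<T>)"

definition triangulated_sets :: "(real^2) set set \<Rightarrow> (real^2) set set" where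
  "triangulated_sets \<T> = {interior (\<Union>t\<in>\<F>. closure t) | \<F>. \<F> \<subseteq> \<T>}"

definition triangulated_perimeter :: "(real^2) set set \<Rightarrow> (real^2) set \<Rightarrow> ennreal" where
  "triangulated_perimeter \<T> E =
     (if E \<in> triangulated_sets \<T> then perimeter E unit_square else \<infinity>)"

text \<open>All boundaries are taken relative to the open square: \<^const>\<open>reduced_boundary\<close> is a subset of
  its first argument, so boundary parts on the frontier of the square carry no energy in the limit.\<close>

definition limit_density :: "(real^2) set set \<Rightarrow> (real^2 \<Rightarrow> real) \<Rightarrow> bool" where
  "limit_density \<T> \<phi> \<longleftrightarrow>
     continuous_on UNIV \<phi> \<and> (\<forall>x. 0 \<le> \<phi> x) \<and> (\<forall>t\<ge>0. \<forall>x. \<phi> (t *\<^sub>R x) = t * \<phi> x) \<and>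
     gamma_converges unit_square
       (\<lambda>k. triangulated_perimeter (periodic_triangulation \<T> k))
       (anisotropic_perimeter unit_square \<phi>)"

definition wulff_shape :: "('a::euclidean_space \<Rightarrow> real) \<Rightarrow> 'a set" where
  "wulff_shape \<phi> = {x. \<forall>\<nu>\<in>sphere 0 1. x \<bullet> \<nu> \<le> \<phi> \<nu>}"

definition rotate2 :: "real \<Rightarrow> real^2 \<Rightarrow> real^2" where
  "rotate2 \<theta> x = vector [cos \<theta> * x $ 1 - sin \<theta> * x $ 2, sin \<theta> * x $ 1 + cos \<theta> * x $ 2]"

text \<open>The filled regular \<open>n\<close>-gon centred at the origin with a vertex at \<open>v\<close>.\<close>

definition regular_polygon :: "nat \<Rightarrow> real^2 \<Rightarrow> (real^2) set" where
  "regular_polygon n v = convex hull ((\<lambda>j. rotate2 (2 * pi * real j / real n) v) ` {..<n})"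

end

theory Submission imports Defs begin

text \<open>The \<open>\<Gamma>\<close>-limit is tested on the half squares \<open>\<sigma> (x\<^sub>i - 1/2 - b (x\<^sub>j - 1/2)) > 0\<close> with
  \<open>\<bar>b\<bar> \<le> 1\<close>, on which the anisotropic perimeter is \<open>\<phi>\<close> at the conormal \<open>\<sigma> (e\<^sub>i - b e\<^sub>j)\<close>. Staircase sets
  whose boundary follows edges in direction \<open>e\<^sub>j\<close> and diagonals approximate the half square with perimeter
  at most \<open>1 + (sqrt 2 - 1) \<bar>b\<bar>\<close>. Conversely, let \<open>w\<close> be a vertex of the octagon of all \<open>w\<close> with
  \<open>\<bar>w \<bullet> n\<bar> \<le> 1\<close> for the four unit normals \<open>n\<close> of the edges. On a union of triangles the field \<open>\<eta> w\<close> may be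
  replaced near each edge by its normal component, whose norm is at most 1, up to an error concentrated near
  the vertices of the triangulation. Hence the integral of \<open>div (\<eta> w)\<close> over any such set is bounded by its
  perimeter, and this bound passes to the limit. Both bounds agree, so
  \<open>\<phi> x = max \<bar>x\<^sub>1\<bar> \<bar>x\<^sub>2\<bar> + (sqrt 2 - 1) min \<bar>x\<^sub>1\<bar> \<bar>x\<^sub>2\<bar>\<close>, whose unit ball and Wulff shape are octagons.\<close>

section \<open>One-dimensional Hausdorff measure\<close>

text \<open>The definitions dictate the route: \<open>total_variation\<close> and
  \<open>normal_vector\<close> are given by \<open>THE\<close> and \<open>Lim\<close>, so they can
  be evaluated only where the polar decomposition is known and unique. Half squares have a constant
  normal, which reduces uniqueness to one fixed vector, and they suffice: their conormals meet every
  ray, and \<open>\<phi>\<close> is homogeneous. The liminf inequality along explicit staircases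
  bounds \<open>\<phi>\<close> from above. From below the recovery sequence is unknown, so an
  estimate is needed that holds for every triangulated set at each fixed \<open>k\<close>. The
  obstacle there is that the perimeter admits only C^1 fields, whereas the normal component of
  \<open>w\<close> jumps where edges of different directions meet. Smoothing at scale
  \<open>\<epsilon>\<close> costs gradients of order \<open>k / \<epsilon>\<close>, but only on an
  area of order \<open>\<epsilon>^2\<close>, since vertices have codimension two; with
  \<open>k\<close> fixed the error vanishes with \<open>\<epsilon>\<close>. The constant
  \<open>sqrt 2 - 1\<close> is the extra length, per unit of \<open>x_j\<close>, of a diagonal over
  a straight edge; it is also the tangent of \<open>pi / 8\<close>.\<close>

text \<open>Caratheodory's criterion for metric outer measures. The set \<open>B n\<close>, the part
  of \<open>A\<close> at distance more than \<open>1 / (n + 1)\<close> from \<open>C\<close>, is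
  separated from \<open>C\<close>; what remains of \<open>A - C\<close> lies in the shells
  \<open>R m\<close> with \<open>m >= n\<close>, and their measures are the tail of a convergent
  series.\<close>

lemma metric_outer_measure_closed:
  fixes H :: "'a::metric_space set \<Rightarrow> ennreal"
  assumes oms: "outer_measure_space UNIV H"
    and sep: "\<And>A B r. r > 0 \<Longrightarrow> (\<And>x y. x \<in> A \<Longrightarrow> y \<in> B \<Longrightarrow> r \<le> dist x y) \<Longrightarrow> H A + H B \<le> H (A \<union> B)"
    and C: "closed C"
  shows "H (A \<inter> C) + H (A - C) \<le> H A"
proof (cases "C = {} \<or> H A = \<infinity>")
  case True
  have "H {} = 0" using oms by (simp add: outer_measure_space_def positive_def)
  with True show ?thesis by auto
next
  case False
  then have C0: "C \<noteq> {}" and fin: "H A < \<infinity>" by (auto simp: top.not_eq_extremum)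
  have mono: "H X \<le> H Y" if "X \<subseteq> Y" for X Y
    using oms that by (auto simp: outer_measure_space_def increasing_def)
  have empty: "H {} = 0" using oms by (simp add: outer_measure_space_def positive_def)
  have csub: "H (\<Union>i. F i) \<le> (\<Sum>i. H (F i))" for F :: "nat \<Rightarrow> 'a set"
  proof -
    have "H (\<Union>i. F i) = H (\<Union>i. disjointed F i)" by (simp add: UN_disjointed_eq)
    also have "\<dots> \<le> (\<Sum>i. H (disjointed F i))"
      using oms disjoint_family_disjointed[of F]
      by (auto simp: outer_measure_space_def countably_subadditive_def)
    also have "\<dots> \<le> (\<Sum>i. H (F i))"
      by (intro suminf_le mono disjointed_subset) auto
    finally show ?thesis .
  qed
  define f where "f x = infdist x C" for x
  have lip: "f x \<le> f y + dist x y" for x y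
    unfolding f_def by (rule infdist_triangle)
  have f0: "f x = 0 \<longleftrightarrow> x \<in> C" for x
    unfolding f_def using C C0 by (simp add: in_closed_iff_infdist_zero)
  have f0': "f x \<ge> 0" for x unfolding f_def by (rule infdist_nonneg)
  define B where "B n = {x \<in> A. f x > 1 / real (n + 1)}" for n
  define R where "R n = {x \<in> A. 1 / real (n + 2) < f x \<and> f x \<le> 1 / real (n + 1)}" for n
  \<comment> \<open>Shells two steps apart have positive distance, so the sums over even and over
    odd indices are each bounded by \<open>H A\<close>.\<close>
  have partial: "(\<Sum>i<N. H (R (2 * i + j))) \<le> H (\<Union>i<N. R (2 * i + j))" for N j
  proof (induction N)
    case 0 then show ?case by simp
  next
    case (Suc N)
    have "H (\<Union>i<N. R (2 * i + j)) + H (R (2 * N + j)) \<le> H ((\<Union>i<N. R (2 * i + j)) \<union> R (2 * N + j))"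
    proof (rule sep)
      let ?r = "1 / real (2 * N + j) - 1 / real (2 * N + j + 1)"
      \<comment> \<open>For \<open>2 * N + j = 0\<close> the value \<open>1 / 0 = 0\<close> makes
        \<open>?r\<close> negative; the union is then empty, so any positive distance will
        do.\<close>
      let ?r' = "if 2 * N + j = 0 then 1 else ?r"
      show "0 < ?r'" by (auto simp: field_simps)
      fix x y assume x: "x \<in> (\<Union>i<N. R (2 * i + j))" and y: "y \<in> R (2 * N + j)"
      then obtain i where i: "i < N" "x \<in> R (2 * i + j)" by blast
      have "1 / real (2 * N + j) \<le> 1 / real (2 * i + j + 2)"
        using i by (intro divide_left_mono) auto
      moreover have "f x \<le> f y + dist x y" by (rule lip)
      ultimately show "?r' \<le> dist x y" using i y by (auto simp: R_def)
    qed
    moreover have "(\<Union>i<Suc N. R (2 * i + j)) = (\<Union>i<N. R (2 * i + j)) \<union> R (2 * N + j)"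
      by (auto simp: lessThan_Suc)
    ultimately show ?case
      unfolding sum.lessThan_Suc by (simp only: order_trans[OF add_right_mono[OF Suc]])
  qed
  have "(\<Sum>i. H (R (2 * i + j))) \<le> H A" for j
    by (intro suminf_le_const summableI order_trans[OF partial] mono) (auto simp: R_def)
  from this[of 0] this[of 1]
  have bd: "(\<Sum>i. H (R (2 * i))) \<le> H A" "(\<Sum>i. H (R (2 * i + 1))) \<le> H A" by auto
  have split2: "(\<Sum>i<2 * N. H (R i)) = (\<Sum>i<N. H (R (2 * i))) + (\<Sum>i<N. H (R (2 * i + 1)))" for N
    by (induction N) (auto simp: ac_simps)
  have "(\<Sum>i. H (R i)) \<le> H A + H A"
  proof (intro suminf_le_const summableI)
    fix N
    have "(\<Sum>i<N. H (R i)) \<le> (\<Sum>i<2 * N. H (R i))" by (intro sum_mono2) auto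
    also have "\<dots> \<le> (\<Sum>i. H (R (2 * i))) + (\<Sum>i. H (R (2 * i + 1)))"
      unfolding split2 by (intro add_mono sum_le_suminf summableI) auto
    also have "\<dots> \<le> H A + H A" by (intro add_mono bd)
    finally show "(\<Sum>i<N. H (R i)) \<le> H A + H A" .
  qed
  with fin have Rfin: "(\<Sum>i. H (R i)) < \<infinity>"
    by (metis ennreal_add_less_top infinity_ennreal_def le_less_trans)
  have cover: "A - C \<subseteq> B n \<union> (\<Union>m. R (m + n))" for n
  proof
    fix x assume x: "x \<in> A - C"
    then have "f x > 0" using f0 f0' by (metis DiffD2 less_eq_real_def)
    show "x \<in> B n \<union> (\<Union>m. R (m + n))"
    proof (cases "x \<in> B n")
      case False
      then have le: "f x \<le> 1 / real (n + 1)" using x by (auto simp: B_def)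
      define m where "m = nat (\<lfloor>1 / f x\<rfloor> - 1)"
      have "real (n + 1) \<le> 1 / f x" using le \<open>f x > 0\<close> by (simp add: field_simps)
      then have fl: "int n + 1 \<le> \<lfloor>1 / f x\<rfloor>" by (simp add: le_floor_iff)
      then have m: "int m = \<lfloor>1 / f x\<rfloor> - 1" "m \<ge> n" unfolding m_def by linarith+
      have "real m + 1 \<le> 1 / f x" "1 / f x < real m + 2"
        using m(1) by linarith+
      then have "x \<in> R m" using x \<open>f x > 0\<close> by (auto simp: R_def field_simps)
      then show ?thesis using m(2) by (metis UN_I UnI2 UNIV_I le_add_diff_inverse2)
    qed simp
  qed
  have step: "H (A \<inter> C) + H (A - C) \<le> H A + (\<Sum>m. H (R (m + n)))" for n
  proof -
    have "H (A - C) \<le> H (B n \<union> (\<Union>m. R (m + n)))" by (intro mono cover)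
    also have "B n \<union> (\<Union>m. R (m + n)) = (\<Union>m. case m of 0 \<Rightarrow> B n | Suc m \<Rightarrow> R (m + n))"
      by (auto split: nat.splits)
    also have "H \<dots> \<le> (\<Sum>m. H (case m of 0 \<Rightarrow> B n | Suc m \<Rightarrow> R (m + n)))" by (rule csub)
    also have "\<dots> = H (B n) + (\<Sum>m. H (R (m + n)))"
      by (subst suminf_offset[of _ 1]) (auto intro: summableI)
    finally have "H (A \<inter> C) + H (A - C) \<le> H (A \<inter> C) + (H (B n) + (\<Sum>m. H (R (m + n))))"
      by (rule add_left_mono)
    also have "\<dots> = (H (A \<inter> C) + H (B n)) + (\<Sum>m. H (R (m + n)))" by (simp add: ac_simps)
    also have "H (A \<inter> C) + H (B n) \<le> H ((A \<inter> C) \<union> B n)"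
    proof (rule sep)
      show "1 / real (n + 1) > 0" by simp
      fix x y assume "x \<in> A \<inter> C" "y \<in> B n"
      then show "1 / real (n + 1) \<le> dist x y"
        using lip[of y x] f0[of x] by (auto simp: B_def dist_commute)
    qed
    also have "H ((A \<inter> C) \<union> B n) \<le> H A" by (intro mono) (auto simp: B_def)
    finally show ?thesis by (simp add: add_right_mono)
  qed
  have "(\<lambda>n. (\<Sum>m. H (R (m + n)))) \<longlonglongrightarrow> 0"
  proof -
    \<comment> \<open>The finite total allows passing to a summable real series, whose tails
      vanish.\<close>
    define r where "r i = enn2real (H (R i))" for i
    have lt: "H (R i) < \<infinity>" for i
      by (metis Rfin ennreal_suminf_lessD infinity_ennreal_def)
    have r: "H (R i) = ennreal (r i)" "r i \<ge> 0" for i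
      unfolding r_def using lt[of i] by (auto simp: less_top)
    have sm: "summable r"
      using Rfin r by (intro summable_suminf_not_top) auto
    have eq: "(\<Sum>m. H (R (m + n))) = ennreal (\<Sum>m. r (m + n))" for n
      unfolding r using r(2) sm by (intro suminf_ennreal2) (auto simp: summable_iff_shift)
    have "(\<lambda>n. \<Sum>m. r (m + n)) \<longlonglongrightarrow> 0"
      using suminf_exist_split2[OF sm] by simp
    then show ?thesis unfolding eq by (intro tendsto_ennrealI[where x=0, simplified])
  qed
  then have "(\<lambda>n. H A + (\<Sum>m. H (R (m + n)))) \<longlonglongrightarrow> H A + 0"
    by (intro tendsto_add) auto
  then show ?thesis
    using step by (intro LIMSEQ_le_const[where X="\<lambda>n. H A + (\<Sum>m. H (R (m + n)))"]) auto
qed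

text \<open>The measurable sets in Caratheodory's sense form a sigma-algebra, so it is enough to
  treat the closed sets, which generate the Borel sets.\<close>

lemma borel_subset_lambda_system:
  fixes H :: "'a::metric_space set \<Rightarrow> ennreal"
  assumes oms: "outer_measure_space UNIV H"
    and sep: "\<And>A B r. r > 0 \<Longrightarrow> (\<And>x y. x \<in> A \<Longrightarrow> y \<in> B \<Longrightarrow> r \<le> dist x y) \<Longrightarrow> H A + H B \<le> H (A \<union> B)"
  shows "sets borel \<subseteq> lambda_system UNIV UNIV H"
proof -
  interpret s: sigma_algebra UNIV "UNIV :: 'a set set"
    using sigma_algebra_Pow[of UNIV] by simp
  have "measure_space UNIV (lambda_system UNIV UNIV H) H"
    by (rule s.caratheodory_lemma[OF oms])
  then interpret l: sigma_algebra UNIV "lambda_system UNIV UNIV H"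
    by (simp add: measure_space_def)
  have sub: "subadditive UNIV H"
    using oms by (intro s.countably_subadditive_subadditive) (auto simp: outer_measure_space_def)
  have "C \<in> lambda_system UNIV UNIV H" if "closed C" for C
  proof -
    have "H (X \<inter> C) + H (X - C) = H X" for X
    proof (rule antisym)
      show "H (X \<inter> C) + H (X - C) \<le> H X"
        by (rule metric_outer_measure_closed[OF oms _ that]) (rule sep)
      have "H X = H ((X \<inter> C) \<union> (X - C))" by (simp add: Int_Diff_Un)
      also have "\<dots> \<le> H (X \<inter> C) + H (X - C)"
        using sub by (intro subadditiveD) auto
      finally show "H X \<le> H (X \<inter> C) + H (X - C)" .
    qed
    then show ?thesis by (simp add: s.lambda_system_eq)
  qed
  then have "sigma_sets UNIV {C. closed C} \<subseteq> lambda_system UNIV UNIV H"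
    by (intro l.sigma_sets_subset) auto
  then show ?thesis by (simp add: borel_eq_closed)
qed

section \<open>Size-restricted covers and the outer measure they generate\<close>

lemma hausdorff1_pre_le:
  assumes "A \<subseteq> (\<Union>i. C i)" "\<And>i. bounded (C i)" "\<And>i. diameter (C i) \<le> \<delta>"
  shows "hausdorff1_pre \<delta> A \<le> (\<Sum>i. ennreal (diameter (C i)))"
  unfolding hausdorff1_pre_def using assms by (intro INF_lower) auto

lemma hausdorff1_pre_antimono: "\<delta> \<le> \<delta>' \<Longrightarrow> hausdorff1_pre \<delta>' A \<le> hausdorff1_pre \<delta> A"
  unfolding hausdorff1_pre_def by (intro INF_superset_mono) (auto intro: order_trans)

lemma hausdorff1_pre_mono: "A \<subseteq> B \<Longrightarrow> hausdorff1_pre \<delta> A \<le> hausdorff1_pre \<delta> B"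
  unfolding hausdorff1_pre_def by (intro INF_superset_mono) auto

text \<open>Covers of \<open>A n\<close> that exceed the infimum by less than
  \<open>e / 2^(n+1)\<close> are merged into one sequence through \<open>prod_decode\<close>; the
  excesses add up to \<open>e\<close>.\<close>

lemma hausdorff1_pre_UN:
  "hausdorff1_pre \<delta> (\<Union>i. A i) \<le> (\<Sum>i::nat. hausdorff1_pre \<delta> (A i))"
proof (rule ennreal_le_epsilon)
  fix e :: real assume e: "0 < e" and fin: "(\<Sum>n. hausdorff1_pre \<delta> (A n)) < top"
  let ?O = "hausdorff1_pre \<delta>"
  have "\<exists>C. A n \<subseteq> (\<Union>i. C i) \<and> (\<forall>i. bounded (C i) \<and> diameter (C i) \<le> \<delta>) \<and>
      (\<Sum>i::nat. ennreal (diameter (C i))) < ?O (A n) + e * (1/2)^Suc n" for n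
  proof -
    have "?O (A n) < ?O (A n) + e * (1/2)^Suc n"
      using e fin by (auto simp add: less_top dest!: ennreal_suminf_lessD)
    then show ?thesis
      by (subst (asm) hausdorff1_pre_def) (auto simp: INF_less_iff)
  qed
  then obtain B where B: "\<And>n. A n \<subseteq> (\<Union>i. B n i)" "\<And>n i. bounded (B n i)" "\<And>n i. diameter (B n i) \<le> \<delta>"
    "\<And>n. (\<Sum>i::nat. ennreal (diameter (B n i))) < ?O (A n) + e * (1/2)^Suc n"
    by metis
  define C where "C = case_prod B o prod_decode"
  have "?O (\<Union>i. A i) \<le> (\<Sum>i. ennreal (diameter (C i)))"
  proof (rule hausdorff1_pre_le)
    show "(\<Union>i. A i) \<subseteq> (\<Union>i. C i)"
      using B(1) by (auto simp add: C_def subset_eq) (metis prod.case prod_encode_inverse)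
  qed (use B in \<open>auto simp: C_def split: prod.splits\<close>)
  also have "\<dots> = (\<Sum>n. \<Sum>i. ennreal (diameter (B n i)))"
    unfolding C_def comp_def by (intro suminf_ennreal_2dimen[where f="\<lambda>x. ennreal (diameter (case_prod B x))"]) simp
  also have "\<dots> \<le> (\<Sum>n. ?O (A n) + e * (1/2) ^ Suc n)"
    using B(4) by (intro suminf_le) (auto intro: less_imp_le summableI)
  also have "... = (\<Sum>n. ?O (A n)) + (\<Sum>n. ennreal e * ennreal ((1/2) ^ Suc n))"
    using \<open>0 < e\<close> by (subst suminf_add[symmetric])
                     (auto simp del: ennreal_suminf_cmult simp add: ennreal_mult[symmetric])
  also have "\<dots> = (\<Sum>n. ?O (A n)) + e"
    unfolding ennreal_suminf_cmult
    by (subst suminf_ennreal_eq[OF zero_le_power power_half_series]) auto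
  finally show "?O (\<Union>i. A i) \<le> (\<Sum>n. ?O (A n)) + e" .
qed

text \<open>A covering set of diameter at most \<open>\<delta> < r\<close> cannot meet both
  \<open>A\<close> and \<open>B\<close>, so a cover of the union splits into two covers that share
  no nonempty member. A member missing \<open>A\<close> (or \<open>B\<close>) is replaced by the
  empty set, of diameter 0.\<close>

lemma hausdorff1_pre_separated:
  assumes \<delta>: "0 \<le> \<delta>" "\<delta> < r" and AB: "\<And>x y. x \<in> A \<Longrightarrow> y \<in> B \<Longrightarrow> r \<le> dist x y"
  shows "hausdorff1_pre \<delta> A + hausdorff1_pre \<delta> B \<le> hausdorff1_pre \<delta> (A \<union> B)"
  unfolding hausdorff1_pre_def[of \<delta> "A \<union> B"]
proof (rule INF_greatest)
  fix C :: "nat \<Rightarrow> 'a set"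
  assume "C \<in> {C. A \<union> B \<subseteq> (\<Union>i. C i) \<and> (\<forall>i. bounded (C i) \<and> diameter (C i) \<le> \<delta>)}"
  then have C: "A \<union> B \<subseteq> (\<Union>i. C i)" "\<And>i. bounded (C i)" "\<And>i. diameter (C i) \<le> \<delta>" by auto
  define D where "D X i = (if C i \<inter> X = {} then {} else C i)" for X i
  have "hausdorff1_pre \<delta> A \<le> (\<Sum>i. ennreal (diameter (D A i)))"
    using C \<delta> by (intro hausdorff1_pre_le) (auto simp: D_def subset_iff, blast)
  moreover have "hausdorff1_pre \<delta> B \<le> (\<Sum>i. ennreal (diameter (D B i)))"
    using C \<delta> by (intro hausdorff1_pre_le) (auto simp: D_def subset_iff, blast)
  ultimately have "hausdorff1_pre \<delta> A + hausdorff1_pre \<delta> B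
      \<le> (\<Sum>i. ennreal (diameter (D A i))) + (\<Sum>i. ennreal (diameter (D B i)))"
    by (rule add_mono)
  also have "\<dots> = (\<Sum>i. ennreal (diameter (D A i)) + ennreal (diameter (D B i)))"
    by (intro suminf_add summableI)
  also have "\<dots> \<le> (\<Sum>i. ennreal (diameter (C i)))"
  proof (intro suminf_le summableI)
    fix i
    have "C i \<inter> A = {} \<or> C i \<inter> B = {}"
    proof (rule ccontr)
      assume "\<not> ?thesis"
      then obtain x y where xy: "x \<in> C i" "x \<in> A" "y \<in> C i" "y \<in> B" by blast
      then have "dist x y \<le> diameter (C i)" using C(2) by (intro diameter_bounded_bound)
      then show False using AB[of x y] xy C(3)[of i] \<delta> by auto
    qed
    then show "ennreal (diameter (D A i)) + ennreal (diameter (D B i)) \<le> ennreal (diameter (C i))"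
      by (auto simp: D_def)
  qed
  finally show "hausdorff1_pre \<delta> A + hausdorff1_pre \<delta> B \<le> (\<Sum>i. ennreal (diameter (C i)))" .
qed

lemma hausdorff1_outer_separated:
  assumes r: "r > 0" and AB: "\<And>x y. x \<in> A \<Longrightarrow> y \<in> B \<Longrightarrow> r \<le> dist x y"
  shows "hausdorff1_outer A + hausdorff1_outer B \<le> hausdorff1_outer (A \<union> B)"
proof -
  have "hausdorff1_pre \<delta> A + hausdorff1_pre \<delta>' B \<le> hausdorff1_outer (A \<union> B)"
    if "\<delta> > 0" "\<delta>' > 0" for \<delta> \<delta>'
  proof -
    \<comment> \<open>The two suprema are tested at independent scales; passing to a common one
      below \<open>r\<close> only increases both values.\<close>
    let ?d = "min (min \<delta> \<delta>') (r / 2)"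
    have "hausdorff1_pre \<delta> A + hausdorff1_pre \<delta>' B \<le> hausdorff1_pre ?d A + hausdorff1_pre ?d B"
      by (intro add_mono hausdorff1_pre_antimono) auto
    also have "\<dots> \<le> hausdorff1_pre ?d (A \<union> B)"
      using that r AB by (intro hausdorff1_pre_separated[where r=r]) auto
    also have "\<dots> \<le> hausdorff1_outer (A \<union> B)"
      unfolding hausdorff1_outer_def using that r by (intro SUP_upper) auto
    finally show ?thesis .
  qed
  then have "(SUP \<delta>\<in>{0<..}. hausdorff1_pre \<delta> A + hausdorff1_outer B) \<le> hausdorff1_outer (A \<union> B)"
    unfolding hausdorff1_outer_def[of B]
  proof (intro SUP_least)
    fix \<delta> :: real assume "\<delta> \<in> {0<..}"
    then show "hausdorff1_pre \<delta> A + (SUP \<delta>\<in>{0<..}. hausdorff1_pre \<delta> B) \<le> hausdorff1_outer (A \<union> B)"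
      using \<open>\<And>\<delta> \<delta>'. \<lbrakk>0 < \<delta>; 0 < \<delta>'\<rbrakk> \<Longrightarrow> _\<close>
      by (subst ennreal_SUP_add_right) (auto intro!: SUP_least exI[of _ 1])
  qed
  moreover have "(SUP \<delta>\<in>{0<..}. hausdorff1_pre \<delta> A + hausdorff1_outer B) = hausdorff1_outer A + hausdorff1_outer B"
    unfolding hausdorff1_outer_def[of A]
    by (subst ennreal_SUP_add_left) auto
  ultimately show ?thesis by simp
qed

lemma outer_measure_space_hausdorff1: "outer_measure_space UNIV (hausdorff1_outer :: 'a::metric_space set \<Rightarrow> ennreal)"
  unfolding outer_measure_space_def
proof (intro conjI)
  have "hausdorff1_pre \<delta> ({} :: 'a set) = 0" if "\<delta> > 0" for \<delta>
    using hausdorff1_pre_le[of "{}" "\<lambda>_. {} :: 'a set" \<delta>] that by auto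
  then show "positive UNIV (hausdorff1_outer :: 'a set \<Rightarrow> ennreal)"
    by (auto simp: positive_def hausdorff1_outer_def)
  show "increasing UNIV (hausdorff1_outer :: 'a set \<Rightarrow> ennreal)"
    by (auto simp: increasing_def hausdorff1_outer_def intro!: SUP_mono hausdorff1_pre_mono)
  show "countably_subadditive UNIV (hausdorff1_outer :: 'a set \<Rightarrow> ennreal)"
    unfolding countably_subadditive_def
  proof (intro allI impI)
    fix A :: "nat \<Rightarrow> 'a set"
    show "hausdorff1_outer (\<Union>i. A i) \<le> (\<Sum>i. hausdorff1_outer (A i))"
      unfolding hausdorff1_outer_def[of "\<Union>i. A i"]
    proof (rule SUP_least)
      fix \<delta> :: real assume "\<delta> \<in> {0<..}"
      then have "hausdorff1_pre \<delta> (A i) \<le> hausdorff1_outer (A i)" for i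
        unfolding hausdorff1_outer_def by (intro SUP_upper)
      then show "hausdorff1_pre \<delta> (\<Union>i. A i) \<le> (\<Sum>i. hausdorff1_outer (A i))"
        by (intro order_trans[OF hausdorff1_pre_UN] suminf_le summableI)
    qed
  qed
qed

lemma sets_hausdorff1 [simp, measurable_cong]: "sets hausdorff1 = sets borel"
  unfolding hausdorff1_def using sets.sigma_sets_eq[of borel] by (simp add: sets_measure_of_conv)

lemma emeasure_hausdorff1:
  assumes "A \<in> sets borel"
  shows "emeasure hausdorff1 A = hausdorff1_outer A"
proof (rule emeasure_measure_of[OF hausdorff1_def])
  interpret s: sigma_algebra UNIV "UNIV :: 'a set set"
    using sigma_algebra_Pow[of UNIV] by simp
  have ms: "measure_space UNIV (lambda_system UNIV UNIV hausdorff1_outer) (hausdorff1_outer :: 'a set \<Rightarrow> ennreal)"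
    by (rule s.caratheodory_lemma[OF outer_measure_space_hausdorff1])
  have "sets borel \<subseteq> lambda_system UNIV UNIV (hausdorff1_outer :: 'a set \<Rightarrow> ennreal)"
    by (rule borel_subset_lambda_system[OF outer_measure_space_hausdorff1 hausdorff1_outer_separated])
  from measure_down[OF ms _ this]
  have "measure_space UNIV (sets borel) (hausdorff1_outer :: 'a set \<Rightarrow> ennreal)"
    using sets.sigma_algebra_axioms[of borel] by simp
  then show "positive (sets hausdorff1) (hausdorff1_outer :: 'a set \<Rightarrow> ennreal)"
    "countably_additive (sets hausdorff1) (hausdorff1_outer :: 'a set \<Rightarrow> ennreal)"
    by (auto simp: measure_space_def)
qed (use assms in auto)

text \<open>\<open>p\<close> is a similarity with ratio \<open>L\<close>. From above, the interval
  is cut into \<open>N\<close> equal pieces; from below, a cover is pulled back to the line, where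
  subadditivity of Lebesgue measure applies.\<close>

lemma hausdorff1_outer_segment:
  fixes p :: "real \<Rightarrow> 'a::metric_space"
  assumes p: "\<And>s t. dist (p s) (p t) = L * \<bar>s - t\<bar>"
  shows "hausdorff1_outer (p ` {0<..<1}) = ennreal L"
proof (rule antisym)
  have "0 \<le> L * \<bar>1 - 0::real\<bar>" using zero_le_dist[of "p 1" "p 0"] unfolding p .
  then have L: "L \<ge> 0" by simp
  have dm: "bounded (p ` X)" "diameter (p ` X) \<le> L * d"
    if "\<And>s t. s \<in> X \<Longrightarrow> t \<in> X \<Longrightarrow> \<bar>s - t\<bar> \<le> d" "d \<ge> 0" for X d
  proof -
    have *: "dist x y \<le> L * d" if "x \<in> p ` X" "y \<in> p ` X" for x y
      using that \<open>\<And>s t. s \<in> X \<Longrightarrow> t \<in> X \<Longrightarrow> \<bar>s - t\<bar> \<le> d\<close> L by (auto simp: p intro!: mult_left_mono)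
    then show "bounded (p ` X)" using bounded_two_points by blast
    show "diameter (p ` X) \<le> L * d"
      unfolding diameter_def using L that(2) * by (auto intro!: cSUP_least)
  qed
  show "hausdorff1_outer (p ` {0<..<1}) \<le> ennreal L"
    unfolding hausdorff1_outer_def
  proof (rule SUP_least)
    fix \<delta> :: real assume "\<delta> \<in> {0<..}"
    then have \<delta>: "\<delta> > 0" by simp
    obtain N :: nat where N: "N > 0" "L / N \<le> \<delta>"
    proof -
      obtain N :: nat where "L / \<delta> < N" using reals_Archimedean2 by blast
      then have "L / Suc N \<le> \<delta>" using \<delta> by (simp add: field_simps)
      then show ?thesis using that by blast
    qed
    define I where "I i = (if i < N then {real i / N..real (i + 1) / N} else {})" for i
    have I: "\<bar>s - t\<bar> \<le> 1 / N" if "s \<in> I i" "t \<in> I i" for s t i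
    proof -
      have "real i / N \<le> s" "s \<le> real (i + 1) / N" "real i / N \<le> t" "t \<le> real (i + 1) / N"
        using that by (auto simp: I_def split: if_splits)
      moreover have "real (i + 1) / N = real i / N + 1 / N" by (simp add: add_divide_distrib)
      ultimately show ?thesis by linarith
    qed
    have "hausdorff1_pre \<delta> (p ` {0<..<1}) \<le> (\<Sum>i. ennreal (diameter (p ` I i)))"
    proof (rule hausdorff1_pre_le)
      show "p ` {0<..<1} \<subseteq> (\<Union>i. p ` I i)"
      proof
        fix x assume "x \<in> p ` {0<..<1}"
        then obtain s where s: "0 < s" "s < 1" "x = p s" by auto
        define i where "i = nat \<lfloor>N * s\<rfloor>"
        have i: "real i \<le> N * s" "N * s < real i + 1"
        proof -
          have "real i = of_int \<lfloor>N * s\<rfloor>" unfolding i_def using s by simp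
          then show "real i \<le> N * s" "N * s < real i + 1" by linarith+
        qed
        moreover have "N * s < N" using s N by simp
        ultimately have "i < N" by linarith
        then have "s \<in> I i" using i N by (auto simp: I_def field_simps)
        then show "x \<in> (\<Union>i. p ` I i)" using s by blast
      qed
      fix i
      show "bounded (p ` I i)" using I by (rule dm[where d = "1 / N"]) simp_all
      show "diameter (p ` I i) \<le> \<delta>" using dm(2)[of "I i" "1 / N"] I N by force
    qed
    also have "\<dots> = (\<Sum>i<N. ennreal (diameter (p ` I i)))"
      by (rule suminf_finite) (auto simp: I_def)
    also have "\<dots> \<le> (\<Sum>i<N. ennreal (L * (1 / N)))"
      using I by (intro sum_mono ennreal_leI dm) auto
    also have "\<dots> = ennreal L" using N L by (simp add: ennreal_of_nat_eq_real_of_nat flip: ennreal_mult)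
    finally show "hausdorff1_pre \<delta> (p ` {0<..<1}) \<le> ennreal L" .
  qed
  \<comment> \<open>The estimate from below holds for covers of any mesh, so a single scale is
    enough.\<close>
  have "ennreal L \<le> hausdorff1_pre 1 (p ` {0<..<1})"
    unfolding hausdorff1_pre_def
  proof (rule INF_greatest)
    fix C :: "nat \<Rightarrow> 'a set"
    assume "C \<in> {C. p ` {0<..<1} \<subseteq> (\<Union>i. C i) \<and> (\<forall>i. bounded (C i) \<and> diameter (C i) \<le> 1)}"
    then have C: "p ` {0<..<1} \<subseteq> (\<Union>i. C i)" "\<And>i. bounded (C i)" by auto
    show "ennreal L \<le> (\<Sum>i. ennreal (diameter (C i)))"
    proof (cases "L = 0")
      case False
      with L have L: "L > 0" by simp
      define d where "d i = diameter (C i)" for i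
      have d0: "d i \<ge> 0" for i unfolding d_def using C(2) by (rule diameter_ge_0)
      \<comment> \<open>The preimage of \<open>C i\<close> has diameter at most
        \<open>d i / L\<close>, so it is contained in the interval of that length starting at its
        infimum. If \<open>C i\<close> misses the curve, \<open>Inf\<close> would carry no
        information and \<open>J i\<close> is empty.\<close>
      define J where "J i = (if \<exists>s. p s \<in> C i then (let s = (SOME s. p s \<in> C i) in {Inf {s. p s \<in> C i}..Inf {s. p s \<in> C i} + d i / L}) else {})" for i
      have J: "s \<in> J i" if s: "p s \<in> C i" for s i
      proof -
        have *: "\<bar>s - t\<bar> \<le> d i / L" if "p t \<in> C i" for t
          using diameter_bounded_bound[OF C(2) s that] L by (simp add: p d_def field_simps)
        have bb: "bdd_below {s. p s \<in> C i}"
          using * by (intro bdd_belowI[of _ "s - d i / L"]) (force simp: abs_le_iff)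
        have "Inf {s. p s \<in> C i} \<le> s" using s bb by (intro cInf_lower) auto
        moreover have "s - d i / L \<le> Inf {s. p s \<in> C i}"
          using s * by (intro cInf_greatest) (force simp: abs_le_iff)+
        ultimately show ?thesis using s by (auto simp: J_def)
      qed
      have Jm: "J i \<in> sets lborel" "emeasure lborel (J i) \<le> ennreal (d i / L)" for i
        using L d0[of i] by (auto simp: J_def Let_def)
      have "ennreal 1 = emeasure lborel {0<..<1::real}" by simp
      also have "\<dots> \<le> emeasure lborel (\<Union>i. J i)"
        using C(1) J Jm by (intro emeasure_mono) (fastforce simp: subset_iff)+
      also have "\<dots> \<le> (\<Sum>i. emeasure lborel (J i))"
        using Jm by (intro emeasure_subadditive_countably) auto
      also have "\<dots> \<le> (\<Sum>i. ennreal (d i / L))" by (intro suminf_le summableI Jm)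
      also have "\<dots> = (\<Sum>i. ennreal (1 / L) * ennreal (d i))"
        using L d0 by (simp flip: ennreal_mult)
      also have "\<dots> = ennreal (1 / L) * (\<Sum>i. ennreal (d i))" by simp
      finally have "ennreal L * ennreal 1 \<le> ennreal L * (ennreal (1 / L) * (\<Sum>i. ennreal (d i)))"
        by (rule mult_left_mono) simp
      also have "\<dots> = (\<Sum>i. ennreal (d i))"
        using L by (simp add: mult.assoc[symmetric] flip: ennreal_mult)
      finally show ?thesis by (simp add: d_def)
    qed simp
  qed
  also have "\<dots> \<le> hausdorff1_outer (p ` {0<..<1})"
    unfolding hausdorff1_outer_def by (intro SUP_upper) auto
  finally show "ennreal L \<le> hausdorff1_outer (p ` {0<..<1})" .
qed

section \<open>The octagon norm and its Wulff shape\<close>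

text \<open>Since \<open>sqrt 2 - 1 < 1\<close>, the maximum selects the term led by the larger
  coordinate. Written as a maximum of two seminorm-like terms, the function is continuous and
  subadditive by inspection.\<close>

definition octagon_norm :: "real^2 \<Rightarrow> real" where
  "octagon_norm x = max (\<bar>x $ 1\<bar> + (sqrt 2 - 1) * \<bar>x $ 2\<bar>) (\<bar>x $ 2\<bar> + (sqrt 2 - 1) * \<bar>x $ 1\<bar>)"

lemma sqrt2_bounds: "1 < sqrt 2" "sqrt 2 < 3/2"
proof -
  show "1 < sqrt 2" by simp
  have "sqrt 2 < sqrt ((3/2)^2)" by (intro real_sqrt_less_mono) (simp add: power2_eq_square)
  then show "sqrt 2 < 3/2" by simp
qed

lemma octagon_norm_scaleR: "octagon_norm (t *\<^sub>R x) = \<bar>t\<bar> * octagon_norm x"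
proof -
  have "\<bar>t\<bar> * max a b = max (\<bar>t\<bar> * a) (\<bar>t\<bar> * b)" for a b
    by (simp add: max_mult_distrib_left)
  then show ?thesis by (simp add: octagon_norm_def abs_mult distrib_left mult.left_commute)
qed

lemma octagon_norm_triangle: "octagon_norm (x + y) \<le> octagon_norm x + octagon_norm y"
proof -
  have *: "(sqrt 2 - 1) * \<bar>a + b\<bar> \<le> (sqrt 2 - 1) * \<bar>a\<bar> + (sqrt 2 - 1) * \<bar>b\<bar>" for a b :: real
    using sqrt2_bounds by (simp add: abs_triangle_ineq mult_left_mono flip: distrib_left)
  show ?thesis
    using *[of "x $ 1" "y $ 1"] *[of "x $ 2" "y $ 2"] abs_triangle_ineq[of "x $ 1" "y $ 1"] abs_triangle_ineq[of "x $ 2" "y $ 2"]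
    unfolding octagon_norm_def vector_add_component
    by (intro max.boundedI
        order_trans[OF _ add_mono[OF max.cobounded1 max.cobounded1]] order_trans[OF _ add_mono[OF max.cobounded2 max.cobounded2]])
      linarith+
qed

lemma continuous_octagon_norm [continuous_intros]: "continuous_on S octagon_norm"
  unfolding octagon_norm_def by (intro continuous_intros)

lemma octagon_vertices:
  "(\<lambda>j. rotate2 (2 * pi * real j / real 8) (vector [1, 0])) ` {..<8} =
    {vector [1, 0], vector [sqrt 2 / 2, sqrt 2 / 2], vector [0, 1], vector [- sqrt 2 / 2, sqrt 2 / 2],
     vector [-1, 0], vector [- sqrt 2 / 2, - sqrt 2 / 2], vector [0, -1], vector [sqrt 2 / 2, - sqrt 2 / 2]}"
proof -
  have v: "rotate2 t (vector [1, 0]) = vector [cos t, sin t]" for t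
    by (simp add: rotate2_def)
  have e: "{..<8} = {0, 1, 2, 3, 4, 5, 6, 7::nat}" by auto
  have a: "3 * pi / 4 = pi - pi / 4" "5 * pi / 4 = pi / 4 + pi" "3 * pi / 2 = pi / 2 + pi"
    "7 * pi / 4 = 2 * pi - pi / 4" by auto
  have c: "cos (3 * pi / 4) = - (sqrt 2 / 2)" "sin (3 * pi / 4) = sqrt 2 / 2"
    "cos (5 * pi / 4) = - (sqrt 2 / 2)" "sin (5 * pi / 4) = - (sqrt 2 / 2)"
    "cos (3 * pi / 2) = 0" "sin (3 * pi / 2) = -1"
    "cos (7 * pi / 4) = sqrt 2 / 2" "sin (7 * pi / 4) = - (sqrt 2 / 2)"
    unfolding a cos_diff sin_diff sin_add cos_add by (simp_all add: cos_45 sin_45)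
  show ?thesis unfolding e by (simp add: v c c[unfolded mult.commute[of _ pi]] cos_45 sin_45)
qed

text \<open>The vertices have norm at most 1, so convexity gives one inclusion. Conversely the norm
  is linear on each sector between an axis and a diagonal: \<open>x\<close> is a combination of the
  two vertices spanning its sector, with nonnegative coefficients whose sum is
  \<open>octagon_norm x\<close>.\<close>

lemma regular_octagon: "regular_polygon 8 (vector [1, 0]) = {x. octagon_norm x \<le> 1}"
proof -
  define V where "V = {vector [1, 0], vector [sqrt 2 / 2, sqrt 2 / 2], vector [0, 1], vector [- sqrt 2 / 2, sqrt 2 / 2],
     vector [-1, 0], vector [- sqrt 2 / 2, - sqrt 2 / 2], vector [0, -1], vector [sqrt 2 / 2, - sqrt 2 / 2] :: real^2}"
  have rp: "regular_polygon 8 (vector [1, 0]) = convex hull V"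
    unfolding regular_polygon_def V_def using octagon_vertices by simp
  have "convex {x. octagon_norm x \<le> 1}"
  proof (rule convexI)
    fix x y :: "real^2" and u v :: real
    assume *: "x \<in> {x. octagon_norm x \<le> 1}" "y \<in> {x. octagon_norm x \<le> 1}" "0 \<le> u" "0 \<le> v" "u + v = 1"
    have "octagon_norm (u *\<^sub>R x + v *\<^sub>R y) \<le> u * octagon_norm x + v * octagon_norm y"
      using octagon_norm_triangle[of "u *\<^sub>R x" "v *\<^sub>R y"] * by (simp add: octagon_norm_scaleR)
    also have "\<dots> \<le> u * 1 + v * 1" using * by (intro add_mono mult_left_mono) auto
    finally show "u *\<^sub>R x + v *\<^sub>R y \<in> {x. octagon_norm x \<le> 1}" using * by simp
  qed
  moreover have "V \<subseteq> {x. octagon_norm x \<le> 1}"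
  proof -
    have "sqrt 2 / 2 + (sqrt 2 - 1) * (sqrt 2 / 2) = 1" by (simp add: field_simps)
    then show ?thesis unfolding V_def using sqrt2_bounds
      by (auto simp: octagon_norm_def abs_if)
  qed
  ultimately have sub: "convex hull V \<subseteq> {x. octagon_norm x \<le> 1}" by (rule hull_minimal[rotated])
  \<comment> \<open>The origin lies in the hull, so the coefficients need only sum to at most
    1.\<close>
  have comb: "a *\<^sub>R v + b *\<^sub>R w \<in> convex hull V"
    if "v \<in> V" "w \<in> V" "0 \<le> a" "0 \<le> b" "a + b \<le> 1" for a b v w
  proof -
    have V: "v \<in> convex hull V" "w \<in> convex hull V" using that by (auto intro: hull_inc)
    have "vector [1, 0] \<in> convex hull V" "vector [-1, 0] \<in> convex hull V" by (auto simp: V_def intro: hull_inc)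
    from convexD[OF convex_convex_hull this, of "1/2" "1/2"]
    have "(1/2) *\<^sub>R vector [1, 0] + (1/2) *\<^sub>R vector [-1, 0] \<in> convex hull V" by simp
    moreover have "(1/2) *\<^sub>R vector [1, 0] + (1/2) *\<^sub>R vector [-1, 0] = (0 :: real^2)"
      by (simp add: vec_eq_iff forall_2)
    ultimately have 0: "0 \<in> convex hull V" by simp
    show ?thesis
      using V 0 that
        convex_sum[of "{0,1,2::nat}" "convex hull V" "\<lambda>i. if i = 0 then 1 - a - b else if i = 1 then a else b"
          "\<lambda>i. if i = 0 then 0 else if i = 1 then v else w"]
      by simp
  qed
  have "x \<in> convex hull V" if x: "octagon_norm x \<le> 1" for x
  proof -
    \<comment> \<open>The signs reflect the vertices into the quadrant of \<open>x\<close>, leaving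
      two sectors instead of eight.\<close>
    define s where "s i = (if x $ i < 0 then -1 else 1 :: real)" for i
    have s: "\<bar>x $ i\<bar> = s i * x $ i" "s i * s i = 1" for i by (auto simp: s_def)
    have le: "\<bar>x $ 1\<bar> + (sqrt 2 - 1) * \<bar>x $ 2\<bar> \<le> 1" "\<bar>x $ 2\<bar> + (sqrt 2 - 1) * \<bar>x $ 1\<bar> \<le> 1"
      using x by (auto simp: octagon_norm_def)
    have VV: "vector [s 1, 0] \<in> V" "vector [0, s 2] \<in> V" "vector [s 1 * (sqrt 2 / 2), s 2 * (sqrt 2 / 2)] \<in> V"
      by (auto simp: V_def s_def)
    show ?thesis
    proof (cases "\<bar>x $ 2\<bar> \<le> \<bar>x $ 1\<bar>")
      case True
      have "x = (\<bar>x $ 1\<bar> - \<bar>x $ 2\<bar>) *\<^sub>R vector [s 1, 0] + (sqrt 2 * \<bar>x $ 2\<bar>) *\<^sub>R vector [s 1 * (sqrt 2 / 2), s 2 * (sqrt 2 / 2)]"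
        by (auto simp: vec_eq_iff forall_2 s_def abs_if field_simps)
      also have "\<dots> \<in> convex hull V"
        using True le VV by (intro comb) (auto simp: algebra_simps)
      finally show ?thesis .
    next
      case False
      have "x = (\<bar>x $ 2\<bar> - \<bar>x $ 1\<bar>) *\<^sub>R vector [0, s 2] + (sqrt 2 * \<bar>x $ 1\<bar>) *\<^sub>R vector [s 1 * (sqrt 2 / 2), s 2 * (sqrt 2 / 2)]"
        by (auto simp: vec_eq_iff forall_2 s_def abs_if field_simps)
      also have "\<dots> \<in> convex hull V"
        using False le VV by (intro comb) (auto simp: algebra_simps)
      finally show ?thesis .
    qed
  qed
  with sub rp show ?thesis by auto
qed

lemma frontier_octagon: "frontier (regular_polygon 8 (vector [1, 0])) = octagon_norm -` {1}"
proof -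
  let ?P = "{x. octagon_norm x \<le> 1}"
  have cl: "closed ?P" by (intro closed_Collect_le continuous_intros)
  have "open {x. octagon_norm x < 1}" by (intro open_Collect_less continuous_intros)
  then have "{x. octagon_norm x < 1} \<subseteq> interior ?P" by (intro interior_maximal) auto
  moreover have "octagon_norm x < 1" if x: "x \<in> interior ?P" for x
  proof -
    obtain e where e: "e > 0" "ball x e \<subseteq> ?P" using x mem_interior[of x ?P] by auto
    show ?thesis
    proof (cases "x = 0")
      case False
      \<comment> \<open>Stretching by \<open>1 + t\<close> moves \<open>x\<close> by
        \<open>e / 2\<close>, so an interior point can be scaled up within the set; by homogeneity
        its norm is below 1.\<close>
      define t where "t = e / (2 * norm x)"
      have t: "t > 0" "dist x ((1 + t) *\<^sub>R x) < e"
      proof -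
        have "dist x ((1 + t) *\<^sub>R x) = norm (- (t *\<^sub>R x))"
          unfolding dist_norm by (rule arg_cong[where f=norm]) (simp add: scaleR_left_distrib)
        then show "dist x ((1 + t) *\<^sub>R x) < e" using False e by (simp add: t_def)
        show "t > 0" using False e by (simp add: t_def)
      qed
      then have "(1 + t) *\<^sub>R x \<in> ?P" using e by auto
      then have *: "(1 + t) * octagon_norm x \<le> 1" using t by (simp add: octagon_norm_scaleR)
      show ?thesis
      proof (rule ccontr)
        assume "\<not> octagon_norm x < 1"
        then have "(1 + t) * 1 \<le> (1 + t) * octagon_norm x" using t by (intro mult_left_mono) auto
        from order_trans[OF this *] t show False by simp
      qed
    qed (simp add: octagon_norm_def)
  qed
  ultimately have "interior ?P = {x. octagon_norm x < 1}" by auto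
  then show ?thesis
    using cl unfolding regular_octagon by (auto simp: frontier_def closure_closed)
qed

text \<open>The vertices of the unit ball of the norm are the axis and diagonal unit vectors.
  Testing with them yields the four strips; conversely these eight constraints imply all others, by
  the summation by parts in \<open>key\<close>.\<close>

lemma wulff_octagon:
  "wulff_shape octagon_norm = {x. \<bar>x $ 1\<bar> \<le> 1 \<and> \<bar>x $ 2\<bar> \<le> 1 \<and> \<bar>x $ 1 + x $ 2\<bar> \<le> sqrt 2 \<and> \<bar>x $ 1 - x $ 2\<bar> \<le> sqrt 2}"
    (is "_ = ?W")
proof (intro set_eqI iffI)
  fix x assume x: "x \<in> ?W"
  have "x \<bullet> n \<le> octagon_norm n" for n
  proof -
    have key: "a * p + b * q \<le> p + (sqrt 2 - 1) * q"
      if "a \<le> 1" "b \<le> 1" "a + b \<le> sqrt 2" "0 \<le> q" "q \<le> p" for a b p q :: real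
    proof -
      have "a * p + b * q = a * (p - q) + (a + b) * q" by (simp add: algebra_simps)
      also have "\<dots> \<le> 1 * (p - q) + sqrt 2 * q"
        using that by (intro add_mono mult_right_mono) auto
      finally show ?thesis by (simp add: algebra_simps)
    qed
    let ?a = "x $ 1 * sgn (n $ 1)" and ?b = "x $ 2 * sgn (n $ 2)"
    have ab: "?a \<le> 1" "?b \<le> 1" "?a + ?b \<le> sqrt 2"
      using x sqrt2_bounds by (auto simp: sgn_if abs_le_iff)
    have "x \<bullet> n = ?a * \<bar>n $ 1\<bar> + ?b * \<bar>n $ 2\<bar>"
      by (simp add: inner_vec_def sum_2 sgn_if abs_if)
    also have "\<dots> \<le> octagon_norm n"
    proof (cases "\<bar>n $ 2\<bar> \<le> \<bar>n $ 1\<bar>")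
      case True
      from key[OF ab _ True] show ?thesis by (auto simp: octagon_norm_def le_max_iff_disj)
    next
      case False
      from key[of ?b ?a "\<bar>n $ 1\<bar>" "\<bar>n $ 2\<bar>"] ab False show ?thesis
        by (auto simp: octagon_norm_def le_max_iff_disj add.commute)
    qed
    finally show ?thesis .
  qed
  then show "x \<in> wulff_shape octagon_norm" by (auto simp: wulff_shape_def)
next
  fix x assume "x \<in> wulff_shape octagon_norm"
  then have W: "x \<bullet> n \<le> octagon_norm n" if "norm n = 1" for n
    using that by (auto simp: wulff_shape_def)
  have n: "norm (vector [a, b] :: real^2) = 1" if "a * a + b * b = 1" for a b
    using that by (simp add: norm_vec_def L2_set_def sum_2 power2_eq_square)
  have e: "\<bar>x $ 1\<bar> \<le> 1" "\<bar>x $ 2\<bar> \<le> 1"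
    using W[OF n, of 1 0] W[OF n, of "-1" 0] W[OF n, of 0 1] W[OF n, of 0 "-1"] sqrt2_bounds
    by (auto simp: octagon_norm_def inner_vec_def sum_2)
  have d: "s * x $ 1 + t * x $ 2 \<le> sqrt 2" if "\<bar>s\<bar> = 1" "\<bar>t\<bar> = 1" for s t
  proof -
    have "s * s = 1" "t * t = 1" using that by (auto simp: abs_if split: if_splits)
    then have "norm (vector [s * (sqrt 2 / 2), t * (sqrt 2 / 2)] :: real^2) = 1"
      by (intro n) (simp add: field_simps)
    from W[OF this] have "(s * x $ 1 + t * x $ 2) * (sqrt 2 / 2) \<le> 1"
      using that by (simp add: octagon_norm_def inner_vec_def sum_2 abs_mult field_simps)
    then have "(s * x $ 1 + t * x $ 2) * (sqrt 2 / 2) * sqrt 2 \<le> 1 * sqrt 2"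
      by (intro mult_right_mono) auto
    then show ?thesis by (simp add: mult.assoc)
  qed
  show "x \<in> ?W"
    using e d[of 1 1] d[of "-1" "-1"] d[of 1 "-1"] d[of "-1" 1] by (auto simp: abs_le_iff)
qed

lemma rotate2_neg_cancel: "rotate2 a (rotate2 (- a) x) = x" "rotate2 (- a) (rotate2 a x) = x"
proof -
  have p: "cos a * (cos a * p) + sin a * (sin a * p) = p" for p
  proof -
    have "cos a * (cos a * p) + sin a * (sin a * p) = ((cos a)\<^sup>2 + (sin a)\<^sup>2) * p"
      by (simp only: distrib_right power2_eq_square mult.assoc)
    then show ?thesis by simp
  qed
  show "rotate2 a (rotate2 (- a) x) = x" "rotate2 (- a) (rotate2 a x) = x"
    by (simp_all add: rotate2_def vec_eq_iff forall_2 algebra_simps) (simp_all only: p simp_thms)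
qed

text \<open>The polygon has circumradius 1, while the Wulff octagon has inradius 1 and sides normal
  to axes and diagonals. An octagon of inradius 1 has circumradius \<open>1 / cos (pi / 8)\<close>,
  whence the dilation factor.\<close>

lemma wulff_octagon_rotation:
  "wulff_shape octagon_norm =
    (\<lambda>x. (1 / cos (pi / 8)) *\<^sub>R x) ` rotate2 (pi / 8) ` regular_polygon 8 (vector [1, 0])"
proof -
  define c s where "c = cos (pi / 8)" and "s = sin (pi / 8)"
  have c: "c > 0" unfolding c_def by (intro cos_gt_zero_pi) auto
  have "c * c - s * s = sqrt 2 / 2"
    using cos_double[of "pi / 8"] by (simp add: c_def s_def cos_45 power2_eq_square)
  moreover have one: "c * c + s * s = 1"
    using sin_cos_squared_add2[of "pi / 8"] by (simp add: c_def s_def power2_eq_square)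
  moreover have cs: "2 * (c * s) = sqrt 2 / 2"
    using sin_double[of "pi / 8"] by (simp add: c_def s_def sin_45 mult.commute)
  ultimately have cc: "c * c = 1/2 + sqrt 2 / 4" "s * s = 1/2 - sqrt 2 / 4" by auto
  \<comment> \<open>This is \<open>tan (pi / 8) = sqrt 2 - 1\<close>, multiplied out.\<close>
  have "c * ((sqrt 2 - 1) * c) = c * s"
  proof -
    have "c * ((sqrt 2 - 1) * c) = (sqrt 2 - 1) * (c * c)" by (simp add: algebra_simps)
    also have "\<dots> = sqrt 2 / 4" unfolding cc by (simp add: field_simps)
    finally show ?thesis using cs by linarith
  qed
  then have t: "(sqrt 2 - 1) * c = s" using c by (metis mult_left_cancel less_irrefl)
  have iff: "octagon_norm (rotate2 (- (pi / 8)) (c *\<^sub>R x)) \<le> 1 \<longleftrightarrow> x \<in> wulff_shape octagon_norm" for x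
  proof -
    let ?z = "rotate2 (- (pi / 8)) x"
    have z: "?z $ 1 = c * x $ 1 + s * x $ 2" "?z $ 2 = c * x $ 2 - s * x $ 1"
      by (auto simp: rotate2_def c_def s_def)
    have lin: "rotate2 (- (pi / 8)) (c *\<^sub>R x) = c *\<^sub>R ?z"
      by (simp add: rotate2_def vec_eq_iff forall_2 algebra_simps)
    \<comment> \<open>By the value of the tangent, each term of the norm is a maximum of absolute
      values of two linear functionals; in the rotated coordinates \<open>?z\<close> these become
      the four strips of \<open>wulff_octagon\<close>.\<close>
    have "c * (\<bar>a\<bar> + (sqrt 2 - 1) * \<bar>b\<bar>) = max \<bar>c * a + s * b\<bar> \<bar>c * a - s * b\<bar>" for a b
    proof -
      have s: "s > 0" unfolding s_def by (intro sin_gt_zero) auto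
      have "c * (\<bar>a\<bar> + (sqrt 2 - 1) * \<bar>b\<bar>) = c * \<bar>a\<bar> + s * \<bar>b\<bar>"
        by (simp add: t[symmetric] algebra_simps)
      also have "\<dots> = \<bar>c * a\<bar> + \<bar>s * b\<bar>" using c s by (simp add: abs_mult)
      finally show ?thesis by linarith
    qed
    then have "c * octagon_norm ?z = max (max \<bar>c * ?z $ 1 + s * ?z $ 2\<bar> \<bar>c * ?z $ 1 - s * ?z $ 2\<bar>)
        (max \<bar>c * ?z $ 2 + s * ?z $ 1\<bar> \<bar>c * ?z $ 2 - s * ?z $ 1\<bar>)"
      using c by (simp add: octagon_norm_def max_mult_distrib_left)
    also have "c * ?z $ 1 + s * ?z $ 2 = (c * c - s * s) * x $ 1 + 2 * (c * s) * x $ 2"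
      unfolding z by (simp add: algebra_simps)
    also have "\<dots> = sqrt 2 / 2 * (x $ 1 + x $ 2)" unfolding cs cc by (simp add: field_simps)
    also have "c * ?z $ 1 - s * ?z $ 2 = (c * c + s * s) * x $ 1"
      unfolding z by (simp add: algebra_simps)
    also have "\<dots> = x $ 1" using one by simp
    also have "c * ?z $ 2 + s * ?z $ 1 = (c * c + s * s) * x $ 2"
      unfolding z by (simp add: algebra_simps)
    also have "\<dots> = x $ 2" using one by simp
    also have "c * ?z $ 2 - s * ?z $ 1 = (c * c - s * s) * x $ 2 - 2 * (c * s) * x $ 1"
      unfolding z by (simp add: algebra_simps)
    also have "\<dots> = - (sqrt 2 / 2 * (x $ 1 - x $ 2))" unfolding cs cc by (simp add: field_simps)
    finally have "c * octagon_norm ?z = max (max \<bar>sqrt 2 / 2 * (x $ 1 + x $ 2)\<bar> \<bar>x $ 1\<bar>)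
        (max \<bar>x $ 2\<bar> \<bar>- (sqrt 2 / 2 * (x $ 1 - x $ 2))\<bar>)" .
    moreover have "\<bar>sqrt 2 / 2 * d\<bar> \<le> 1 \<longleftrightarrow> \<bar>d\<bar> \<le> sqrt 2" for d
    proof -
      have "\<bar>sqrt 2 / 2 * d\<bar> = \<bar>d\<bar> / sqrt 2" by (simp add: abs_mult field_simps)
      then show ?thesis by (simp only: divide_le_eq_1_pos[of "sqrt 2"] real_sqrt_gt_0_iff zero_less_numeral)
    qed
    ultimately show ?thesis
      using c unfolding lin wulff_octagon by (auto simp: octagon_norm_scaleR)
  qed
  show ?thesis
  proof (intro set_eqI iffI)
    fix x assume "x \<in> wulff_shape octagon_norm"
    then have "rotate2 (- (pi / 8)) (c *\<^sub>R x) \<in> regular_polygon 8 (vector [1, 0])"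
      using iff by (simp add: regular_octagon)
    moreover have "x = (1 / cos (pi / 8)) *\<^sub>R rotate2 (pi / 8) (rotate2 (- (pi / 8)) (c *\<^sub>R x))"
      using c by (simp add: rotate2_neg_cancel c_def)
    ultimately show "x \<in> (\<lambda>x. (1 / cos (pi / 8)) *\<^sub>R x) ` rotate2 (pi / 8) ` regular_polygon 8 (vector [1, 0])"
      by (metis imageI)
  next
    fix x assume "x \<in> (\<lambda>x. (1 / cos (pi / 8)) *\<^sub>R x) ` rotate2 (pi / 8) ` regular_polygon 8 (vector [1, 0])"
    then obtain y where y: "octagon_norm y \<le> 1" "x = (1 / c) *\<^sub>R rotate2 (pi / 8) y"
      by (auto simp: regular_octagon c_def)
    then have "rotate2 (- (pi / 8)) (c *\<^sub>R x) = y" using c by (simp add: rotate2_neg_cancel)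
    then show "x \<in> wulff_shape octagon_norm" using iff y by metis
  qed
qed

section \<open>Cutoff functions and scalar test functions\<close>

text \<open>A building block of class C^1: \<open>test_field\<close> asks for one continuous
  derivative, so piecewise polynomials do.\<close>

definition pos_sq :: "real \<Rightarrow> real" where "pos_sq u = (max 0 u)\<^sup>2"

lemma pos_sq_deriv: "(pos_sq has_real_derivative 2 * max 0 u) (at u)"
proof (cases "u = 0")
  case True
  have "((\<lambda>h. pos_sq h / h) \<longlongrightarrow> 0) (at 0)"
  proof (rule Lim_null_comparison)
    show "((\<lambda>h::real. \<bar>h\<bar>) \<longlongrightarrow> 0) (at 0)" by (intro tendsto_eq_intros) auto
    show "\<forall>\<^sub>F h in at 0. norm (pos_sq h / h) \<le> \<bar>h\<bar>"
      by (auto simp: pos_sq_def eventually_at_filter max_def power2_eq_square)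
  qed
  then show ?thesis using True by (simp add: DERIV_def pos_sq_def)
next
  case False
  show ?thesis
  proof (cases "u > 0")
    case True
    have "((\<lambda>u. u\<^sup>2) has_real_derivative 2 * max 0 u) (at u)"
      using True by (auto intro!: derivative_eq_intros)
    moreover have "\<forall>\<^sub>F x in nhds u. x\<^sup>2 = pos_sq x"
      using True by (intro eventually_nhds_in_open[of "{0<..}", THEN eventually_mono]) (auto simp: pos_sq_def)
    ultimately show ?thesis by (subst (asm) DERIV_cong_ev[OF refl _ refl]) auto
  next
    case F2: False
    have "((\<lambda>u::real. 0::real) has_real_derivative 2 * max 0 u) (at u)"
      using False F2 by (auto intro!: derivative_eq_intros)
    moreover have "\<forall>\<^sub>F x in nhds u. 0 = pos_sq x"
      using False F2 by (intro eventually_nhds_in_open[of "{..<0}", THEN eventually_mono]) (auto simp: pos_sq_def)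
    ultimately show ?thesis by (subst (asm) DERIV_cong_ev[OF refl _ refl]) auto
  qed
qed

text \<open>A step from 0 (up to \<open>1/2\<close>) to 1 (from 1 on). The inner
  \<open>pos_sq\<close> smooths the corner at \<open>1/2\<close>, the outer one that at 1.\<close>

definition cutoff :: "real \<Rightarrow> real" where "cutoff y = 1 - pos_sq (1 - pos_sq (2 * y - 1))"

definition cutoff' :: "real \<Rightarrow> real" where
  "cutoff' y = 8 * max 0 (1 - pos_sq (2 * y - 1)) * max 0 (2 * y - 1)"

lemma cutoff_deriv: "(cutoff has_real_derivative cutoff' y) (at y)"
proof -
  have "((\<lambda>y. 2 * y - 1) has_real_derivative 2) (at y)" by (auto intro!: derivative_eq_intros)
  from DERIV_diff[OF DERIV_const[of 1] DERIV_chain2[OF pos_sq_deriv this]]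
  have "((\<lambda>y. 1 - pos_sq (2 * y - 1)) has_real_derivative 0 - 2 * max 0 (2 * y - 1) * 2) (at y)" .
  from DERIV_diff[OF DERIV_const[of 1] DERIV_chain2[OF pos_sq_deriv this]]
  show ?thesis unfolding cutoff_def cutoff'_def by (simp add: mult.assoc)
qed

lemma continuous_on_pos_sq [continuous_intros]: "continuous_on S f \<Longrightarrow> continuous_on S (\<lambda>x. pos_sq (f x))"
  unfolding pos_sq_def by (intro continuous_intros)

lemma continuous_on_cutoff' [continuous_intros]: "continuous_on S f \<Longrightarrow> continuous_on S (\<lambda>x. cutoff' (f x))"
  unfolding cutoff'_def by (intro continuous_intros)

lemma cutoff_eq_0: "y \<le> 1/2 \<Longrightarrow> cutoff y = 0"
  by (simp add: cutoff_def pos_sq_def)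

lemma cutoff_eq_1: "1 \<le> y \<Longrightarrow> cutoff y = 1"
proof -
  assume "1 \<le> y"
  then have "1 \<le> (2 * y - 1)\<^sup>2" by (intro one_le_power) auto
  moreover have "max 0 (2 * y - 1) = 2 * y - 1" using \<open>1 \<le> y\<close> by simp
  ultimately show ?thesis by (simp add: cutoff_def pos_sq_def max_absorb1)
qed

lemma cutoff_range: "0 \<le> cutoff y" "cutoff y \<le> 1"
proof -
  have "max 0 (1 - pos_sq (2 * y - 1)) \<le> 1" by (auto simp: pos_sq_def)
  then have "(max 0 (1 - pos_sq (2 * y - 1)))\<^sup>2 \<le> 1\<^sup>2" by (intro power_mono) auto
  then show "0 \<le> cutoff y" unfolding cutoff_def pos_sq_def[of "1 - _"] by simp
  show "cutoff y \<le> 1" by (simp add: cutoff_def pos_sq_def)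
qed

lemma cutoff'_eq_0: "1 \<le> y \<Longrightarrow> cutoff' y = 0"
proof -
  assume "1 \<le> y"
  then have "1 \<le> (2 * y - 1)\<^sup>2" by (intro one_le_power) auto
  moreover have "max 0 (2 * y - 1) = 2 * y - 1" using \<open>1 \<le> y\<close> by simp
  ultimately show ?thesis by (simp add: cutoff'_def pos_sq_def max_absorb1)
qed

lemma cutoff'_bound: "\<bar>cutoff' y\<bar> \<le> 8"
proof (cases "1 \<le> y")
  case False
  have "max 0 (1 - pos_sq (2 * y - 1)) * max 0 (2 * y - 1) \<le> 1 * 1"
    using False by (intro mult_mono) (auto simp: pos_sq_def)
  moreover have "0 \<le> max 0 (1 - pos_sq (2 * y - 1)) * max 0 (2 * y - 1)" by (intro mult_nonneg_nonneg) auto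
  ultimately show ?thesis by (simp add: cutoff'_def)
qed (simp add: cutoff'_eq_0)

text \<open>Scalar functions with an explicit gradient avoid the bounded linear maps in
  \<^const>\<open>test_field\<close>.\<close>

definition scalar_test :: "'a::euclidean_space set \<Rightarrow> ('a \<Rightarrow> real) \<Rightarrow> ('a \<Rightarrow> 'a) \<Rightarrow> bool" where
  "scalar_test \<Omega> f f' \<longleftrightarrow>
     (\<forall>x. (f has_derivative (\<lambda>h. f' x \<bullet> h)) (at x)) \<and> continuous_on UNIV f' \<and>
     (\<exists>K. compact K \<and> K \<subseteq> \<Omega> \<and> (\<forall>x. x \<notin> K \<longrightarrow> f x = 0))"

lemma notin_support: "x \<notin> closure {x. f x \<noteq> 0} \<Longrightarrow> f x = 0"
  by (metis (mono_tags) closure_subset mem_Collect_eq subsetD)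

lemma support_subset_compact:
  fixes f :: "'a::euclidean_space \<Rightarrow> 'b::real_normed_vector"
  assumes K: "compact K" "K \<subseteq> \<Omega>" "\<And>x. x \<notin> K \<Longrightarrow> f x = 0"
  shows "compact (closure {x. f x \<noteq> 0})" "closure {x. f x \<noteq> 0} \<subseteq> \<Omega>"
proof -
  have sub: "closure {x. f x \<noteq> 0} \<subseteq> K"
    using K by (intro closure_minimal compact_imp_closed) auto
  then show "closure {x. f x \<noteq> 0} \<subseteq> \<Omega>" using K by auto
  show "compact (closure {x. f x \<noteq> 0})"
    using sub K(1) compact_closure bounded_subset[OF compact_imp_bounded[OF K(1)]] closure_subset by (metis order_trans)
qed

text \<open>The gradient vanishes off \<open>K\<close> as well, since \<open>f\<close> is zero on
  the open complement of \<open>K\<close>.\<close>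

lemma scalar_testD:
  assumes "scalar_test \<Omega> f f'"
  shows scalar_test_deriv: "(f has_derivative (\<lambda>h. f' x \<bullet> h)) (at x)"
    and scalar_test_cont: "continuous_on S f'"
    and scalar_test_cont0: "continuous_on S f"
    and scalar_test_support: "\<exists>K. compact K \<and> K \<subseteq> \<Omega> \<and> (\<forall>x. x \<notin> K \<longrightarrow> f x = 0 \<and> f' x = 0)"
proof -
  have d: "(f has_derivative (\<lambda>h. f' x \<bullet> h)) (at x)" for x using assms by (simp add: scalar_test_def)
  then show "(f has_derivative (\<lambda>h. f' x \<bullet> h)) (at x)" .
  show "continuous_on S f'" using assms continuous_on_subset by (auto simp: scalar_test_def)
  have "continuous_on UNIV f"
    by (rule has_derivative_continuous_on) (use d has_derivative_at_withinI in blast)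
  then show "continuous_on S f" by (rule continuous_on_subset) simp
  obtain K where K: "compact K" "K \<subseteq> \<Omega>" "\<And>x. x \<notin> K \<Longrightarrow> f x = 0"
    using assms by (auto simp: scalar_test_def)
  have "f' x = 0" if "x \<notin> K" for x
  proof -
    have "open (- K)" using K by (simp add: compact_imp_closed open_Compl)
    have "(f has_derivative (\<lambda>h. 0)) (at x)"
      by (rule has_derivative_transform_within_open[of "\<lambda>_. 0" _ _ UNIV "- K"])
        (use \<open>open (- K)\<close> that K in auto)
    from has_derivative_unique[OF this d] have "(\<lambda>h. 0) = (\<lambda>h. f' x \<bullet> h)" .
    then have "f' x \<bullet> f' x = 0" by metis
    then show "f' x = 0" by simp
  qed
  with K show "\<exists>K. compact K \<and> K \<subseteq> \<Omega> \<and> (\<forall>x. x \<notin> K \<longrightarrow> f x = 0 \<and> f' x = 0)" by blast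
qed

lemma divergence_eq:
  assumes "(T has_derivative T') (at x)"
  shows "divergence T x = (\<Sum>b\<in>Basis. T' b \<bullet> b)"
  unfolding divergence_def using frechet_derivative_at[OF assms] by simp

lemma test_field_derivE:
  assumes "test_field \<Omega> T"
  obtains T' where "\<And>x. (T has_derivative blinfun_apply (T' x)) (at x)" "continuous_on UNIV T'"
  using assms unfolding test_field_def by blast

text \<open>\<open>g v x\<close> is the adjoint of the derivative of \<open>T\<close> at
  \<open>x\<close>, applied to \<open>v\<close>; the divergence is then the trace, expressed by
  gradients of components.\<close>

lemma scalar_test_component:
  fixes T :: "'a::euclidean_space \<Rightarrow> 'a"
  assumes T: "test_field \<Omega> T"
  obtains g where "\<And>v. scalar_test \<Omega> (\<lambda>x. T x \<bullet> v) (\<lambda>x. g v x)" "\<And>x. divergence T x = (\<Sum>b\<in>Basis. g b x \<bullet> b)"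
proof -
  obtain T' where T': "\<And>x. (T has_derivative blinfun_apply (T' x)) (at x)" "continuous_on UNIV T'"
    using test_field_derivE[OF T] by blast
  define g where "g v x = (\<Sum>b\<in>Basis. (blinfun_apply (T' x) b \<bullet> v) *\<^sub>R b)" for v x
  have g: "g v x \<bullet> h = blinfun_apply (T' x) h \<bullet> v" for v x h
  proof -
    have "blinfun_apply (T' x) h = blinfun_apply (T' x) (\<Sum>b\<in>Basis. (h \<bullet> b) *\<^sub>R b)" by (simp add: euclidean_representation)
    also have "\<dots> = (\<Sum>b\<in>Basis. (h \<bullet> b) *\<^sub>R blinfun_apply (T' x) b)" by (simp add: blinfun.bilinear_simps)
    finally show ?thesis by (simp add: g_def inner_sum_left inner_sum_right inner_commute[of _ h] mult.commute)
  qed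
  have "scalar_test \<Omega> (\<lambda>x. T x \<bullet> v) (g v)" for v
    unfolding scalar_test_def
  proof (intro conjI allI)
    show "((\<lambda>x. T x \<bullet> v) has_derivative (\<lambda>h. g v x \<bullet> h)) (at x)" for x
      unfolding g by (auto intro!: derivative_eq_intros T')
    show "continuous_on UNIV (g v)" unfolding g_def by (intro continuous_intros T')
    show "\<exists>K. compact K \<and> K \<subseteq> \<Omega> \<and> (\<forall>x. x \<notin> K \<longrightarrow> T x \<bullet> v = 0)"
    proof (intro exI conjI allI impI)
      show "compact (closure {x. T x \<noteq> 0})" "closure {x. T x \<noteq> 0} \<subseteq> \<Omega>"
        using T unfolding test_field_def by blast+
      show "T x \<bullet> v = 0" if "x \<notin> closure {x. T x \<noteq> 0}" for x
        by (simp add: notin_support[OF that])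
    qed
  qed
  moreover have "divergence T x = (\<Sum>b\<in>Basis. g b x \<bullet> b)" for x
    unfolding g by (rule divergence_eq[OF T'(1)])
  ultimately show ?thesis by (rule that)
qed

lemma scalar_test_field:
  assumes f: "scalar_test \<Omega> f f'"
  shows "test_field \<Omega> (\<lambda>x. f x *\<^sub>R v)" "divergence (\<lambda>x. f x *\<^sub>R v) x = f' x \<bullet> v"
proof -
  have d: "((\<lambda>x. f x *\<^sub>R v) has_derivative (\<lambda>h. (f' x \<bullet> h) *\<^sub>R v)) (at x)" for x
    by (intro has_derivative_scaleR_left scalar_test_deriv[OF f])
  obtain K where K: "compact K" "K \<subseteq> \<Omega>" "\<And>x. x \<notin> K \<Longrightarrow> f x = 0"
    using scalar_test_support[OF f] by blast
  show "test_field \<Omega> (\<lambda>x. f x *\<^sub>R v)"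
    unfolding test_field_def
  proof (intro conjI exI allI)
    let ?T = "\<lambda>x. blinfun_scaleR_left v o\<^sub>L blinfun_inner_left (f' x)"
    show "((\<lambda>x. f x *\<^sub>R v) has_derivative blinfun_apply (?T x)) (at x)" for x
    proof -
      have "blinfun_apply (?T x) = (\<lambda>h. (f' x \<bullet> h) *\<^sub>R v)"
        by (rule ext) (simp add: inner_commute)
      then show ?thesis using d by simp
    qed
    show "continuous_on UNIV ?T"
      by (intro continuous_intros bounded_linear.continuous_on[OF bounded_linear_blinfun_inner_left] scalar_test_cont[OF f])
    have fv: "f x *\<^sub>R v = 0" if "x \<notin> K" for x using K that by simp
    show "compact (closure {x. f x *\<^sub>R v \<noteq> 0})" "closure {x. f x *\<^sub>R v \<noteq> 0} \<subseteq> \<Omega>"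
      using support_subset_compact[OF K(1,2), of "\<lambda>x. f x *\<^sub>R v", OF fv] by blast+
  qed
  have "divergence (\<lambda>x. f x *\<^sub>R v) x = (\<Sum>b\<in>Basis. ((f' x \<bullet> b) *\<^sub>R v) \<bullet> b)"
    by (rule divergence_eq[OF d])
  also have "\<dots> = f' x \<bullet> v" by (simp add: euclidean_inner[of "f' x" v])
  finally show "divergence (\<lambda>x. f x *\<^sub>R v) x = f' x \<bullet> v" .
qed

lemma scalar_test_mult:
  assumes f: "scalar_test \<Omega> f f'"
    and g: "\<And>x. (g has_derivative (\<lambda>h. g' x \<bullet> h)) (at x)" "continuous_on UNIV g'"
  shows "scalar_test \<Omega> (\<lambda>x. g x * f x) (\<lambda>x. g x *\<^sub>R f' x + f x *\<^sub>R g' x)"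
  unfolding scalar_test_def
proof (intro conjI allI)
  show "((\<lambda>x. g x * f x) has_derivative (\<lambda>h. (g x *\<^sub>R f' x + f x *\<^sub>R g' x) \<bullet> h)) (at x)" for x
    by (rule derivative_eq_intros g scalar_test_deriv[OF f])+ (simp add: inner_add_left algebra_simps)
  have "continuous_on UNIV g"
    by (rule has_derivative_continuous_on) (use g has_derivative_at_withinI in blast)
  then show "continuous_on UNIV (\<lambda>x. g x *\<^sub>R f' x + f x *\<^sub>R g' x)"
    by (intro continuous_intros g scalar_test_cont[OF f] scalar_test_cont0[OF f])
  show "\<exists>K. compact K \<and> K \<subseteq> \<Omega> \<and> (\<forall>x. x \<notin> K \<longrightarrow> g x * f x = 0)"
    using scalar_test_support[OF f] by auto
qed

lemma test_field_add:
  assumes "test_field \<Omega> S" "test_field \<Omega> T"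
  shows "test_field \<Omega> (\<lambda>x. S x + T x)" "divergence (\<lambda>x. S x + T x) x = divergence S x + divergence T x"
proof -
  obtain S' where S': "\<And>x. (S has_derivative blinfun_apply (S' x)) (at x)" "continuous_on UNIV S'"
    using test_field_derivE[OF assms(1)] by blast
  obtain T' where T': "\<And>x. (T has_derivative blinfun_apply (T' x)) (at x)" "continuous_on UNIV T'"
    using test_field_derivE[OF assms(2)] by blast
  have d: "((\<lambda>x. S x + T x) has_derivative blinfun_apply (S' x + T' x)) (at x)" for x
    by (auto intro!: derivative_eq_intros S' T' simp: blinfun.bilinear_simps)
  let ?K = "closure {x. S x \<noteq> 0} \<union> closure {x. T x \<noteq> 0}"
  have K: "compact ?K" "?K \<subseteq> \<Omega>"
    using assms by (auto simp: test_field_def)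
  have K0: "x \<notin> ?K \<Longrightarrow> S x + T x = 0" for x
    using notin_support[of x T] notin_support[of x S] by auto
  show "test_field \<Omega> (\<lambda>x. S x + T x)"
    unfolding test_field_def
    using d support_subset_compact[OF K K0] by (auto intro!: exI[of _ "\<lambda>x. S' x + T' x"] continuous_intros S' T')
  show "divergence (\<lambda>x. S x + T x) x = divergence S x + divergence T x"
    unfolding divergence_eq[OF d] divergence_eq[OF S'(1)] divergence_eq[OF T'(1)]
    by (simp add: blinfun.bilinear_simps inner_add_left sum.distrib)
qed

section \<open>The Gauss-Green formula below a piecewise differentiable graph\<close>

text \<open>With \<open>i, j\<close> equal to \<open>1, 2\<close> or to \<open>2, 1\<close>, a
  single argument treats graphs over both axes.\<close>

definition pt :: "'n \<Rightarrow> 'n \<Rightarrow> real \<Rightarrow> real \<Rightarrow> real^'n::finite" where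
  "pt i j t s = t *\<^sub>R axis i 1 + s *\<^sub>R axis j 1"

lemma pt_nth: "pt i j t s $ l = (if l = i then t else 0) + (if l = j then s else 0)"
  by (simp add: pt_def axis_def)

lemma UNIV_2_eq:
  assumes "i \<noteq> j" shows "(UNIV :: 2 set) = {i, j}"
  using assms exhaust_2[of i] exhaust_2[of j] unfolding UNIV_2 by auto

lemma sum_2_eq:
  assumes "i \<noteq> j" shows "(\<Sum>l\<in>(UNIV :: 2 set). f l) = f i + f j"
  unfolding UNIV_2_eq[OF assms] using assms by simp

lemma forall_2_eq:
  assumes "i \<noteq> j" shows "(\<forall>l :: 2. P l) \<longleftrightarrow> P i \<and> P j"
proof -
  have "(\<forall>l. P l) \<longleftrightarrow> (\<forall>l\<in>UNIV. P l)" by simp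
  then show ?thesis unfolding UNIV_2_eq[OF assms] by simp
qed

lemma vec_eq_2_iff:
  assumes "i \<noteq> j" shows "(x :: real^2) = y \<longleftrightarrow> x $ i = y $ i \<and> x $ j = y $ j"
  unfolding vec_eq_iff forall_2_eq[OF assms] ..

lemma Basis_real2:
  assumes "i \<noteq> j" shows "(Basis :: (real^2) set) = {axis i 1, axis j 1}"
  unfolding Basis_vec_def UNIV_2_eq[OF assms] by auto

lemma inner_real2:
  assumes "i \<noteq> j" shows "(x :: real^2) \<bullet> y = x $ i * y $ i + x $ j * y $ j"
  unfolding inner_vec_def sum_2_eq[OF assms] by simp

lemma norm_real2: "i \<noteq> j \<Longrightarrow> norm (x :: real^2) = sqrt ((x $ i)\<^sup>2 + (x $ j)\<^sup>2)"
  by (simp add: norm_eq_sqrt_inner inner_real2[of i j] power2_eq_square)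

lemma continuous_on_pt [continuous_intros]:
  "continuous_on S f \<Longrightarrow> continuous_on S g \<Longrightarrow> continuous_on S (\<lambda>x. pt i j (f x) (g x))"
  unfolding pt_def by (intro continuous_intros)

lemma borel_measurable_pt [measurable]:
  "f \<in> borel_measurable M \<Longrightarrow> g \<in> borel_measurable M \<Longrightarrow> (\<lambda>x. pt i j (f x) (g x)) \<in> borel_measurable M"
  unfolding pt_def by (intro borel_measurable_add borel_measurable_scaleR borel_measurable_const)

lemma borel_measurable_pt2: "(\<lambda>p. pt i j (fst p) (snd p)) \<in> borel_measurable borel"
  by (intro borel_measurable_continuous_onI continuous_intros)

text \<open>Lebesgue measure is determined by its values on boxes, and these are products in either
  order of the axes. This transfers Fubini's theorem from pairs to vectors.\<close>

lemma lborel_real2: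
  assumes ij: "i \<noteq> j"
  shows "(lborel :: (real^2) measure) = distr lborel borel (\<lambda>(t, s). pt i j t s)"
proof (rule lborel_eqI)
  fix l u :: "real^2"
  assume le: "\<And>b. b \<in> Basis \<Longrightarrow> l \<bullet> b \<le> u \<bullet> b"
  have le': "l $ k \<le> u $ k" for k
    using le[of "axis k 1"] by (simp add: inner_axis)
  have ne: "axis i (1::real) \<noteq> axis j 1" using ij by (simp add: axis_eq_axis)
  have "(\<lambda>(t, s). pt i j t s) -` box l u = {l $ i <..< u $ i} \<times> {l $ j <..< u $ j}"
    using ij by (auto simp: mem_box_cart forall_2_eq[of i j] pt_nth)
  then have "emeasure (distr lborel borel (\<lambda>(t, s). pt i j t s)) (box l u) =
      emeasure (lborel \<Otimes>\<^sub>M lborel) ({l $ i <..< u $ i} \<times> {l $ j <..< u $ j})"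
    using borel_measurable_pt2[of i j] by (subst emeasure_distr) (simp_all add: lborel_prod case_prod_unfold)
  also have "\<dots> = ennreal (u $ i - l $ i) * ennreal (u $ j - l $ j)"
    using le' by (subst lborel.emeasure_pair_measure_Times) auto
  also have "\<dots> = ennreal (\<Prod>b\<in>Basis. (u - l) \<bullet> b)"
    using ne le' by (simp add: Basis_real2[OF ij] inner_axis ennreal_mult)
  finally show "emeasure (distr lborel borel (\<lambda>(t, s). pt i j t s)) (box l u) = ennreal (\<Prod>b\<in>Basis. (u - l) \<bullet> b)" .
qed simp

lemma integral_real2:
  fixes f :: "real^2 \<Rightarrow> real"
  assumes ij: "i \<noteq> j" and f: "integrable lborel f"
  shows "(LINT x|lborel. f x) = (LINT s|lborel. LINT t|lborel. f (pt i j t s))"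
    and "integrable lborel (\<lambda>(t, s). f (pt i j t s))"
proof -
  have m: "f \<in> borel_measurable borel" using f by simp
  show 1: "integrable lborel (\<lambda>(t, s). f (pt i j t s))"
    using f m borel_measurable_pt2[of i j] integrable_distr_eq[of "\<lambda>p. pt i j (fst p) (snd p)" lborel borel f]
    by (subst (asm) lborel_real2[OF ij]) (simp add: case_prod_unfold)
  have "(LINT x|lborel. f x) = (LINT p|lborel. f (case_prod (pt i j) p))"
    using m borel_measurable_pt2[of i j] by (subst lborel_real2[OF ij]) (simp add: integral_distr case_prod_unfold)
  also have "\<dots> = (LINT s|lborel. LINT t|lborel. f (pt i j t s))"
    using 1 lborel_pair.integral_snd[of "\<lambda>t s. f (pt i j t s)"] by (simp add: lborel_prod case_prod_unfold)
  finally show "(LINT x|lborel. f x) = (LINT s|lborel. LINT t|lborel. f (pt i j t s))" .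
qed

lemma integrable_bounded_compact_support:
  fixes f :: "'a::euclidean_space \<Rightarrow> real"
  assumes "f \<in> borel_measurable borel" "compact K" "\<And>x. x \<in> K \<Longrightarrow> \<bar>f x\<bar> \<le> B" "\<And>x. x \<notin> K \<Longrightarrow> f x = 0"
  shows "integrable lborel f"
  using assms by (intro integrableI_bounded_set[where A=K and B=B])
    (auto intro: borel_compact emeasure_compact_finite[unfolded less_top infinity_ennreal_def])

text \<open>The finite set \<open>N\<close> admits kinks of the graph. \<open>\<sigma>\<close>
  selects the ray above or below \<open>c\<close>, and compact support leaves only the boundary term
  at \<open>c\<close>.\<close>

lemma integral_FTC_compact_support:
  fixes F :: "real \<Rightarrow> real"
  assumes N: "finite N" and F: "continuous_on UNIV F" and D: "\<And>x. x \<notin> N \<Longrightarrow> (F has_real_derivative D x) (at x)"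
    and m: "D \<in> borel_measurable borel" and B: "\<And>x. \<bar>D x\<bar> \<le> B"
    and R: "\<And>x. R < \<bar>x\<bar> \<Longrightarrow> F x = 0 \<and> D x = 0"
    and \<sigma>: "\<sigma> = 1 \<or> \<sigma> = -1"
  shows "(LINT t|lborel. indicator {t. 0 < \<sigma> * (t - c)} t * D t) = - \<sigma> * F c"
    and "(LINT t|lborel. D t) = 0"
proof -
  \<comment> \<open>\<open>R\<close> may be negative, hence the absolute value; \<open>M\<close>
    lies beyond both the support and \<open>c\<close>.\<close>
  define M where "M = max \<bar>R\<bar> \<bar>c\<bar> + 1"
  have M: "R < M" "- M < c" "c < M" "\<bar>R\<bar> < M" by (auto simp: M_def)
  have int: "(LINT t|lborel. indicator {a..b} t * D t) = F b - F a" if ab: "a \<le> b" for a b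
  proof -
    have i: "integrable lborel (\<lambda>t. indicator {a..b} t * D t)"
    proof (rule integrable_bounded_compact_support)
      show "(\<lambda>t. indicator {a..b} t * D t) \<in> borel_measurable borel" using m by measurable
      show "compact {a..b}" by simp
      show "\<bar>indicator {a..b} x * D x\<bar> \<le> B" for x
        using B[of x] order_trans[OF abs_ge_zero B] by (auto simp: indicator_def)
    qed auto
    have "(D has_integral (F b - F a)) {a..b}"
      using N ab by (rule fundamental_theorem_of_calculus_interior_strong)
        (use D F in \<open>auto simp: has_real_derivative_iff_has_vector_derivative intro: continuous_on_subset\<close>)
    then have "((\<lambda>t. if t \<in> {a..b} then D t else 0) has_integral (F b - F a)) UNIV"
      by (subst has_integral_restrict_UNIV)
    moreover have "(\<lambda>t. if t \<in> {a..b} then D t else 0) = (\<lambda>t. indicator {a..b} t * D t)"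
      by (auto simp: indicator_def)
    ultimately show ?thesis
      using has_integral_integral_lborel[OF i] has_integral_unique by metis
  qed
  have out: "D x = 0" if "x \<notin> {-M..M}" for x
    using that M by (intro R[THEN conjunct2]) (auto simp: abs_if split: if_splits)
  have z: "F M = 0" "F (- M) = 0" using R M by auto
  have "(LINT t|lborel. D t) = (LINT t|lborel. indicator {-M..M} t * D t)"
    using out by (intro Bochner_Integration.integral_cong) (auto simp: indicator_def)
  then show "(LINT t|lborel. D t) = 0" using int[of "-M" M] M z by simp
  have ae: "AE t in lborel. t \<noteq> c" by (rule AE_lborel_singleton)
  show "(LINT t|lborel. indicator {t. 0 < \<sigma> * (t - c)} t * D t) = - \<sigma> * F c"
  proof (cases "\<sigma> = 1")
    case True
    have "(LINT t|lborel. indicator {t. 0 < \<sigma> * (t - c)} t * D t) = (LINT t|lborel. indicator {c..M} t * D t)"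
    proof (rule integral_cong_AE)
      show "AE t in lborel. indicator {t. 0 < \<sigma> * (t - c)} t * D t = indicator {c..M} t * D t"
        using ae by eventually_elim (use out M True in \<open>auto simp: indicator_def\<close>)
    qed (use m in measurable)
    then show ?thesis using int[of c M] M z True by simp
  next
    case False
    with \<sigma> have s: "\<sigma> = -1" by simp
    have "(LINT t|lborel. indicator {t. 0 < \<sigma> * (t - c)} t * D t) = (LINT t|lborel. indicator {-M..c} t * D t)"
    proof (rule integral_cong_AE)
      show "AE t in lborel. indicator {t. 0 < \<sigma> * (t - c)} t * D t = indicator {-M..c} t * D t"
        using ae by eventually_elim (use out M s in \<open>auto simp: indicator_def\<close>)
    qed (use m in measurable)
    then show ?thesis using int[of "-M" c] M z s by simp
  qed
qed

text \<open>\<open>c\<close> is the slope of \<open>g\<close> off the finitely many kinks in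
  \<open>N\<close>, where it is only bounded; this covers straight lines and staircases alike.
  \<open>\<sigma>\<close> lets one formula serve epigraphs and hypographs.\<close>

locale graph =
  fixes i j :: 2 and g c :: "real \<Rightarrow> real" and N :: "real set" and B \<sigma> :: real
  assumes ij: "i \<noteq> j" and g: "continuous_on UNIV g"
    and c [measurable]: "c \<in> borel_measurable borel" and cB: "\<And>s. \<bar>c s\<bar> \<le> B"
    and N: "finite N" and gc: "\<And>s. s \<notin> N \<Longrightarrow> (g has_real_derivative c s) (at s)"
    and \<sigma>: "\<sigma> = 1 \<or> \<sigma> = -1"
begin

definition side :: "(real^2) set" where "side = {x. 0 < \<sigma> * (x $ i - g (x $ j))}"

lemma open_side: "open side"
  unfolding side_def
  by (intro open_Collect_less continuous_intros continuous_on_compose2[OF g]) auto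

context
  fixes f :: "real^2 \<Rightarrow> real" and f' \<Omega>
  assumes f: "scalar_test \<Omega> f f'"
begin

lemma support_bound: "\<exists>R>0. \<forall>t s. R < \<bar>t\<bar> \<or> R < \<bar>s\<bar> \<longrightarrow> f (pt i j t s) = 0 \<and> f' (pt i j t s) = 0"
proof -
  obtain K where K: "compact K" "\<And>x. x \<notin> K \<Longrightarrow> f x = 0 \<and> f' x = 0"
    using scalar_test_support[OF f] by blast
  obtain R where R: "R > 0" "\<And>x. x \<in> K \<Longrightarrow> norm x \<le> R"
    using compact_imp_bounded[OF K(1)] bounded_pos[of K] by auto
  have "pt i j t s \<notin> K" if "R < \<bar>t\<bar> \<or> R < \<bar>s\<bar>" for t s
    using that R(2)[of "pt i j t s"] component_le_norm_cart[of "pt i j t s" i] component_le_norm_cart[of "pt i j t s" j] ij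
    by (auto simp: pt_nth)
  then show ?thesis using R K by blast
qed

lemma gradient_bound: "\<exists>C. \<forall>x l. \<bar>f' x $ l\<bar> \<le> C"
proof -
  obtain K where K: "compact K" "\<And>x. x \<notin> K \<Longrightarrow> f x = 0 \<and> f' x = 0"
    using scalar_test_support[OF f] by blast
  have "compact (f' ` K)" by (intro compact_continuous_image scalar_test_cont[OF f] K)
  then obtain C where C: "C > 0" "\<And>x. x \<in> K \<Longrightarrow> norm (f' x) \<le> C"
    using compact_imp_bounded[of "f' ` K"] bounded_pos[of "f' ` K"] by auto
  have "norm (f' x) \<le> C" for x using C K(2)[of x] by (cases "x \<in> K") auto
  then show ?thesis
    by (intro exI[of _ C] allI) (rule order_trans[OF component_le_norm_cart])
qed

lemma gradient_measurable [measurable]: "(\<lambda>x. f' x $ l) \<in> borel_measurable borel"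
  by (intro borel_measurable_continuous_onI continuous_intros scalar_test_cont[OF f])

lemma g_measurable [measurable]: "g \<in> borel_measurable borel"
  by (rule borel_measurable_continuous_onI[OF g])

lemma gradient_integrable:
  assumes [measurable]: "a \<in> borel_measurable borel" and A: "\<And>s. \<bar>a s\<bar> \<le> A"
  shows "integrable lborel (\<lambda>x. indicator side x * (a (x $ j) * f' x $ l))"
proof -
  obtain K where K: "compact K" "\<And>x. x \<notin> K \<Longrightarrow> f x = 0 \<and> f' x = 0"
    using scalar_test_support[OF f] by blast
  obtain C where C: "\<And>x l. \<bar>f' x $ l\<bar> \<le> C" using gradient_bound by blast
  have [measurable]: "side \<in> sets borel" using open_side by simp
  have bd: "\<bar>indicator side x * (a (x $ j) * f' x $ l)\<bar> \<le> A * C" for x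
  proof -
    have "\<bar>a (x $ j)\<bar> * \<bar>f' x $ l\<bar> \<le> A * C" using A C order_trans[OF abs_ge_zero A] by (intro mult_mono) auto
    moreover have "0 \<le> A * C" using order_trans[OF abs_ge_zero A] order_trans[OF abs_ge_zero C] by simp
    ultimately show ?thesis by (simp add: indicator_def abs_mult)
  qed
  show ?thesis
  proof (rule integrable_bounded_compact_support[OF _ K(1) bd])
    show "(\<lambda>x. indicator side x * (a (x $ j) * f' x $ l)) \<in> borel_measurable borel"
      using gradient_measurable by measurable
  qed (use K in auto)
qed

text \<open>On each line in direction \<open>i\<close> the domain is a ray ending at the graph and
  the weight is constant, so the fundamental theorem applies line by line. The weight will be 1 or
  the slope \<open>c\<close>.\<close>

lemma normal_part:
  assumes [measurable]: "a \<in> borel_measurable borel" and A: "\<And>s. \<bar>a s\<bar> \<le> A"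
  shows "(LINT x|lborel. indicator side x * (a (x $ j) * f' x $ i)) = - \<sigma> * (LINT s|lborel. a s * f (pt i j (g s) s))"
proof -
  obtain R where R: "\<And>t s. R < \<bar>t\<bar> \<or> R < \<bar>s\<bar> \<Longrightarrow> f (pt i j t s) = 0 \<and> f' (pt i j t s) = 0"
    using support_bound by blast
  obtain C where C: "\<And>x l. \<bar>f' x $ l\<bar> \<le> C" using gradient_bound by blast
  have inner: "(LINT t|lborel. indicator {t. 0 < \<sigma> * (t - g s)} t * f' (pt i j t s) $ i) = - \<sigma> * f (pt i j (g s) s)" for s
  proof (rule integral_FTC_compact_support(1)[where N="{}" and F="\<lambda>t. f (pt i j t s)" and R=R and B=C])
    show "continuous_on UNIV (\<lambda>t. f (pt i j t s))"
      by (intro continuous_on_compose2[OF scalar_test_cont0[OF f, of UNIV]] continuous_intros) auto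
    show "((\<lambda>t. f (pt i j t s)) has_real_derivative f' (pt i j t s) $ i) (at t)" for t
    proof -
      have "((\<lambda>t. pt i j t s) has_derivative (\<lambda>h. h *\<^sub>R axis i 1)) (at t)"
        unfolding pt_def by (auto intro!: derivative_eq_intros)
      from has_derivative_compose[OF this scalar_test_deriv[OF f]]
      show ?thesis by (simp add: has_field_derivative_def inner_axis mult.commute[of _ "f' _ $ i"])
    qed
  qed (use R C \<sigma> in auto)
  have "(LINT x|lborel. indicator side x * (a (x $ j) * f' x $ i)) =
      (LINT s|lborel. LINT t|lborel. indicator side (pt i j t s) * (a (pt i j t s $ j) * f' (pt i j t s) $ i))"
    by (rule integral_real2(1)[OF ij gradient_integrable[OF assms]])
  also have "\<dots> = (LINT s|lborel. a s * (LINT t|lborel. indicator {t. 0 < \<sigma> * (t - g s)} t * f' (pt i j t s) $ i))"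
  proof (intro Bochner_Integration.integral_cong refl)
    fix s
    have "(LINT t|lborel. indicator side (pt i j t s) * (a (pt i j t s $ j) * f' (pt i j t s) $ i)) =
        (LINT t|lborel. a s * (indicator {t. 0 < \<sigma> * (t - g s)} t * f' (pt i j t s) $ i))"
      using ij by (intro Bochner_Integration.integral_cong) (auto simp: pt_nth side_def indicator_def)
    then show "(LINT t|lborel. indicator side (pt i j t s) * (a (pt i j t s $ j) * f' (pt i j t s) $ i)) =
        a s * (LINT t|lborel. indicator {t. 0 < \<sigma> * (t - g s)} t * f' (pt i j t s) $ i)"
      by simp
  qed
  also have "\<dots> = (LINT s|lborel. - \<sigma> * (a s * f (pt i j (g s) s)))"
    unfolding inner by (intro Bochner_Integration.integral_cong) auto
  finally show ?thesis by simp
qed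

text \<open>The shear \<open>t = u + g s\<close> turns the domain into the half plane
  \<open>0 < \<sigma> * u\<close>, on which the integrand is the derivative of \<open>f\<close>
  along a translate of the graph. Integrated over \<open>s\<close> first, it gives 0 for every
  \<open>u\<close>.\<close>

lemma tangential_part:
  "(LINT x|lborel. indicator side x * (f' x $ j + c (x $ j) * f' x $ i)) = 0"
proof -
  obtain R where R: "\<And>t s. R < \<bar>t\<bar> \<or> R < \<bar>s\<bar> \<Longrightarrow> f (pt i j t s) = 0 \<and> f' (pt i j t s) = 0" "R > 0"
    using support_bound by blast
  obtain C where C: "\<And>x l. \<bar>f' x $ l\<bar> \<le> C" using gradient_bound by blast
  define Q where "Q t s = f' (pt i j t s) $ j + c s * f' (pt i j t s) $ i" for t s
  have [measurable]: "side \<in> sets borel" using open_side by simp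
  have QC: "\<bar>Q t s\<bar> \<le> C + B * C" for t s
  proof -
    have "\<bar>c s * f' (pt i j t s) $ i\<bar> \<le> B * C"
      unfolding abs_mult using cB[of s] C order_trans[OF abs_ge_zero cB] by (intro mult_mono) auto
    then show ?thesis unfolding Q_def using C[of "pt i j t s" j] by linarith
  qed
  then have QC0: "0 \<le> C + B * C" using order_trans[OF abs_ge_zero] by blast
  have Qm [measurable]: "(\<lambda>p. Q (fst p) (snd p)) \<in> borel_measurable borel"
    unfolding Q_def borel_prod[symmetric] by measurable
  have "integrable lborel (\<lambda>x. indicator side x * (1 * f' x $ j) + indicator side x * (c (x $ j) * f' x $ i))"
    by (intro Bochner_Integration.integrable_add gradient_integrable[where a="\<lambda>_. 1" and A=1] gradient_integrable[OF c cB]) auto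
  then have int: "integrable lborel (\<lambda>x. indicator side x * (f' x $ j + c (x $ j) * f' x $ i))"
    by (simp add: distrib_left)
  have "(LINT x|lborel. indicator side x * (f' x $ j + c (x $ j) * f' x $ i)) =
     (LINT s|lborel. LINT t|lborel. indicator {t. 0 < \<sigma> * (t - g s)} t * Q t s)"
    unfolding integral_real2(1)[OF ij int]
    using ij by (auto intro!: Bochner_Integration.integral_cong simp: pt_nth side_def indicator_def Q_def)
  also have "\<dots> = (LINT s|lborel. LINT u|lborel. indicator {u. 0 < \<sigma> * u} u * Q (u + g s) s)"
  proof (rule Bochner_Integration.integral_cong[OF refl])
    fix s
    show "(LINT t|lborel. indicator {t. 0 < \<sigma> * (t - g s)} t * Q t s) =
        (LINT u|lborel. indicator {u. 0 < \<sigma> * u} u * Q (u + g s) s)"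
      by (subst lborel_integral_real_affine[where c=1 and t="g s"]) (auto simp: indicator_def add.commute)
  qed
  also have "\<dots> = (LINT u|lborel. LINT s|lborel. indicator {u. 0 < \<sigma> * u} u * Q (u + g s) s)"
  proof (rule lborel_pair.Fubini_integral)
    have "compact (g ` {-R..R})" by (intro compact_continuous_image continuous_on_subset[OF g]) auto
    then obtain G where G: "\<And>s. \<bar>s\<bar> \<le> R \<Longrightarrow> \<bar>g s\<bar> \<le> G"
    proof -
      obtain G' where "\<And>y. y \<in> g ` {-R..R} \<Longrightarrow> \<bar>y\<bar> \<le> G'"
        using compact_imp_bounded[OF \<open>compact (g ` {-R..R})\<close>] unfolding bounded_iff by auto
      then show ?thesis by (intro that[of G']) (auto simp: abs_le_iff)
    qed
    have "integrable lborel (\<lambda>p. indicator {u. 0 < \<sigma> * u} (fst p) * Q (fst p + g (snd p)) (snd p))"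
    proof (rule integrable_bounded_compact_support)
      show "compact (cbox (- (R + G), - R) (R + G, R))" by (rule compact_cbox)
      show "\<bar>indicator {u. 0 < \<sigma> * u} (fst p) * Q (fst p + g (snd p)) (snd p)\<bar> \<le> C + B * C" for p :: "real \<times> real"
        using QC QC0 by (auto simp: indicator_def)
      show "indicator {u. 0 < \<sigma> * u} (fst p) * Q (fst p + g (snd p)) (snd p) = 0" if "p \<notin> cbox (- (R + G), - R) (R + G, R)" for p
      proof -
        have "R < \<bar>snd p\<bar> \<or> R < \<bar>fst p + g (snd p)\<bar>"
        proof (rule ccontr)
          assume "\<not> ?thesis"
          then have "\<bar>snd p\<bar> \<le> R" "\<bar>fst p + g (snd p)\<bar> \<le> R" by auto
          moreover from G[OF this(1)] this(2) have "\<bar>fst p\<bar> \<le> R + G" by linarith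
          ultimately show False using that by (cases p) (auto simp: cbox_Pair_eq abs_le_iff)
        qed
        then show ?thesis using R(1) by (auto simp: Q_def)
      qed
      show "(\<lambda>p. indicator {u. 0 < \<sigma> * u} (fst p) * Q (fst p + g (snd p)) (snd p)) \<in> borel_measurable borel"
        unfolding Q_def borel_prod[symmetric] by measurable
    qed
    then show "integrable (lborel \<Otimes>\<^sub>M lborel) (\<lambda>(u, s). indicator {u. 0 < \<sigma> * u} u * Q (u + g s) s)"
      by (simp add: lborel_prod case_prod_unfold)
  qed
  finally have *: "(LINT x|lborel. indicator side x * (f' x $ j + c (x $ j) * f' x $ i)) =
      (LINT u|lborel. indicator {u. 0 < \<sigma> * u} u * (LINT s|lborel. Q (u + g s) s))" by simp
  have "(LINT s|lborel. Q (u + g s) s) = 0" for u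
  proof (rule integral_FTC_compact_support(2)[where N=N and F="\<lambda>s. f (pt i j (u + g s) s)" and R=R and B="C + B * C" and \<sigma>=1])
    show "continuous_on UNIV (\<lambda>s. f (pt i j (u + g s) s))"
      by (intro continuous_on_compose2[OF scalar_test_cont0[OF f, of UNIV]] continuous_intros g) auto
    show "((\<lambda>s. f (pt i j (u + g s) s)) has_real_derivative Q (u + g s) s) (at s)" if "s \<notin> N" for s
    proof -
      have "((\<lambda>s. pt i j (u + g s) s) has_derivative (\<lambda>h. (c s * h) *\<^sub>R axis i 1 + h *\<^sub>R axis j 1)) (at s)"
        unfolding pt_def using gc[OF that, unfolded has_field_derivative_def] by (auto intro!: derivative_eq_intros)
      from has_derivative_compose[OF this scalar_test_deriv[OF f]]
      show ?thesis
        unfolding has_field_derivative_def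
        by (rule has_derivative_eq_rhs) (auto simp: inner_axis inner_add_right Q_def algebra_simps)
    qed
    show "(\<lambda>s. Q (u + g s) s) \<in> borel_measurable borel" unfolding Q_def by measurable
    show "R < \<bar>x\<bar> \<Longrightarrow> f (pt i j (u + g x) x) = 0 \<and> Q (u + g x) x = 0" for x
      using R by (auto simp: Q_def)
  qed (use N QC in auto)
  then show ?thesis using * by simp
qed

lemma tangential_part':
  "(LINT x|lborel. indicator side x * f' x $ j) = \<sigma> * (LINT s|lborel. c s * f (pt i j (g s) s))"
proof -
  have int: "integrable lborel (\<lambda>x. indicator side x * (1 * f' x $ j))" "integrable lborel (\<lambda>x. indicator side x * (c (x $ j) * f' x $ i))"
    by (rule gradient_integrable[where A=1]; simp) (rule gradient_integrable[OF c cB])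
  show ?thesis
    using tangential_part Bochner_Integration.integral_add[OF int] normal_part[OF c cB]
    by (simp add: distrib_left)
qed

lemma normal_part': "(LINT x|lborel. indicator side x * f' x $ i) = - \<sigma> * (LINT s|lborel. f (pt i j (g s) s))"
  using normal_part[of "\<lambda>_. 1" 1] by simp

end

text \<open>The vector with components \<open>1\<close> and \<open>- c s\<close> is a unit normal
  times the length element, so the boundary integral runs over the parameter and involves no surface
  measure.\<close>

lemma gauss_green:
  assumes T: "test_field \<Omega> T"
  shows "(LINT x:side|lebesgue. divergence T x) =
    - \<sigma> * (LINT s|lborel. T (pt i j (g s) s) $ i - c s * T (pt i j (g s) s) $ j)"
proof -
  obtain G where G: "\<And>v. scalar_test \<Omega> (\<lambda>x. T x \<bullet> v) (G v)" "\<And>x. divergence T x = (\<Sum>b\<in>Basis. G b x \<bullet> b)"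
    using scalar_test_component[OF T] by blast
  define P where "P = G (axis i 1)"
  define S where "S = G (axis j 1)"
  have P: "scalar_test \<Omega> (\<lambda>x. T x $ i) P" and S: "scalar_test \<Omega> (\<lambda>x. T x $ j) S"
    using G(1)[of "axis i 1"] G(1)[of "axis j 1"] by (simp_all add: P_def S_def inner_axis)
  have div: "divergence T x = P x $ i + S x $ j" for x
    using ij by (simp add: G(2) Basis_real2[OF ij] P_def S_def inner_axis axis_eq_axis)
  have [measurable]: "side \<in> sets borel" using open_side by simp
  have [measurable]: "(\<lambda>x. P x $ l) \<in> borel_measurable borel" "(\<lambda>x. S x $ l) \<in> borel_measurable borel" for l
    by (rule gradient_measurable[OF P] gradient_measurable[OF S])+
  have line: "integrable lborel (\<lambda>s. a s * h (pt i j (g s) s))"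
    if a: "a \<in> borel_measurable borel" "\<And>s. \<bar>a s\<bar> \<le> A" and h: "scalar_test \<Omega> h h'" for a h h' A
  proof -
    obtain R where R: "\<And>t s. R < \<bar>t\<bar> \<or> R < \<bar>s\<bar> \<Longrightarrow> h (pt i j t s) = 0" using support_bound[OF h] by blast
    have "compact ((\<lambda>s. h (pt i j (g s) s)) ` {-R..R})"
      by (intro compact_continuous_image continuous_on_compose2[OF scalar_test_cont0[OF h, of UNIV]] continuous_intros continuous_on_subset[OF g]) auto
    then obtain H where H: "\<And>s. s \<in> {-R..R} \<Longrightarrow> \<bar>h (pt i j (g s) s)\<bar> \<le> H"
    proof -
      obtain H' where "\<And>y. y \<in> (\<lambda>s. h (pt i j (g s) s)) ` {-R..R} \<Longrightarrow> \<bar>y\<bar> \<le> H'"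
        using compact_imp_bounded[OF \<open>compact ((\<lambda>s. h (pt i j (g s) s)) ` {-R..R})\<close>] unfolding bounded_iff by auto
      then show ?thesis by (intro that[of H']) auto
    qed
    have [measurable]: "h \<in> borel_measurable borel"
      by (intro borel_measurable_continuous_onI scalar_test_cont0[OF h])
    show ?thesis
    proof (rule integrable_bounded_compact_support)
      show "compact {-R..R}" by simp
      show "\<bar>a s * h (pt i j (g s) s)\<bar> \<le> A * H" if "s \<in> {-R..R}" for s
        unfolding abs_mult using a(2)[of s] H[OF that] order_trans[OF abs_ge_zero a(2)] by (intro mult_mono) auto
      show "a s * h (pt i j (g s) s) = 0" if "s \<notin> {-R..R}" for s
      proof -
        have "R < \<bar>s\<bar>" using that by auto
        then show ?thesis using R[of "g s" s] by simp
      qed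
      show "(\<lambda>s. a s * h (pt i j (g s) s)) \<in> borel_measurable borel"
        using a(1) borel_measurable_continuous_onI[OF g] by measurable
    qed
  qed
  have "(LINT x:side|lebesgue. divergence T x) = (LINT x|lebesgue. indicator side x * P x $ i + indicator side x * S x $ j)"
    unfolding set_lebesgue_integral_def div by (simp add: distrib_left)
  also have "\<dots> = (LINT x|lborel. indicator side x * P x $ i + indicator side x * S x $ j)"
    by (rule integral_completion) measurable
  also have "\<dots> = (LINT x|lborel. indicator side x * P x $ i) + (LINT x|lborel. indicator side x * S x $ j)"
    using gradient_integrable[OF P, of "\<lambda>_. 1" 1] gradient_integrable[OF S, of "\<lambda>_. 1" 1]
    by (intro Bochner_Integration.integral_add) auto
  also have "\<dots> = - \<sigma> * ((LINT s|lborel. 1 * T (pt i j (g s) s) $ i) - (LINT s|lborel. c s * T (pt i j (g s) s) $ j))"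
    unfolding normal_part'[OF P] tangential_part'[OF S] by (simp add: algebra_simps)
  also have "\<dots> = - \<sigma> * (LINT s|lborel. T (pt i j (g s) s) $ i - c s * T (pt i j (g s) s) $ j)"
    using line[where a="\<lambda>_. 1" and A=1, OF _ _ P] line[OF c cB S] by (subst Bochner_Integration.integral_diff) auto
  finally show ?thesis .
qed

end

lemma divergence_outside:
  assumes T: "test_field \<Omega> T" and x: "x \<notin> \<Omega>"
  shows "divergence T x = 0" "T x = 0"
proof -
  let ?K = "closure {x. T x \<noteq> 0}"
  have K: "x \<notin> ?K" using T x by (auto simp: test_field_def)
  then show "T x = 0" by (rule notin_support)
  have "(T has_derivative (\<lambda>h. 0)) (at x)"
  proof (rule has_derivative_transform_within_open[of "\<lambda>_. 0" _ _ UNIV "- ?K"])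
    show "open (- ?K)" by (rule open_Compl) simp
    show "x \<in> - ?K" using K by simp
    show "0 = T y" if "y \<in> - ?K" for y using that notin_support[of y T] by simp
  qed simp
  from divergence_eq[OF this] show "divergence T x = 0" by simp
qed

lemma integral_divergence_Int:
  assumes "test_field \<Omega> T"
  shows "(LINT x:E \<inter> \<Omega>|lebesgue. divergence T x) = (LINT x:E|lebesgue. divergence T x)"
  unfolding set_lebesgue_integral_def using divergence_outside[OF assms]
  by (intro Bochner_Integration.integral_cong) (auto simp: indicator_def)

section \<open>Uniqueness of the polar decomposition\<close>

lemma AE_nonneg_of_set_integrals:
  fixes h :: "'a \<Rightarrow> real"
  assumes h: "integrable M h" and nn: "\<And>B. B \<in> sets M \<Longrightarrow> 0 \<le> (LINT x:B|M. h x)"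
  shows "AE x in M. 0 \<le> h x"
proof -
  let ?B = "{x \<in> space M. h x < 0}"
  have [measurable]: "h \<in> borel_measurable M" using h by simp
  have B: "?B \<in> sets M" by measurable
  have i: "integrable M (\<lambda>x. - (indicator ?B x * h x))"
    using integrable_mult_indicator[OF B h] by simp
  have "(LINT x|M. - (indicator ?B x * h x)) \<le> 0"
    using nn[OF B] by (simp add: set_lebesgue_integral_def)
  moreover have "0 \<le> (LINT x|M. - (indicator ?B x * h x))"
    by (intro Bochner_Integration.integral_nonneg) (auto simp: indicator_def)
  ultimately have "(LINT x|M. - (indicator ?B x * h x)) = 0" by simp
  then have "AE x in M. - (indicator ?B x * h x) = 0"
    by (subst (asm) integral_nonneg_eq_0_iff_AE[OF i]) (auto simp: indicator_def)
  then show ?thesis using AE_space by eventually_elim (auto simp: indicator_def split: if_splits)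
qed

text \<open>For \<open>a <= b\<close> the product is positive exactly between \<open>a\<close> and
  \<open>b\<close>. The factor \<open>Suc m\<close> eventually pushes it past 1 at each interior
  point, while the threshold \<open>1/2\<close> of \<open>cutoff\<close> keeps the support inside
  the open interval.\<close>

definition interval_bump :: "real \<Rightarrow> real \<Rightarrow> nat \<Rightarrow> real \<Rightarrow> real" where
  "interval_bump a b m t = cutoff ((t - a) * (b - t) * real (Suc m))"

lemma interval_bump_range: "0 \<le> interval_bump a b m t" "interval_bump a b m t \<le> 1"
  unfolding interval_bump_def by (rule cutoff_range)+

lemma interval_bump_tendsto:
  assumes "a \<le> b"
  shows "(\<lambda>m. interval_bump a b m t) \<longlonglongrightarrow> indicator {a<..<b} t"
proof (cases "t \<in> {a<..<b}")
  case True
  then have pos: "0 < (t - a) * (b - t)" by (intro mult_pos_pos) auto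
  obtain N :: nat where N: "1 / ((t - a) * (b - t)) < N" using reals_Archimedean2 by blast
  have "interval_bump a b m t = 1" if "m \<ge> N" for m
  proof -
    have "1 / ((t - a) * (b - t)) \<le> Suc m" using N that by simp
    then show ?thesis unfolding interval_bump_def using pos by (intro cutoff_eq_1) (simp add: field_simps)
  qed
  then have "\<forall>\<^sub>F m in sequentially. interval_bump a b m t = indicator {a<..<b} t"
    using True by (auto simp: eventually_sequentially)
  then show ?thesis by (rule tendsto_eventually)
next
  case False
  have "(t - a) * (b - t) \<le> 0"
    using False assms by (cases "t \<le> a") (auto intro: mult_nonpos_nonneg mult_nonneg_nonpos)
  then have le: "(t - a) * (b - t) * real (Suc m) \<le> 0" for m by (rule mult_nonpos_nonneg) simp
  have "interval_bump a b m t = 0" for m unfolding interval_bump_def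
    by (rule cutoff_eq_0, rule order_trans[OF le]) simp
  then show ?thesis using False by simp
qed

definition box_bump :: "real^2 \<Rightarrow> real^2 \<Rightarrow> nat \<Rightarrow> real^2 \<Rightarrow> real" where
  "box_bump l u m x = interval_bump (l $ 1) (u $ 1) m (x $ 1) * interval_bump (l $ 2) (u $ 2) m (x $ 2)"

lemma box_bump_range: "0 \<le> box_bump l u m x" "box_bump l u m x \<le> 1"
  unfolding box_bump_def using interval_bump_range by (auto intro!: mult_nonneg_nonneg mult_le_one)

lemma box_bump_tendsto:
  assumes "l $ 1 \<le> u $ 1" "l $ 2 \<le> u $ 2"
  shows "(\<lambda>m. box_bump l u m x) \<longlonglongrightarrow> indicator (box l u) x"
proof -
  have "(\<lambda>m. box_bump l u m x) \<longlonglongrightarrow> indicator {l $ 1<..<u $ 1} (x $ 1) * indicator {l $ 2<..<u $ 2} (x $ 2)"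
    unfolding box_bump_def by (intro tendsto_mult interval_bump_tendsto assms)
  also have "indicator {l $ 1<..<u $ 1} (x $ 1) * indicator {l $ 2<..<u $ 2} (x $ 2) = (indicator (box l u) x :: real)"
    by (auto simp: indicator_def mem_box_cart forall_2)
  finally show ?thesis .
qed

lemma scalar_test_box_bump:
  assumes "l $ 1 \<le> u $ 1" "l $ 2 \<le> u $ 2" "box l u \<subseteq> \<Omega>"
  obtains f' where "scalar_test \<Omega> (box_bump l u m) f'"
proof -
  define P where "P k x = (x $ k - l $ k) * (u $ k - x $ k) * real (Suc m)" for k :: 2 and x :: "real^2"
  define P' where "P' k x = ((u $ k - x $ k) - (x $ k - l $ k)) * real (Suc m)" for k :: 2 and x :: "real^2"
  define f' :: "real^2 \<Rightarrow> real^2" where "f' x = (cutoff' (P 1 x) * P' 1 x * cutoff (P 2 x)) *\<^sub>R axis 1 1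
      + (cutoff (P 1 x) * cutoff' (P 2 x) * P' 2 x) *\<^sub>R axis 2 1" for x
  have P: "((\<lambda>x. cutoff (P k x)) has_derivative (\<lambda>h. cutoff' (P k x) * (P' k x * h $ k))) (at x)" for k x
  proof -
    have "(P k has_derivative (\<lambda>h. P' k x * h $ k)) (at x)"
      unfolding P_def P'_def
      by (auto intro!: derivative_eq_intros bounded_linear.has_derivative[OF bounded_linear_vec_nth] simp: algebra_simps)
    from has_derivative_compose[OF this cutoff_deriv[unfolded has_field_derivative_def]]
    show ?thesis .
  qed
  have cc: "continuous_on UNIV (\<lambda>x. cutoff (P k x))" for k
    by (rule has_derivative_continuous_on) (use P has_derivative_at_withinI in blast)
  have "scalar_test \<Omega> (box_bump l u m) f'"
    unfolding scalar_test_def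
  proof (intro conjI allI)
    show "(box_bump l u m has_derivative (\<lambda>h. f' x \<bullet> h)) (at x)" for x
    proof -
      have "((\<lambda>x. cutoff (P 1 x) * cutoff (P 2 x)) has_derivative (\<lambda>h. f' x \<bullet> h)) (at x)"
        by (rule has_derivative_eq_rhs[OF has_derivative_mult[OF P P]])
          (simp add: f'_def inner_add_left inner_axis' algebra_simps fun_eq_iff)
      then show ?thesis by (simp add: box_bump_def[abs_def] interval_bump_def P_def)
    qed
    show "continuous_on UNIV f'"
      unfolding f'_def by (intro continuous_intros cc) (auto simp: P_def P'_def intro!: continuous_intros)
    \<comment> \<open>The bump vanishes unless both products exceed \<open>1/2\<close>; this closed
      condition keeps away from the faces of the box.\<close>
    let ?K = "{x. 1/2 \<le> P 1 x \<and> 1/2 \<le> P 2 x} \<inter> cbox l u"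
    have "closed {x. 1/2 \<le> P 1 x \<and> 1/2 \<le> P 2 x}"
      unfolding P_def by (intro closed_Collect_conj closed_Collect_le continuous_intros)
    then have "compact ?K" by (intro closed_Int_compact compact_cbox)
    moreover have pos: "l $ k < x $ k \<and> x $ k < u $ k" if "1/2 \<le> P k x" "l $ k \<le> u $ k" for k x
    proof -
      have "0 < (x $ k - l $ k) * (u $ k - x $ k) * real (Suc m)" using that(1) by (simp add: P_def)
      then have "0 < (x $ k - l $ k) * (u $ k - x $ k)" by (simp add: zero_less_mult_iff)
      then show ?thesis using that(2) by (auto simp: zero_less_mult_iff)
    qed
    moreover have "?K \<subseteq> \<Omega>"
      using assms(3) pos[of 1] pos[of 2] assms(1,2) by (force simp: mem_box_cart forall_2)
    moreover have "box_bump l u m x = 0" if "x \<notin> ?K" for x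
    proof (rule ccontr)
      assume nz: "box_bump l u m x \<noteq> 0"
      then have "1/2 < P 1 x" "1/2 < P 2 x"
        using cutoff_eq_0[of "P 1 x"] cutoff_eq_0[of "P 2 x"]
        unfolding box_bump_def interval_bump_def P_def[symmetric] by (auto simp: not_le[symmetric])
      then show False using that pos[of 1 x] pos[of 2 x] assms(1,2) by (auto simp: mem_box_cart forall_2)
    qed
    ultimately show "\<exists>K. compact K \<and> K \<subseteq> \<Omega> \<and> (\<forall>x. x \<notin> K \<longrightarrow> box_bump l u m x = 0)" by blast
  qed
  then show ?thesis by (rule that)
qed

lemma unit_square_eq_box: "unit_square = box 0 1"
  by (auto simp: unit_square_def mem_box_cart forall_2)

lemma open_unit_square: "open unit_square"
  unfolding unit_square_eq_box by (rule open_box)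

lemma polar_decompositionD:
  assumes "polar_decomposition \<Omega> A \<mu> \<nu>"
  shows "sets \<mu> = sets borel" "finite_measure \<mu>" "emeasure \<mu> (- \<Omega>) = 0"
    "\<nu> \<in> borel_measurable borel" "AE x in \<mu>. norm (\<nu> x) = 1"
  by (insert assms, unfold polar_decomposition_def, elim conjE, assumption)+

lemma polar_decomposition_divergence:
  assumes "polar_decomposition \<Omega> A \<mu> \<nu>" "test_field \<Omega> T"
  shows "(LINT x:A|lebesgue. divergence T x) = - (LINT x|\<mu>. T x \<bullet> \<nu> x)"
  by (insert assms(1), unfold polar_decomposition_def, elim conjE allE impE, rule assms(2), assumption)

text \<open>Needed to evaluate the \<open>THE\<close> in \<open>total_variation\<close> and
  \<open>indicator_derivative\<close>. Testing with bumps shows that the vector measures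
  \<open>\<nu> \<mu>\<close> and \<open>n \<mu>0\<close> agree on boxes, hence on Borel sets. As
  \<open>n\<close> is constant, the signs of scalar products then identify \<open>\<nu>\<close>, and
  equality of the measures follows.\<close>

lemma polar_decomposition_unique_const:
  fixes A :: "(real^2) set"
  assumes p0: "polar_decomposition unit_square A \<mu>0 (\<lambda>_. n)" and n: "norm n = 1"
    and p: "polar_decomposition unit_square A \<mu> \<nu>"
  shows "\<mu> = \<mu>0" "AE x in \<mu>. \<nu> x = n"
proof -
  note s0 = polar_decompositionD(1)[OF p0] and s = polar_decompositionD(1)[OF p]
    and \<nu> = polar_decompositionD(4)[OF p] and norm1 = polar_decompositionD(5)[OF p]
    and null0 = polar_decompositionD(3)[OF p0] and null = polar_decompositionD(3)[OF p]
  interpret M0: finite_measure \<mu>0 by (rule polar_decompositionD(2)[OF p0])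
  interpret M: finite_measure \<mu> by (rule polar_decompositionD(2)[OF p])
  note [measurable_cong] = s s0
  have sp: "space \<mu> = UNIV" "space \<mu>0 = UNIV"
    using sets_eq_imp_space_eq[OF s] sets_eq_imp_space_eq[OF s0] by auto
  note [measurable] = \<nu>
  have sq [measurable]: "unit_square \<in> sets borel" using open_unit_square by simp
  have aein: "AE x in \<mu>. x \<in> unit_square" "AE x in \<mu>0. x \<in> unit_square"
    using null null0 by (auto intro!: AE_I[of _ _ "- unit_square"] simp: s s0)
  have int: "integrable \<mu> (\<lambda>x. \<nu> x \<bullet> v)" for v
  proof (rule M.integrable_const_bound[where B="norm v"])
    show "AE x in \<mu>. norm (\<nu> x \<bullet> v) \<le> norm v"
      using norm1
    proof eventually_elim
      case (elim x)
      then show ?case using Cauchy_Schwarz_ineq2[of "\<nu> x" v] by simp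
    qed
  qed measurable
  have test: "(LINT x|\<mu>. f x * (\<nu> x \<bullet> v)) = (n \<bullet> v) * (LINT x|\<mu>0. f x)"
    if f: "scalar_test unit_square f f'" for f f' v
  proof -
    have "(LINT x:A|lebesgue. divergence (\<lambda>x. f x *\<^sub>R v) x) = - (LINT x|\<mu>. (f x *\<^sub>R v) \<bullet> \<nu> x)"
      by (rule polar_decomposition_divergence[OF p scalar_test_field(1)[OF f]])
    moreover have "(LINT x:A|lebesgue. divergence (\<lambda>x. f x *\<^sub>R v) x) = - (LINT x|\<mu>0. (f x *\<^sub>R v) \<bullet> n)"
      by (rule polar_decomposition_divergence[OF p0 scalar_test_field(1)[OF f]])
    ultimately show ?thesis by (simp add: inner_commute mult.commute)
  qed
  have box_in: "(LINT x:box l u|\<mu>. \<nu> x \<bullet> v) = (n \<bullet> v) * measure \<mu>0 (box l u)"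
    if lu: "l $ 1 \<le> u $ 1" "l $ 2 \<le> u $ 2" and sub: "box l u \<subseteq> unit_square" for l u v
  proof -
    have eq: "(LINT x|\<mu>. box_bump l u m x * (\<nu> x \<bullet> v)) = (n \<bullet> v) * (LINT x|\<mu>0. box_bump l u m x)" for m
    proof -
      obtain f' where "scalar_test unit_square (box_bump l u m) f'" using scalar_test_box_bump[OF lu sub] .
      then show ?thesis by (rule test)
    qed
    have [measurable]: "box_bump l u m \<in> borel_measurable borel" for m
    proof -
      obtain f' where "scalar_test unit_square (box_bump l u m) f'" using scalar_test_box_bump[OF lu sub] .
      from scalar_test_cont0[OF this] show ?thesis by (rule borel_measurable_continuous_onI)
    qed
    have "(\<lambda>m. LINT x|\<mu>. box_bump l u m x * (\<nu> x \<bullet> v)) \<longlonglongrightarrow> (LINT x|\<mu>. indicator (box l u) x * (\<nu> x \<bullet> v))"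
    proof (rule integral_dominated_convergence[where w="\<lambda>x. \<bar>\<nu> x \<bullet> v\<bar>"])
      show "integrable \<mu> (\<lambda>x. \<bar>\<nu> x \<bullet> v\<bar>)" using int by simp
      show "AE x in \<mu>. (\<lambda>m. box_bump l u m x * (\<nu> x \<bullet> v)) \<longlonglongrightarrow> indicator (box l u) x * (\<nu> x \<bullet> v)"
        by (intro AE_I2 tendsto_mult_right box_bump_tendsto lu)
      show "AE x in \<mu>. norm (box_bump l u m x * (\<nu> x \<bullet> v)) \<le> \<bar>\<nu> x \<bullet> v\<bar>" for m
        using box_bump_range[of l u m] by (intro AE_I2) (simp add: abs_mult mult_left_le_one_le)
    qed measurable
    moreover have "(\<lambda>m. LINT x|\<mu>0. box_bump l u m x) \<longlonglongrightarrow> (LINT x|\<mu>0. indicator (box l u) x)"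
    proof (rule integral_dominated_convergence[where w="\<lambda>x. 1"])
      show "AE x in \<mu>0. (\<lambda>m. box_bump l u m x) \<longlonglongrightarrow> indicator (box l u) x"
        by (intro AE_I2 box_bump_tendsto lu)
      show "AE x in \<mu>0. norm (box_bump l u m x) \<le> 1" for m
        using box_bump_range[of l u m] by (intro AE_I2) simp
    qed auto
    then have "(\<lambda>m. (n \<bullet> v) * (LINT x|\<mu>0. box_bump l u m x)) \<longlonglongrightarrow> (n \<bullet> v) * measure \<mu>0 (box l u)"
      by (intro tendsto_mult_left) (simp add: sp)
    ultimately show ?thesis
      unfolding eq set_lebesgue_integral_def by (simp add: LIMSEQ_unique)
  qed
  have in_sq: "(LINT x:B \<inter> unit_square|\<mu>. \<nu> x \<bullet> v) = (LINT x:B|\<mu>. \<nu> x \<bullet> v)"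
    "measure \<mu>0 (B \<inter> unit_square) = measure \<mu>0 B" if [measurable]: "B \<in> sets borel" for B v
  proof -
    show "(LINT x:B \<inter> unit_square|\<mu>. \<nu> x \<bullet> v) = (LINT x:B|\<mu>. \<nu> x \<bullet> v)"
      unfolding set_lebesgue_integral_def
      by (rule integral_cong_AE) (measurable, use aein(1) in eventually_elim, auto simp: indicator_def)
    show "measure \<mu>0 (B \<inter> unit_square) = measure \<mu>0 B"
      by (rule M0.finite_measure_eq_AE) (use aein(2) in eventually_elim, auto simp: s0 that)
  qed
  have box: "(LINT x:box l u|\<mu>. \<nu> x \<bullet> v) = (n \<bullet> v) * measure \<mu>0 (box l u)" for l u v
  proof -
    \<comment> \<open>Test functions live in the square, so a box is first clipped to it; both
      measures ignore the rest.\<close>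
    let ?l = "(\<chi> k. max (l $ k) 0) :: real^2" and ?u = "(\<chi> k. min (u $ k) 1) :: real^2"
    have e: "box l u \<inter> unit_square = box ?l ?u"
      by (auto simp: unit_square_eq_box mem_box_cart)
    have "(LINT x:box ?l ?u|\<mu>. \<nu> x \<bullet> v) = (n \<bullet> v) * measure \<mu>0 (box ?l ?u)"
    proof (cases "?l $ 1 \<le> ?u $ 1 \<and> ?l $ 2 \<le> ?u $ 2")
      case True
      then show ?thesis using e by (intro box_in) auto
    next
      case False
      then have "box ?l ?u = {}" unfolding interval_eq_empty_cart by (auto simp only: not_le de_Morgan_conj intro: less_imp_le)
      then show ?thesis by (simp add: set_lebesgue_integral_def)
    qed
    then show ?thesis using in_sq[of "box l u"] unfolding e by simp
  qed
  have all: "(LINT x:B|\<mu>. \<nu> x \<bullet> v) = (n \<bullet> v) * measure \<mu>0 B" if "B \<in> sets borel" for B v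
  proof -
    \<comment> \<open>Complements in the Dynkin induction are taken in the whole space, which up to
      null sets is the box \<open>unit_square\<close>.\<close>
    have total: "(LINT x:UNIV|\<mu>. \<nu> x \<bullet> v) = (n \<bullet> v) * measure \<mu>0 UNIV"
      using box[where l=0 and u=1] in_sq[of UNIV] unfolding unit_square_eq_box by simp
    have si: "set_integrable \<mu> B (\<lambda>x. \<nu> x \<bullet> v)" if "B \<in> sets borel" for B
      unfolding set_integrable_def using int that by (intro integrable_mult_indicator) (auto simp: s)
    have gen: "sets (borel :: (real^2) measure) = sigma_sets UNIV (range (\<lambda>(a, b). box a b))"
      by (subst borel_eq_box) (simp add: sets_measure_of)
    have stable: "Int_stable (range (\<lambda>(a, b). box a b :: (real^2) set))"
      by (auto simp: Int_stable_def Int_interval image_iff box_Int_box)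
    have sub: "range (\<lambda>(a, b). box a b :: (real^2) set) \<subseteq> Pow UNIV" by simp
    have "B \<in> sigma_sets UNIV (range (\<lambda>(a, b). box a b))" using that gen by simp
    from stable sub this show ?thesis
    proof (induction rule: sigma_sets_induct_disjoint)
      case (basic A)
      then show ?case using box by auto
    next
      case empty
      then show ?case by (simp add: set_lebesgue_integral_def)
    next
      case (compl A)
      have A: "A \<in> sets borel" using compl gen by simp
      have "(LINT x:UNIV - A|\<mu>. \<nu> x \<bullet> v) = (LINT x:UNIV|\<mu>. \<nu> x \<bullet> v) - (LINT x:A|\<mu>. \<nu> x \<bullet> v)"
        using set_integral_Un[of "UNIV - A" A \<mu> "\<lambda>x. \<nu> x \<bullet> v", OF Diff_disjoint[of A UNIV, unfolded Int_commute[of A]] si si] A by simp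
      also have "\<dots> = (n \<bullet> v) * (measure \<mu>0 UNIV - measure \<mu>0 A)"
        unfolding total compl by (simp add: right_diff_distrib)
      also have "measure \<mu>0 UNIV - measure \<mu>0 A = measure \<mu>0 (UNIV - A)"
        using M0.finite_measure_compl[of A] A by (simp add: sp s0)
      finally show ?case .
    next
      case (union F)
      have F: "range F \<subseteq> sets borel" using union gen by auto
      have "(LINT x:(\<Union>k. F k)|\<mu>. \<nu> x \<bullet> v) = (\<Sum>k. LINT x:F k|\<mu>. \<nu> x \<bullet> v)"
        using F union(1) by (intro lebesgue_integral_countable_add si) (auto simp: s disjoint_family_on_def)
      also have "\<dots> = (\<Sum>k. (n \<bullet> v) * measure \<mu>0 (F k))" using union(3) by simp
      also have "\<dots> = (n \<bullet> v) * (\<Sum>k. measure \<mu>0 (F k))"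
        using M0.finite_measure_UNION[OF _ union(1)] F by (intro suminf_mult) (auto simp: s0 sums_iff)
      also have "(\<Sum>k. measure \<mu>0 (F k)) = measure \<mu>0 (\<Union>k. F k)"
        using M0.finite_measure_UNION[OF _ union(1)] F by (auto simp: s0 sums_iff)
      finally show ?case .
    qed
  qed
  \<comment> \<open>The integral of \<open>\<nu> x \<bullet> v\<close> over every Borel set is a
    multiple of its \<open>\<mu>0\<close>-measure by \<open>n \<bullet> v\<close>, so the integrand
    inherits nonnegativity.\<close>
  have nonneg: "AE x in \<mu>. 0 \<le> \<nu> x \<bullet> v" if "0 \<le> n \<bullet> v" for v
    using that by (intro AE_nonneg_of_set_integrals int) (auto simp: s all)
  have nn: "n \<bullet> n = 1" using n by (simp add: dot_square_norm)
  have perp: "AE x in \<mu>. \<nu> x \<bullet> e = (n \<bullet> e) * (\<nu> x \<bullet> n)" for e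
  proof -
    \<comment> \<open>\<open>?v\<close> is orthogonal to \<open>n\<close>, so the sign condition
      applies to \<open>?v\<close> and to \<open>- ?v\<close> and makes \<open>\<nu> x\<close>
      orthogonal to \<open>?v\<close>.\<close>
    let ?v = "e - (n \<bullet> e) *\<^sub>R n"
    have "n \<bullet> ?v = 0" by (simp add: inner_diff_right nn)
    then have "0 \<le> n \<bullet> ?v" "0 \<le> n \<bullet> - ?v" unfolding inner_minus_right by simp_all
    from nonneg[OF this(1)] nonneg[OF this(2)]
    show ?thesis by eventually_elim (simp add: inner_diff_right)
  qed
  have "AE x in \<mu>. \<forall>e\<in>Basis. \<nu> x \<bullet> e = (n \<bullet> e) * (\<nu> x \<bullet> n)"
    using perp by (intro AE_finite_allI) auto
  moreover have "AE x in \<mu>. 0 \<le> \<nu> x \<bullet> n" using nn by (intro nonneg) simp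
  ultimately show ae: "AE x in \<mu>. \<nu> x = n"
    using norm1
  proof eventually_elim
    case (elim x)
    have eq: "\<nu> x = (\<nu> x \<bullet> n) *\<^sub>R n"
    proof (rule euclidean_eqI)
      fix e :: "real^2" assume "e \<in> Basis"
      with elim(1) show "\<nu> x \<bullet> e = ((\<nu> x \<bullet> n) *\<^sub>R n) \<bullet> e"
        unfolding inner_scaleR_left mult.commute[of "\<nu> x \<bullet> n"] by (rule bspec)
    qed
    have "norm (\<nu> x) = norm ((\<nu> x \<bullet> n) *\<^sub>R n)" by (rule arg_cong[OF eq])
    then have "\<nu> x \<bullet> n = 1" using elim(2,3) n unfolding norm_scaleR by simp
    then have "(\<nu> x \<bullet> n) *\<^sub>R n = n" by simp
    then show ?case by (rule trans[OF eq])
  qed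
  show "\<mu> = \<mu>0"
  proof (rule measure_eqI)
    show "sets \<mu> = sets \<mu>0" using s s0 by simp
    fix B assume "B \<in> sets \<mu>"
    then have B: "B \<in> sets borel" using s by simp
    have "(LINT x:B|\<mu>. \<nu> x \<bullet> n) = (LINT x:B|\<mu>. 1)"
      unfolding set_lebesgue_integral_def
    proof (rule integral_cong_AE)
      show "AE x in \<mu>. indicat_real B x *\<^sub>R (\<nu> x \<bullet> n) = indicat_real B x *\<^sub>R 1"
        using ae by eventually_elim (simp add: nn)
    qed (use B in measurable)
    also have "\<dots> = measure \<mu> B" using B by (simp add: set_lebesgue_integral_def sp)
    finally have "measure \<mu> B = measure \<mu>0 B" using all[OF B, of n] nn by simp
    then show "emeasure \<mu> B = emeasure \<mu>0 B" by (simp add: M.emeasure_eq_measure M0.emeasure_eq_measure)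
  qed
qed

section \<open>Perimeters of half squares\<close>

text \<open>If \<open>f\<close> is not integrable its integral is 0, so the bound holds for every
  \<open>f\<close> dominated by \<open>h\<close>.\<close>

lemma abs_integral_le:
  fixes f h :: "'a \<Rightarrow> real"
  assumes "integrable M h" "\<And>x. \<bar>f x\<bar> \<le> h x"
  shows "\<bar>LINT x|M. f x\<bar> \<le> (LINT x|M. h x)"
proof -
  have "norm (LINT x|M. f x) \<le> (LINT x|M. norm (f x))" by (rule integral_norm_bound)
  also have "\<dots> \<le> (LINT x|M. h x)"
    using assms order_trans[OF abs_ge_zero assms(2)] by (intro integral_mono') auto
  finally show ?thesis by simp
qed

text \<open>A line through the centre with \<open>\<bar>b\<bar> \<le> 1\<close> stays in the square
  for all parameters between 0 and 1, so its length there depends on \<open>b\<close> alone. The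
  choice of axes and of \<open>\<sigma>\<close> covers all normal directions.\<close>

locale half_square =
  fixes i j :: 2 and b \<sigma> :: real
  assumes ij: "i \<noteq> j" and b: "\<bar>b\<bar> \<le> 1" and \<sigma>: "\<sigma> = 1 \<or> \<sigma> = -1"
begin

definition line :: "real \<Rightarrow> real" where "line s = 1/2 + b * (s - 1/2)"

definition seg :: "real \<Rightarrow> real^2" where "seg s = pt i j (line s) s"

definition half :: "(real^2) set" where
  "half = {x \<in> unit_square. 0 < \<sigma> * (x $ i - line (x $ j))}"

definition len :: real where "len = sqrt (1 + b\<^sup>2)"

text \<open>It points into \<open>half\<close>, as does the derivative of an indicator
  function.\<close>

definition conormal :: "real^2" where "conormal = \<sigma> *\<^sub>R (axis i 1 - b *\<^sub>R axis j 1)"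

definition normal :: "real^2" where "normal = (1 / len) *\<^sub>R conormal"

text \<open>Arc length as an image of Lebesgue measure: the polar decomposition can be computed from
  it directly, and Hausdorff measure enters only in the anisotropic perimeter.\<close>

definition seg_measure :: "(real^2) measure" where
  "seg_measure = distr (density lborel (\<lambda>s. ennreal len * indicator {0<..<1} s)) borel seg"

sublocale gr: graph i j line "\<lambda>_. b" "{}" "\<bar>b\<bar>" \<sigma>
  by unfold_locales (use ij \<sigma> in \<open>auto simp: line_def[abs_def] intro!: continuous_intros derivative_eq_intros\<close>)

lemma half_eq: "half = gr.side \<inter> unit_square"
  by (auto simp: half_def gr.side_def)

lemma open_half: "open half"
  unfolding half_eq by (intro open_Int gr.open_side open_unit_square)

lemma half_measurable: "half \<in> measurable_subsets unit_square"
  using open_half by (auto simp: measurable_subsets_def half_def)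

lemma len: "len > 0" "len * len = 1 + b * b"
proof -
  have "1 + b\<^sup>2 > 0" by (intro add_pos_nonneg) auto
  then show "len > 0" "len * len = 1 + b * b" by (auto simp: len_def power2_eq_square)
qed

lemma conormal_nth: "conormal $ i = \<sigma>" "conormal $ j = - \<sigma> * b"
  using ij by (simp_all add: conormal_def axis_def)

lemma norm_conormal: "norm conormal = len"
proof -
  have "\<sigma>\<^sup>2 = 1" using \<sigma> by auto
  then show ?thesis by (simp add: norm_real2[OF ij] conormal_nth len_def power_mult_distrib)
qed

lemma conormal_eq: "conormal = len *\<^sub>R normal"
  using len by (simp add: normal_def)

lemma norm_normal: "norm normal = 1"
  using len norm_conormal by (simp add: normal_def)

lemma unit_square_iff: "x \<in> unit_square \<longleftrightarrow> (0 < x $ i \<and> x $ i < 1) \<and> 0 < x $ j \<and> x $ j < 1"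
proof -
  have "(\<forall>k. 0 < x $ k \<and> x $ k < 1) \<longleftrightarrow> (0 < x $ i \<and> x $ i < 1) \<and> 0 < x $ j \<and> x $ j < 1"
    by (rule forall_2_eq[OF ij])
  then show ?thesis by (auto simp: unit_square_eq_box mem_box_cart)
qed

lemma line_in: "0 < s \<Longrightarrow> s < 1 \<Longrightarrow> 0 < line s \<and> line s < 1"
proof -
  assume s: "0 < s" "s < 1"
  have "\<bar>b * (s - 1/2)\<bar> \<le> 1 * \<bar>s - 1/2\<bar>" unfolding abs_mult using b by (intro mult_right_mono) auto
  also have "\<dots> < 1/2" using s by (simp add: abs_if)
  finally show ?thesis by (auto simp: line_def abs_less_iff)
qed

lemma seg_nth: "seg s $ i = line s" "seg s $ j = s"
  using ij by (simp_all add: seg_def pt_nth)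

lemma seg_in: "seg s \<in> unit_square \<longleftrightarrow> 0 < s \<and> s < 1"
  unfolding unit_square_iff seg_nth using line_in[of s] by blast

lemma seg_image: "seg ` {0<..<1} = {x \<in> unit_square. x $ i = line (x $ j)}"
proof (intro set_eqI iffI)
  fix x assume "x \<in> {x \<in> unit_square. x $ i = line (x $ j)}"
  then have *: "x \<in> unit_square" "x $ i = line (x $ j)" by simp_all
  from *(2) have "x = seg (x $ j)" unfolding vec_eq_2_iff[OF ij] seg_nth by simp
  moreover have "x $ j \<in> {0<..<1}" using *(1) unfolding unit_square_iff by simp
  ultimately show "x \<in> seg ` {0<..<1}" by (rule image_eqI)
next
  fix x assume "x \<in> seg ` {0<..<1}"
  then obtain s where "0 < s" "s < 1" "x = seg s" by auto
  then show "x \<in> {x \<in> unit_square. x $ i = line (x $ j)}" using seg_in[of s] by (simp add: seg_nth)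
qed

lemma continuous_on_seg: "continuous_on S seg"
  unfolding seg_def line_def by (intro continuous_intros)

lemma seg_measurable [measurable]: "seg \<in> borel_measurable borel"
  by (intro borel_measurable_continuous_onI continuous_on_seg)

lemma dist_seg: "dist (seg s) (seg t) = len * \<bar>s - t\<bar>"
proof -
  have "dist (seg s) (seg t) = sqrt ((b * (s - t))\<^sup>2 + (s - t)\<^sup>2)"
    by (simp add: dist_norm norm_real2[OF ij] seg_nth line_def algebra_simps)
  also have "(b * (s - t))\<^sup>2 + (s - t)\<^sup>2 = (1 + b\<^sup>2) * (s - t)\<^sup>2" by (simp add: power2_eq_square algebra_simps)
  finally show ?thesis by (simp add: len_def real_sqrt_mult)
qed

lemma hausdorff1_seg: "emeasure hausdorff1 (seg ` {0<..<1}) = ennreal len"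
proof -
  have "closed {x :: real^2. x $ i = line (x $ j)}"
    unfolding line_def by (intro closed_Collect_eq continuous_intros)
  then have "{x :: real^2. x $ i = line (x $ j)} \<inter> unit_square \<in> sets borel"
    using open_unit_square by (intro sets.Int) auto
  then have "seg ` {0<..<1} \<in> sets borel" unfolding seg_image by (simp add: Int_def conj_commute)
  then show ?thesis using hausdorff1_outer_segment[of seg len, OF dist_seg] by (simp add: emeasure_hausdorff1)
qed

lemma integral_seg_measure:
  fixes f :: "real^2 \<Rightarrow> real"
  assumes [measurable]: "f \<in> borel_measurable borel" and 0: "\<And>x. x \<notin> unit_square \<Longrightarrow> f x = 0"
  shows "(LINT x|seg_measure. f x) = len * (LINT s|lborel. f (seg s))"
proof -
  have "(LINT x|seg_measure. f x) = (LINT s|density lborel (\<lambda>s. ennreal len * indicator {0<..<1} s). f (seg s))"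
    unfolding seg_measure_def by (rule integral_distr) measurable
  also have "\<dots> = (LINT s|density lborel (\<lambda>s. ennreal (len * indicator {0<..<1} s)). f (seg s))"
    using len by (simp add: ennreal_mult' ennreal_indicator)
  also have "\<dots> = (LINT s|lborel. (len * indicator {0<..<1} s) *\<^sub>R f (seg s))"
    using len by (intro integral_density) (auto simp: AE_I2)
  also have "\<dots> = (LINT s|lborel. len * f (seg s))"
    using 0 seg_in by (intro Bochner_Integration.integral_cong) (auto simp: indicator_def)
  finally show ?thesis by simp
qed

lemma emeasure_seg_measure:
  assumes [measurable]: "B \<in> sets borel"
  shows "emeasure seg_measure B = ennreal len * emeasure lborel ({0<..<1} \<inter> seg -` B)"
proof -
  have m [measurable]: "seg -` B \<in> sets borel" using measurable_sets[OF seg_measurable assms] by simp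
  have "emeasure seg_measure B = emeasure (density lborel (\<lambda>s. ennreal len * indicator {0<..<1} s)) (seg -` B)"
    unfolding seg_measure_def by (subst emeasure_distr) auto
  also have "\<dots> = (\<integral>\<^sup>+s. ennreal len * indicator ({0<..<1} \<inter> seg -` B) s \<partial>lborel)"
    by (subst emeasure_density) (auto intro!: nn_integral_cong simp: indicator_def)
  also have "\<dots> = ennreal len * emeasure lborel ({0<..<1} \<inter> seg -` B)"
    by (rule nn_integral_cmult_indicator) auto
  finally show ?thesis .
qed

lemma divergence_half:
  assumes T: "test_field unit_square T"
  shows "(LINT x:half|lebesgue. divergence T x) = - (LINT s|lborel. T (seg s) \<bullet> conormal)"
proof -
  have "(LINT x:half|lebesgue. divergence T x) = - \<sigma> * (LINT s|lborel. T (seg s) $ i - b * T (seg s) $ j)"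
    unfolding half_eq integral_divergence_Int[OF T] gr.gauss_green[OF T] seg_def ..
  also have "\<dots> = - (LINT s|lborel. \<sigma> * (T (seg s) $ i - b * T (seg s) $ j))" by simp
  also have "(\<lambda>s. \<sigma> * (T (seg s) $ i - b * T (seg s) $ j)) = (\<lambda>s. T (seg s) \<bullet> conormal)"
    by (simp add: inner_real2[OF ij] conormal_nth algebra_simps)
  finally show ?thesis .
qed

lemma test_field_measurable:
  assumes "test_field \<Omega> T" shows "T \<in> borel_measurable borel"
proof -
  obtain T' where "\<And>x. (T has_derivative blinfun_apply (T' x)) (at x)" "continuous_on UNIV T'"
    using test_field_derivE[OF assms] by blast
  then have "continuous_on UNIV T"
    by (intro has_derivative_continuous_on) simp
  then show ?thesis by (rule borel_measurable_continuous_onI)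
qed

lemma polar_half: "polar_decomposition unit_square half seg_measure (\<lambda>_. normal)"
  unfolding polar_decomposition_def
proof (intro conjI allI impI)
  show "sets seg_measure = sets borel" by (simp add: seg_measure_def)
  have sp: "space seg_measure = UNIV" by (simp add: seg_measure_def)
  show "finite_measure seg_measure"
    by (rule finite_measureI) (simp add: sp emeasure_seg_measure ennreal_mult_eq_top_iff)
  have "{0<..<1} \<inter> seg -` (- unit_square) = {}" by (auto simp: seg_in)
  then show "emeasure seg_measure (- unit_square) = 0"
    using open_unit_square by (subst emeasure_seg_measure) simp_all
  show "(\<lambda>_. normal) \<in> borel_measurable borel" by simp
  show "AE x in seg_measure. norm normal = 1" by (simp add: norm_normal)
  fix T :: "real^2 \<Rightarrow> real^2" assume T: "test_field unit_square T"
  have "(LINT x|seg_measure. T x \<bullet> normal) = len * (LINT s|lborel. T (seg s) \<bullet> normal)"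
  proof (rule integral_seg_measure)
    show "(\<lambda>x. T x \<bullet> normal) \<in> borel_measurable borel"
      using test_field_measurable[OF T] by measurable
    show "T x \<bullet> normal = 0" if "x \<notin> unit_square" for x
      by (simp add: divergence_outside(2)[OF T that])
  qed
  also have "\<dots> = (LINT s|lborel. T (seg s) \<bullet> conormal)" by (simp add: conormal_eq)
  finally show "(LINT x:half|lebesgue. divergence T x) = - (LINT x|seg_measure. T x \<bullet> normal)"
    by (simp add: divergence_half[OF T])
qed

lemma total_variation_half: "total_variation unit_square half = seg_measure"
  unfolding total_variation_def
proof (rule the_equality)
  show "\<exists>\<nu>. polar_decomposition unit_square half seg_measure \<nu>" using polar_half by blast
  show "\<mu> = seg_measure" if "\<exists>\<nu>. polar_decomposition unit_square half \<mu> \<nu>" for \<mu>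
    using that polar_decomposition_unique_const(1)[OF polar_half norm_normal] by blast
qed

lemma indicator_derivative_half:
  assumes B: "B \<in> sets borel"
  shows "indicator_derivative unit_square half B = measure seg_measure B *\<^sub>R normal"
  unfolding indicator_derivative_def
proof (rule the_equality)
  have s: "sets seg_measure = sets borel" by (simp add: seg_measure_def)
  have fm: "finite_measure seg_measure" by (rule polar_decompositionD(2)[OF polar_half])
  have e: "(LINT x:B|seg_measure. normal) = measure seg_measure B *\<^sub>R normal"
    using B s finite_measure.emeasure_finite[OF fm]
    by (subst set_integral_const) (auto simp: top.not_eq_extremum)
  show "\<exists>\<mu> \<nu>. polar_decomposition unit_square half \<mu> \<nu> \<and> measure seg_measure B *\<^sub>R normal = (LINT x:B|\<mu>. \<nu> x)"
    by (intro exI conjI, rule polar_half, rule e[symmetric])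
  fix d assume "\<exists>\<mu> \<nu>. polar_decomposition unit_square half \<mu> \<nu> \<and> d = (LINT x:B|\<mu>. \<nu> x)"
  then obtain \<mu> \<nu> where p: "polar_decomposition unit_square half \<mu> \<nu>" and d: "d = (LINT x:B|\<mu>. \<nu> x)" by blast
  have \<mu>: "\<mu> = seg_measure" and ae: "AE x in \<mu>. \<nu> x = normal"
    using polar_decomposition_unique_const[OF polar_half norm_normal p] by auto
  have [measurable]: "\<nu> \<in> borel_measurable borel" by (rule polar_decompositionD(4)[OF p])
  have "d = (LINT x:B|seg_measure. normal)"
    unfolding d set_lebesgue_integral_def \<mu>
  proof (rule integral_cong_AE)
    show "AE x in seg_measure. indicat_real B x *\<^sub>R \<nu> x = indicat_real B x *\<^sub>R normal"
      using ae unfolding \<mu> by eventually_elim simp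
    show "(\<lambda>x. indicat_real B x *\<^sub>R \<nu> x) \<in> borel_measurable seg_measure"
      "(\<lambda>x. indicat_real B x *\<^sub>R normal) \<in> borel_measurable seg_measure"
      using B by (simp_all add: measurable_cong_sets[OF s refl])
  qed
  then show "d = measure seg_measure B *\<^sub>R normal" using e by simp
qed

lemma mean_normal_half:
  assumes "measure seg_measure (ball x r) > 0"
  shows "mean_normal unit_square half x r = normal"
  using assms unfolding mean_normal_def total_variation_half indicator_derivative_half[OF borel_open[OF open_ball]]
  by simp

lemma measure_seg_measure_ball:
  assumes s: "0 < s" "s < 1" and r: "r > 0"
  shows "measure seg_measure (ball (seg s) r) > 0"
proof -
  define d where "d = min (min s (1 - s)) (r / (2 * len))"
  have d: "d > 0" "d \<le> s" "d \<le> 1 - s" "len * d < r"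
  proof -
    show "d > 0" "d \<le> s" "d \<le> 1 - s" using s r len by (auto simp: d_def)
    have "len * d \<le> len * (r / (2 * len))" using len by (intro mult_left_mono) (auto simp: d_def)
    also have "\<dots> < r" using len r by simp
    finally show "len * d < r" .
  qed
  have sub: "{s - d<..<s + d} \<subseteq> {0<..<1} \<inter> seg -` ball (seg s) r"
  proof
    fix t assume t: "t \<in> {s - d<..<s + d}"
    then have "len * \<bar>s - t\<bar> \<le> len * d" using len by (intro mult_left_mono) (auto simp: abs_le_iff)
    then show "t \<in> {0<..<1} \<inter> seg -` ball (seg s) r" using t d by (auto simp: dist_seg)
  qed
  have [measurable]: "seg -` ball (seg s) r \<in> sets borel" using measurable_sets[OF seg_measurable, of "ball (seg s) r"] by simp
  have "0 < ennreal len * emeasure lborel {s - d<..<s + d}" using d len by (simp add: ennreal_zero_less_mult_iff)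
  also have "\<dots> \<le> emeasure seg_measure (ball (seg s) r)"
    unfolding emeasure_seg_measure[OF borel_open[OF open_ball]]
    by (intro mult_left_mono emeasure_mono sub) auto
  finally have "0 < emeasure seg_measure (ball (seg s) r)" .
  moreover have "finite_measure seg_measure" by (rule polar_decompositionD(2)[OF polar_half])
  ultimately show ?thesis by (simp add: finite_measure.emeasure_eq_measure)
qed

lemma normal_seg:
  assumes s: "0 < s" "s < 1"
  shows "(mean_normal unit_square half (seg s) \<longlongrightarrow> normal) (at_right 0)"
    and "normal_vector unit_square half (seg s) = normal"
proof -
  have "\<forall>\<^sub>F r in at_right 0. mean_normal unit_square half (seg s) r = normal"
    using eventually_at_right_less[of "0::real"]
    by eventually_elim (intro mean_normal_half measure_seg_measure_ball s)
  then show *: "(mean_normal unit_square half (seg s) \<longlongrightarrow> normal) (at_right 0)"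
    by (rule tendsto_eventually)
  then show "normal_vector unit_square half (seg s) = normal"
    unfolding normal_vector_def by (intro tendsto_Lim) auto
qed

text \<open>On the segment the mean normal does not depend on small \<open>r\<close> at all, because
  \<open>normal\<close> is constant; off the segment a small ball carries no variation.\<close>

lemma reduced_boundary_half: "reduced_boundary unit_square half = seg ` {0<..<1}"
proof (intro set_eqI iffI)
  fix x assume "x \<in> seg ` {0<..<1}"
  then show "x \<in> reduced_boundary unit_square half"
    using seg_in measure_seg_measure_ball normal_seg norm_normal
    by (auto simp: reduced_boundary_def total_variation_half)
next
  fix x assume x: "x \<in> reduced_boundary unit_square half"
  then have sq: "x \<in> unit_square" by (simp add: reduced_boundary_def)
  show "x \<in> seg ` {0<..<1}"
  proof (rule ccontr)
    assume "x \<notin> seg ` {0<..<1}"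
    then have ne: "x $ i \<noteq> line (x $ j)" using sq by (auto simp: seg_image)
    have "open {y :: real^2. y $ i \<noteq> line (y $ j)}"
      unfolding line_def by (intro open_Collect_neq continuous_intros)
    then obtain r where r: "r > 0" "ball x r \<subseteq> {y. y $ i \<noteq> line (y $ j)}"
      using ne open_contains_ball by blast
    then have "seg -` ball x r = {}" by (auto simp: seg_nth subset_iff)
    then have "measure seg_measure (ball x r) = 0"
      by (simp add: measure_def emeasure_seg_measure)
    then show False using x r(1) by (auto simp: reduced_boundary_def total_variation_half)
  qed
qed

lemma perimeter_half: "perimeter half unit_square < \<infinity>"
proof -
  have "perimeter half unit_square \<le> ennreal len"
    unfolding perimeter_def
  proof (rule SUP_least)
    fix T :: "real^2 \<Rightarrow> real^2" assume "T \<in> {T. test_field unit_square T \<and> (\<forall>x. norm (T x) \<le> 1)}"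
    then have T: "test_field unit_square T" and T1: "\<And>x. norm (T x) \<le> 1" by auto
    have "\<bar>LINT s|lborel. T (seg s) \<bullet> conormal\<bar> \<le> (LINT s|lborel. len * indicator {0<..<1::real} s)"
    proof (rule abs_integral_le)
      show "integrable lborel (\<lambda>s. len * indicator {0<..<1::real} s)" by simp
      show "\<bar>T (seg s) \<bullet> conormal\<bar> \<le> len * indicator {0<..<1} s" for s
      proof (cases "0 < s \<and> s < 1")
        case True
        have "\<bar>T (seg s) \<bullet> conormal\<bar> \<le> norm (T (seg s)) * len"
          using Cauchy_Schwarz_ineq2[of "T (seg s)" conormal] by (simp add: norm_conormal)
        also have "\<dots> \<le> 1 * len" using T1 len by (intro mult_right_mono) auto
        finally show ?thesis using True by simp
      next
        case False
        then show ?thesis by (simp add: divergence_outside(2)[OF T] seg_in)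
      qed
    qed
    then have "(LINT x:half|lebesgue. divergence T x) \<le> len"
      unfolding divergence_half[OF T] by (simp add: abs_le_iff)
    then show "ennreal (LINT x:half|lebesgue. divergence T x) \<le> ennreal len" by (rule ennreal_leI)
  qed
  then show ?thesis by (rule le_less_trans) simp
qed

text \<open>The integral is \<open>\<phi> normal\<close> times the length of the segment;
  homogeneity absorbs the length into \<open>conormal\<close>.\<close>

lemma anisotropic_perimeter_half:
  assumes \<phi>: "\<And>x. 0 \<le> \<phi> x" "\<And>t x. 0 \<le> t \<Longrightarrow> \<phi> (t *\<^sub>R x) = t * \<phi> x"
  shows "anisotropic_perimeter unit_square \<phi> half = ennreal (\<phi> conormal)"
proof -
  have m: "seg ` {0<..<1} \<in> sets hausdorff1"
  proof -
    have "closed {x :: real^2. x $ i = line (x $ j)}"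
      unfolding line_def by (intro closed_Collect_eq continuous_intros)
    then have "{x :: real^2. x $ i = line (x $ j)} \<inter> unit_square \<in> sets borel"
      using open_unit_square by (intro sets.Int) auto
    then show ?thesis unfolding seg_image by (simp add: Int_def conj_commute)
  qed
  have "anisotropic_perimeter unit_square \<phi> half =
      (\<integral>\<^sup>+x\<in>seg ` {0<..<1}. ennreal (\<phi> (normal_vector unit_square half x)) \<partial>hausdorff1)"
    unfolding anisotropic_perimeter_def reduced_boundary_half using perimeter_half by simp
  also have "\<dots> = (\<integral>\<^sup>+x. ennreal (\<phi> normal) * indicator (seg ` {0<..<1}) x \<partial>hausdorff1)"
    by (intro nn_integral_cong) (auto simp: indicator_def normal_seg)
  also have "\<dots> = ennreal (\<phi> normal) * ennreal len"
    using m by (simp add: nn_integral_cmult_indicator hausdorff1_seg)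
  also have "\<dots> = ennreal (\<phi> conormal)"
    using len \<phi> by (simp add: conormal_eq mult.commute flip: ennreal_mult)
  finally show ?thesis .
qed

end

section \<open>The cells of the triangulation\<close>

text \<open>Left unnormalised, so that every edge lies on a line where \<open>k\<close> times the
  form is an integer.\<close>

definition edge_normal :: "nat \<Rightarrow> real^2" where
  "edge_normal l = (if l = 0 then vector [1, 0] else if l = 1 then vector [0, 1]
     else if l = 2 then vector [1, 1] else vector [1, -1])"

text \<open>The edges lie on four families of equidistant lines, and inside the square the triangles
  are exactly the components of the complement of these lines. A triangle is thus encoded by the
  integer parts \<open>z l\<close> of four linear forms; for arbitrary \<open>z\<close> the cell may
  be empty.\<close>

definition cell :: "nat \<Rightarrow> (nat \<Rightarrow> int) \<Rightarrow> (real^2) set" where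
  "cell k z = {x. \<forall>l<4. z l < k * (edge_normal l \<bullet> x) \<and> k * (edge_normal l \<bullet> x) < z l + 1}"

definition closed_cell :: "nat \<Rightarrow> (nat \<Rightarrow> int) \<Rightarrow> (real^2) set" where
  "closed_cell k z = {x. \<forall>l<4. z l \<le> k * (edge_normal l \<bullet> x) \<and> k * (edge_normal l \<bullet> x) \<le> z l + 1}"

lemma all_less_4: "(\<forall>l<4. P (l::nat)) \<longleftrightarrow> P 0 \<and> P 1 \<and> P 2 \<and> P 3"
proof -
  have "{..<4::nat} = {0, 1, 2, 3}" by auto
  then have "(\<forall>l\<in>{..<4}. P l) \<longleftrightarrow> P 0 \<and> P 1 \<and> P 2 \<and> P 3" by simp
  then show ?thesis by (simp add: Ball_def)
qed

lemma inner_vector2: "vector [a, b] \<bullet> (x :: real^2) = a * x $ 1 + b * x $ 2"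
  by (simp add: inner_vec_def sum_2)

lemma edge_normal_inner:
  "edge_normal 0 \<bullet> x = x $ 1" "edge_normal (Suc 0) \<bullet> x = x $ 2"
  "edge_normal 2 \<bullet> x = x $ 1 + x $ 2" "edge_normal 3 \<bullet> x = x $ 1 - x $ 2"
  by (simp_all add: edge_normal_def inner_vector2)

lemma edge_normal_nonzero: "edge_normal l \<noteq> 0"
  by (auto simp: edge_normal_def vec_eq_iff forall_2)

lemma open_cell: "open (cell k z)"
proof -
  have "cell k z = (\<Inter>l\<in>{..<4}. {x. z l < k * (edge_normal l \<bullet> x)} \<inter> {x. k * (edge_normal l \<bullet> x) < z l + 1})"
    by (auto simp: cell_def)
  also have "open \<dots>" by (intro open_INT ballI open_Int open_Collect_less continuous_intros) simp
  finally show ?thesis .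
qed

lemma closed_cell_eq: "closed_cell k z =
    (\<Inter>l\<in>{..<4}. {x. (- real k *\<^sub>R edge_normal l) \<bullet> x \<le> - z l} \<inter> {x. (real k *\<^sub>R edge_normal l) \<bullet> x \<le> z l + 1})"
  by (auto simp: closed_cell_def)

lemma interior_closed_cell:
  assumes k: "k > 0" shows "interior (closed_cell k z) = cell k z"
proof
  have "interior (closed_cell k z) \<subseteq> (\<Inter>l\<in>{..<4}. interior ({x. (- real k *\<^sub>R edge_normal l) \<bullet> x \<le> - z l} \<inter>
      {x. (real k *\<^sub>R edge_normal l) \<bullet> x \<le> z l + 1}))"
    unfolding closed_cell_eq by (intro INT_greatest interior_mono INT_lower)
  also have "\<dots> = cell k z"
  proof -
    have "interior ({x. (- real k *\<^sub>R edge_normal l) \<bullet> x \<le> - z l} \<inter> {x. (real k *\<^sub>R edge_normal l) \<bullet> x \<le> z l + 1}) =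
        {x. (- real k *\<^sub>R edge_normal l) \<bullet> x < - z l} \<inter> {x. (real k *\<^sub>R edge_normal l) \<bullet> x < z l + 1}" for l
      unfolding interior_Int using k edge_normal_nonzero[of l]
      by (subst (1 2) interior_halfspace_le) auto
    then show ?thesis by (auto simp: cell_def)
  qed
  finally show "interior (closed_cell k z) \<subseteq> cell k z" .
  show "cell k z \<subseteq> interior (closed_cell k z)"
    by (intro interior_maximal open_cell) (auto simp: cell_def closed_cell_def intro: less_imp_le)
qed

lemma closed_closed_cell: "closed (closed_cell k z)"
  unfolding closed_cell_eq by (intro closed_INT ballI closed_Int closed_halfspace_le)

lemma convex_closed_cell: "convex (closed_cell k z)"
  unfolding closed_cell_eq by (intro convex_INT ballI convex_Int convex_halfspace_le)

lemma closure_cell: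
  assumes "k > 0" "cell k z \<noteq> {}" shows "closure (cell k z) = closed_cell k z"
  using convex_closure_interior[OF convex_closed_cell, of k z] closed_closed_cell assms
  by (simp add: interior_closed_cell closure_closed)

text \<open>\<open>p\<close> and \<open>q\<close> tell on which side of the two diagonals of the
  small square \<open>(i, j)\<close> the triangle lies. The minus sign arises because the difference
  of the scaled coordinates has integer part \<open>i - j\<close> or
  \<open>i - j - 1\<close>.\<close>

definition triangle_index :: "nat \<Rightarrow> nat \<Rightarrow> nat \<Rightarrow> nat \<Rightarrow> nat \<Rightarrow> int" where
  "triangle_index i j p q l = (if l = 0 then int i else if l = 1 then int j
     else if l = 2 then int i + int j + int p else int i - int j - int q)"

lemma mem_cell_triangle: "x \<in> cell k (triangle_index i j p q) \<longleftrightarrow>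
   (i < k * x $ 1 \<and> k * x $ 1 < i + 1) \<and> (j < k * x $ 2 \<and> k * x $ 2 < j + 1) \<and>
   (real i + real j + real p < k * (x $ 1 + x $ 2) \<and> k * (x $ 1 + x $ 2) < real i + real j + real p + 1) \<and>
   (real i - real j - real q < k * (x $ 1 - x $ 2) \<and> k * (x $ 1 - x $ 2) < real i - real j - real q + 1)"
  by (simp add: cell_def all_less_4 triangle_index_def edge_normal_inner)

lemma mem_closed_cell_triangle: "x \<in> closed_cell k (triangle_index i j p q) \<longleftrightarrow>
   (i \<le> k * x $ 1 \<and> k * x $ 1 \<le> i + 1) \<and> (j \<le> k * x $ 2 \<and> k * x $ 2 \<le> j + 1) \<and>
   (real i + real j + real p \<le> k * (x $ 1 + x $ 2) \<and> k * (x $ 1 + x $ 2) \<le> real i + real j + real p + 1) \<and>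
   (real i - real j - real q \<le> k * (x $ 1 - x $ 2) \<and> k * (x $ 1 - x $ 2) \<le> real i - real j - real q + 1)"
  by (simp add: closed_cell_def all_less_4 triangle_index_def edge_normal_inner)

lemma convex_hull_triangle:
  fixes a b c :: "real^2"
  assumes "{a, b, c} \<subseteq> closed_cell k z"
    and "\<And>x. x \<in> closed_cell k z \<Longrightarrow> \<exists>u v w. 0 \<le> u \<and> 0 \<le> v \<and> 0 \<le> w \<and> u + v + w = 1 \<and> u *\<^sub>R a + v *\<^sub>R b + w *\<^sub>R c = x"
  shows "convex hull {a, b, c} = closed_cell k z"
proof
  show "convex hull {a, b, c} \<subseteq> closed_cell k z"
    by (intro hull_minimal assms(1) convex_closed_cell)
  show "closed_cell k z \<subseteq> convex hull {a, b, c}"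
  proof
    fix x assume "x \<in> closed_cell k z"
    from assms(2)[OF this] show "x \<in> convex hull {a, b, c}" unfolding convex_hull_3 by force
  qed
qed

lemma double_diagonal_eq:
  "double_diagonal = {cell 1 (triangle_index 0 0 p q) | p q. p < 2 \<and> q < 2}"
proof -
  note ms = mem_closed_cell_triangle vec_eq_iff forall_2
  have "convex hull {vector [1/2, 1/2], vector [0, 0], vector [1, 0]} = closed_cell 1 (triangle_index 0 0 0 0)"
  proof (rule convex_hull_triangle)
    fix x assume "x \<in> closed_cell 1 (triangle_index 0 0 0 0)"
    \<comment> \<open>The witnesses are barycentric coordinates: that of the centre is twice the
      distance to the outer edge. The other three triangles follow the same pattern.\<close>
    then show "\<exists>u v w. 0 \<le> u \<and> 0 \<le> v \<and> 0 \<le> w \<and> u + v + w = 1 \<and>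
        u *\<^sub>R vector [1/2, 1/2] + v *\<^sub>R vector [0, 0] + w *\<^sub>R vector [1, 0] = x"
      by - (rule exI[of _ "2 * x $ 2"], rule exI[of _ "1 - x $ 1 - x $ 2"], rule exI[of _ "x $ 1 - x $ 2"], auto simp: ms diff_divide_distrib)
  qed (auto simp: ms diff_divide_distrib)
  moreover have "convex hull {vector [1/2, 1/2], vector [1, 0], vector [1, 1]} = closed_cell 1 (triangle_index 0 0 1 0)"
  proof (rule convex_hull_triangle)
    fix x assume "x \<in> closed_cell 1 (triangle_index 0 0 1 0)"
    then show "\<exists>u v w. 0 \<le> u \<and> 0 \<le> v \<and> 0 \<le> w \<and> u + v + w = 1 \<and>
        u *\<^sub>R vector [1/2, 1/2] + v *\<^sub>R vector [1, 0] + w *\<^sub>R vector [1, 1] = x"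
      by - (rule exI[of _ "2 * (1 - x $ 1)"], rule exI[of _ "x $ 1 - x $ 2"], rule exI[of _ "x $ 1 + x $ 2 - 1"], auto simp: ms diff_divide_distrib)
  qed (auto simp: ms diff_divide_distrib)
  moreover have "convex hull {vector [1/2, 1/2], vector [1, 1], vector [0, 1]} = closed_cell 1 (triangle_index 0 0 1 1)"
  proof (rule convex_hull_triangle)
    fix x assume "x \<in> closed_cell 1 (triangle_index 0 0 1 1)"
    then show "\<exists>u v w. 0 \<le> u \<and> 0 \<le> v \<and> 0 \<le> w \<and> u + v + w = 1 \<and>
        u *\<^sub>R vector [1/2, 1/2] + v *\<^sub>R vector [1, 1] + w *\<^sub>R vector [0, 1] = x"
      by - (rule exI[of _ "2 * (1 - x $ 2)"], rule exI[of _ "x $ 1 + x $ 2 - 1"], rule exI[of _ "x $ 2 - x $ 1"], auto simp: ms diff_divide_distrib)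
  qed (auto simp: ms diff_divide_distrib)
  moreover have "convex hull {vector [1/2, 1/2], vector [0, 1], vector [0, 0]} = closed_cell 1 (triangle_index 0 0 0 1)"
  proof (rule convex_hull_triangle)
    fix x assume "x \<in> closed_cell 1 (triangle_index 0 0 0 1)"
    then show "\<exists>u v w. 0 \<le> u \<and> 0 \<le> v \<and> 0 \<le> w \<and> u + v + w = 1 \<and>
        u *\<^sub>R vector [1/2, 1/2] + v *\<^sub>R vector [0, 1] + w *\<^sub>R vector [0, 0] = x"
      by - (rule exI[of _ "2 * x $ 1"], rule exI[of _ "x $ 2 - x $ 1"], rule exI[of _ "1 - x $ 1 - x $ 2"], auto simp: ms diff_divide_distrib)
  qed (auto simp: ms diff_divide_distrib)
  ultimately have "double_diagonal = {cell 1 (triangle_index 0 0 0 0), cell 1 (triangle_index 0 0 1 0),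
      cell 1 (triangle_index 0 0 1 1), cell 1 (triangle_index 0 0 0 1)}"
    unfolding double_diagonal_def by (simp add: interior_closed_cell)
  also have "\<dots> = {cell 1 (triangle_index 0 0 p q) | p q. p < 2 \<and> q < 2}"
    by (auto simp: less_2_cases_iff)
  finally show ?thesis .
qed

lemma image_cell:
  assumes k: "k > 0"
  shows "(\<lambda>x. (1 / real k) *\<^sub>R (x + vector [real i, real j])) ` cell 1 (triangle_index 0 0 p q) =
    cell k (triangle_index i j p q)"
proof (intro set_eqI iffI)
  fix y assume "y \<in> (\<lambda>x. (1 / real k) *\<^sub>R (x + vector [real i, real j])) ` cell 1 (triangle_index 0 0 p q)"
  then obtain x where x: "x \<in> cell 1 (triangle_index 0 0 p q)" and y: "y = (1 / real k) *\<^sub>R (x + vector [real i, real j])"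
    by blast
  have "k * y $ 1 = x $ 1 + i" "k * y $ 2 = x $ 2 + j" using k by (simp_all add: y)
  then show "y \<in> cell k (triangle_index i j p q)"
    using x unfolding mem_cell_triangle distrib_left right_diff_distrib by auto
next
  fix y assume y: "y \<in> cell k (triangle_index i j p q)"
  define x where "x = real k *\<^sub>R y - vector [real i, real j]"
  have "x $ 1 = k * y $ 1 - i" "x $ 2 = k * y $ 2 - j" by (simp_all add: x_def)
  then have "x \<in> cell 1 (triangle_index 0 0 p q)"
    using y unfolding mem_cell_triangle distrib_left right_diff_distrib by auto
  moreover have "y = (1 / real k) *\<^sub>R (x + vector [real i, real j])"
    using k by (simp add: x_def)
  ultimately show "y \<in> (\<lambda>x. (1 / real k) *\<^sub>R (x + vector [real i, real j])) ` cell 1 (triangle_index 0 0 p q)"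
    by (rule rev_image_eqI)
qed

lemma triangulation_eq:
  assumes k: "k > 0"
  shows "periodic_triangulation double_diagonal k =
    {cell k (triangle_index i j p q) | i j p q. i < k \<and> j < k \<and> p < 2 \<and> q < 2}"
proof -
  have "periodic_triangulation double_diagonal k =
      (\<Union>i\<in>{..<k}. \<Union>j\<in>{..<k}. {cell k (triangle_index i j p q) | p q. p < 2 \<and> q < 2})"
    unfolding periodic_triangulation_def double_diagonal_eq
  proof (intro SUP_cong refl)
    fix i j
    show "(\<lambda>t. (\<lambda>x. (1 / real k) *\<^sub>R (x + vector [real i, real j])) ` t) ` {cell 1 (triangle_index 0 0 p q) | p q. p < 2 \<and> q < 2} =
        {cell k (triangle_index i j p q) | p q. p < 2 \<and> q < 2}"
      unfolding image_cell[OF k, symmetric] by blast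
  qed
  also have "\<dots> = {cell k (triangle_index i j p q) | i j p q. i < k \<and> j < k \<and> p < 2 \<and> q < 2}" by auto
  finally show ?thesis .
qed

lemma cell_nonempty:
  assumes k: "k > 0" and pq: "p < 2" "q < 2"
  shows "cell k (triangle_index i j p q) \<noteq> {}"
proof -
  define x :: "real^2" where "x = vector [1/2 + (real p - real q) / 4, 1/4 + (real p + real q) / 4]"
  have "x \<in> cell 1 (triangle_index 0 0 p q)"
    using pq unfolding mem_cell_triangle by (auto simp: x_def less_2_cases_iff)
  then show ?thesis using image_cell[OF k, of i j p q] by blast
qed

lemma triangle_cases:
  assumes k: "k > 0" and t: "t \<in> periodic_triangulation double_diagonal k"
  obtains z where "t = cell k z" "closure t = closed_cell k z" "closed_cell k z \<subseteq> cbox 0 1"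
proof -
  obtain i j p q where t: "t = cell k (triangle_index i j p q)" and ij: "i < k" "j < k" and pq: "p < 2" "q < 2"
    using t unfolding triangulation_eq[OF k] by blast
  have "closed_cell k (triangle_index i j p q) \<subseteq> cbox 0 1"
  proof
    fix x assume "x \<in> closed_cell k (triangle_index i j p q)"
    then have x: "0 \<le> k * x $ 1" "0 \<le> k * x $ 2" "k * x $ 1 \<le> i + 1" "k * x $ 2 \<le> j + 1"
      unfolding mem_closed_cell_triangle by auto
    have "real i + 1 \<le> k" "real j + 1 \<le> k" using ij by auto
    then have "real k * x $ 1 \<le> real k * 1" "real k * x $ 2 \<le> real k * 1" using x by linarith+
    from mult_left_le_imp_le[OF this(1)] mult_left_le_imp_le[OF this(2)]
    have "x $ 1 \<le> 1" "x $ 2 \<le> 1" using k by simp_all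
    moreover have "real k * 0 \<le> real k * x $ 1" "real k * 0 \<le> real k * x $ 2" using x by simp_all
    from mult_left_le_imp_le[OF this(1)] mult_left_le_imp_le[OF this(2)]
    have "0 \<le> x $ 1" "0 \<le> x $ 2" using k by simp_all
    ultimately show "x \<in> cbox 0 1" by (simp add: mem_box_cart forall_2)
  qed
  then show ?thesis using that t closure_cell[OF k cell_nonempty[OF k pq]] by blast
qed

lemma triangles_cover:
  assumes k: "k > 0" and x: "x \<in> unit_square"
  obtains t where "t \<in> periodic_triangulation double_diagonal k" "x \<in> closure t"
proof -
  define i where "i = nat \<lfloor>k * x $ 1\<rfloor>"
  define j where "j = nat \<lfloor>k * x $ 2\<rfloor>"
  have x1: "0 < x $ 1" "x $ 1 < 1" "0 < x $ 2" "x $ 2 < 1" using x by (auto simp: unit_square_def)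
  have pos: "0 \<le> k * x $ 1" "0 \<le> k * x $ 2" using x1 by auto
  have ri: "real i = of_int \<lfloor>k * x $ 1\<rfloor>" and rj: "real j = of_int \<lfloor>k * x $ 2\<rfloor>" unfolding i_def j_def using pos by auto
  have i: "real i \<le> k * x $ 1" "k * x $ 1 < real i + 1" unfolding ri by linarith+
  have j: "real j \<le> k * x $ 2" "k * x $ 2 < real j + 1" unfolding rj by linarith+
  have "real k * x $ 1 < real k * 1" "real k * x $ 2 < real k * 1" by (rule mult_strict_left_mono; use x1 k in simp)+
  then have "real i < k" "real j < k" using i j by linarith+
  then have ijk: "i < k" "j < k" by auto
  \<comment> \<open>Points on a diagonal belong to two closed triangles; ties go to index 0.\<close>
  define p :: nat where "p = (if k * x $ 1 - i + (k * x $ 2 - j) \<le> 1 then 0 else 1)"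
  define q :: nat where "q = (if k * x $ 2 - j \<le> k * x $ 1 - i then 0 else 1)"
  have pq: "p < 2" "q < 2" by (auto simp: p_def q_def)
  have "x \<in> closed_cell k (triangle_index i j p q)"
    using i j unfolding mem_closed_cell_triangle distrib_left right_diff_distrib by (auto simp: p_def q_def)
  moreover have "cell k (triangle_index i j p q) \<in> periodic_triangulation double_diagonal k"
    unfolding triangulation_eq[OF k] using ijk pq by blast
  ultimately show ?thesis using that closure_cell[OF k cell_nonempty[OF k pq]] by blast
qed

lemma open_triangulated: "E \<in> triangulated_sets \<T> \<Longrightarrow> open E"
  by (auto simp: triangulated_sets_def)

lemma triangulated_subset_unit_square:
  assumes k: "k > 0" and E: "E \<in> triangulated_sets (periodic_triangulation double_diagonal k)"
  shows "E \<subseteq> unit_square"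
proof -
  obtain \<F> where F: "\<F> \<subseteq> periodic_triangulation double_diagonal k" and E: "E = interior (\<Union>t\<in>\<F>. closure t)"
    using E by (auto simp: triangulated_sets_def)
  have "(\<Union>t\<in>\<F>. closure t) \<subseteq> cbox 0 1"
  proof (rule UN_least)
    fix t assume "t \<in> \<F>"
    then have "t \<in> periodic_triangulation double_diagonal k" using F by blast
    from triangle_cases[OF k this] obtain z where "closure t = closed_cell k z" "closed_cell k z \<subseteq> cbox 0 1" .
    then show "closure t \<subseteq> cbox 0 1" by simp
  qed
  then have "E \<subseteq> interior (cbox 0 1)" unfolding E by (rule interior_mono)
  then show ?thesis by (simp add: unit_square_eq_box interior_cbox)
qed

text \<open>Off the lines, membership in \<open>E\<close> depends only on four integer parts: a
  point of \<open>E\<close> lies in the closure of a selected triangle, and non-integrality puts it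
  and every point with the same integer parts into the open triangle.\<close>

lemma triangulated_same_floor:
  assumes k: "k > 0" and E: "E \<in> triangulated_sets (periodic_triangulation double_diagonal k)"
    and x: "\<And>l. l < 4 \<Longrightarrow> k * (edge_normal l \<bullet> x) \<notin> \<int>" and y: "\<And>l. l < 4 \<Longrightarrow> k * (edge_normal l \<bullet> y) \<notin> \<int>"
    and fl: "\<And>l. l < 4 \<Longrightarrow> \<lfloor>k * (edge_normal l \<bullet> x)\<rfloor> = \<lfloor>k * (edge_normal l \<bullet> y)\<rfloor>"
    and xE: "x \<in> E"
  shows "y \<in> E"
proof -
  obtain \<F> where F: "\<F> \<subseteq> periodic_triangulation double_diagonal k" and E: "E = interior (\<Union>t\<in>\<F>. closure t)"
    using E by (auto simp: triangulated_sets_def)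
  obtain t where t: "t \<in> \<F>" "x \<in> closure t" using xE interior_subset unfolding E by blast
  have "t \<in> periodic_triangulation double_diagonal k" using F t(1) by blast
  from triangle_cases[OF k this] obtain z where z: "t = cell k z" "closure t = closed_cell k z" .
  have "y \<in> cell k z"
    unfolding cell_def
  proof (intro CollectI allI impI)
    fix l :: nat assume l: "l < 4"
    let ?a = "k * (edge_normal l \<bullet> x)" and ?b = "k * (edge_normal l \<bullet> y)"
    have "of_int (z l) \<le> ?a" "?a \<le> of_int (z l) + 1" using t(2) l unfolding z(2) closed_cell_def by auto
    moreover have "?a \<noteq> of_int (z l + 1)" using x[OF l] by (metis Ints_of_int)
    ultimately have "\<lfloor>?a\<rfloor> = z l" by (simp add: floor_eq_iff)
    then have "\<lfloor>?b\<rfloor> = z l" using fl[OF l] by simp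
    then have "of_int (z l) \<le> ?b" "?b < of_int (z l) + 1" by (simp_all add: floor_eq_iff)
    moreover have "?b \<noteq> of_int (z l)" using y[OF l] by (metis Ints_of_int)
    ultimately show "of_int (z l) < ?b \<and> ?b < of_int (z l) + 1" by simp
  qed
  moreover have "cell k z \<subseteq> E"
    unfolding E using t(1) z by (intro interior_maximal open_cell) (auto intro: subsetD[OF closure_subset])
  ultimately show ?thesis by blast
qed

text \<open>\<open>triangulated_sets\<close> consists of interiors of unions of closures, so it is
  not enough that each triangle lies inside or outside \<open>U\<close>: the condition on
  \<open>interior (closure U)\<close> excludes slits.\<close>

lemma triangulated_set_of_open:
  assumes k: "k > 0" and U: "open U" "U \<subseteq> unit_square" "interior (closure U) \<subseteq> U"
    and dich: "\<And>t. t \<in> periodic_triangulation double_diagonal k \<Longrightarrow> t \<subseteq> U \<or> t \<inter> U = {}"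
  shows "U \<in> triangulated_sets (periodic_triangulation double_diagonal k)"
proof -
  let ?F = "{t \<in> periodic_triangulation double_diagonal k. t \<subseteq> U}"
  have "U = interior (\<Union>t\<in>?F. closure t)"
  proof
    show "U \<subseteq> interior (\<Union>t\<in>?F. closure t)"
    proof (rule interior_maximal[OF _ U(1)], rule subsetI)
      fix x assume x: "x \<in> U"
      obtain t where t: "t \<in> periodic_triangulation double_diagonal k" "x \<in> closure t"
        using triangles_cover[OF k, of x] x U(2) by blast
      have "t \<inter> U \<noteq> {}" using t(2) x U(1) by (metis Int_commute disjoint_iff open_Int_closure_eq_empty)
      then show "x \<in> (\<Union>t\<in>?F. closure t)" using dich[OF t(1)] t by blast
    qed
    have "(\<Union>t\<in>?F. closure t) \<subseteq> closure U" by (auto dest: closure_mono)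
    then have "interior (\<Union>t\<in>?F. closure t) \<subseteq> interior (closure U)" by (rule interior_mono)
    then show "interior (\<Union>t\<in>?F. closure t) \<subseteq> U" using U(3) by blast
  qed
  then show ?thesis unfolding triangulated_sets_def by blast
qed

lemma cell_forms:
  assumes ij: "(i :: 2) \<noteq> j"
  obtains a b c d :: int where "\<And>x. x \<in> cell k z \<Longrightarrow>
    (a < k * x $ i \<and> k * x $ i < a + 1) \<and> (b < k * x $ j \<and> k * x $ j < b + 1) \<and>
    (c < k * x $ i + k * x $ j \<and> k * x $ i + k * x $ j < c + 1) \<and> (d < k * x $ i - k * x $ j \<and> k * x $ i - k * x $ j < d + 1)"
proof -
  have x: "(z 0 < k * x $ 1 \<and> k * x $ 1 < z 0 + 1) \<and> (z 1 < k * x $ 2 \<and> k * x $ 2 < z 1 + 1) \<and>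
    (z 2 < k * x $ 1 + k * x $ 2 \<and> k * x $ 1 + k * x $ 2 < z 2 + 1) \<and>
    (z 3 < k * x $ 1 - k * x $ 2 \<and> k * x $ 1 - k * x $ 2 < z 3 + 1)" if "x \<in> cell k z" for x
    using that unfolding cell_def all_less_4 by (auto simp: edge_normal_inner algebra_simps)
  have "i = 1 \<and> j = 2 \<or> i = 2 \<and> j = 1" using ij exhaust_2[of i] exhaust_2[of j] by auto
  then show ?thesis
  proof
    assume "i = 1 \<and> j = 2"
    then show ?thesis using that[of "z 0" "z 1" "z 2" "z 3"] x by blast
  next
    assume "i = 2 \<and> j = 1"
    \<comment> \<open>Exchanging the axes negates the fourth form, and the negative of the interval
      from \<open>z 3\<close> to \<open>z 3 + 1\<close> starts at \<open>- z 3 - 1\<close>.\<close>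
    then show ?thesis using that[of "z 1" "z 0" "z 2" "- z 3 - 1"] x by (force simp: add.commute)
  qed
qed

section \<open>Upper bound: staircase sets\<close>

text \<open>At an interior point of the closure the non-strict inequality still holds after a step
  of \<open>e / 2\<close> towards the graph, which makes it strict at the point itself.\<close>

lemma (in graph) interior_closure_side:
  "interior (closure (side \<inter> unit_square)) \<subseteq> side \<inter> unit_square"
proof
  fix x assume x: "x \<in> interior (closure (side \<inter> unit_square))"
  let ?C = "{x. 0 \<le> \<sigma> * (x $ i - g (x $ j))}"
  have "closed ?C"
    by (intro closed_Collect_le continuous_intros continuous_on_compose2[OF g]) auto
  then have sub: "closure (side \<inter> unit_square) \<subseteq> ?C \<inter> cbox 0 1"
    unfolding unit_square_eq_box
    by (intro closure_minimal closed_Int closed_cbox) (auto simp: side_def intro: subsetD[OF box_subset_cbox])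
  have "x \<in> interior (cbox 0 1)" using x sub interior_mono[of "closure (side \<inter> unit_square)" "cbox 0 1"] by blast
  then have 1: "x \<in> unit_square" by (simp add: unit_square_eq_box interior_cbox)
  obtain e where e: "e > 0" "ball x e \<subseteq> closure (side \<inter> unit_square)"
    using x unfolding mem_interior by blast
  define y where "y = x - (\<sigma> * e / 2) *\<^sub>R axis i 1"
  have \<sigma>2: "\<sigma> * \<sigma> = 1" "\<bar>\<sigma>\<bar> = 1" using \<sigma> by auto
  have "dist x y < e" using e(1) \<sigma>2 by (simp add: y_def dist_norm abs_mult)
  then have "y \<in> ?C" using e(2) sub by auto
  moreover have "y $ i = x $ i - \<sigma> * e / 2" "y $ j = x $ j" using ij by (auto simp: y_def axis_def)
  ultimately have "0 \<le> \<sigma> * (x $ i - g (x $ j)) - (\<sigma> * \<sigma>) * e / 2" by (simp add: algebra_simps)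
  then have "0 < \<sigma> * (x $ i - g (x $ j))" using e(1) \<sigma>2 by simp
  then show "x \<in> side \<inter> unit_square" using 1 by (simp add: side_def)
qed

text \<open>For the slopes of straight edges and diagonals the length is affine in the absolute
  slope, so the total length can be read off from the number of jumps.\<close>

lemma sqrt_le_slope: "c = 0 \<or> c = 1 \<or> c = -1 \<Longrightarrow> sqrt (1 + c\<^sup>2) = 1 + (sqrt 2 - 1) * \<bar>c :: real\<bar>"
  by auto

context half_square
begin

text \<open>Rounding the line down at the heights \<open>m / k\<close> gives mesh vertices, and
  consecutive ones are joined along a straight edge or a diagonal.\<close>

definition lattice :: "nat \<Rightarrow> nat \<Rightarrow> int" where
  "lattice k m = \<lfloor>k * line (m / k)\<rfloor>"

definition jump :: "nat \<Rightarrow> nat \<Rightarrow> int" where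
  "jump k m = lattice k (Suc m) - lattice k m"

text \<open>The linear interpolation between the lattice points \<open>(lattice k m / k, m / k)\<close>, constant
  outside the unit interval.\<close>

definition stair :: "nat \<Rightarrow> real \<Rightarrow> real" where
  "stair k s = (real_of_int (lattice k 0) + (\<Sum>m<k. real_of_int (jump k m) * max 0 (min 1 (real k * s - real m)))) / k"

definition stair_slope :: "nat \<Rightarrow> real \<Rightarrow> real" where
  "stair_slope k s = (if 0 < s \<and> s < 1 then real_of_int (jump k (nat \<lfloor>real k * s\<rfloor>)) else 0)"

lemma line_step:
  assumes "k > 0" shows "real k * line (real (Suc m) / k) = k * line (m / k) + b"
  using assms by (simp add: line_def field_simps)

text \<open>The sampled values advance by \<open>b\<close> with
  \<open>\<bar>b\<bar> \<le> 1\<close>, so their floors advance by at most 1 and always in the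
  direction of \<open>b\<close>. The common sign means that the staircase makes no detour.\<close>

lemma jump_sign:
  assumes k: "k > 0"
  shows "0 \<le> b \<Longrightarrow> jump k m = 0 \<or> jump k m = 1" "b \<le> 0 \<Longrightarrow> jump k m = 0 \<or> jump k m = -1"
proof -
  define y where "y = k * line (m / k)"
  have e: "jump k m = \<lfloor>y + b\<rfloor> - \<lfloor>y\<rfloor>"
    unfolding jump_def lattice_def line_step[OF k] y_def ..
  have "0 \<le> b \<Longrightarrow> \<lfloor>y\<rfloor> \<le> \<lfloor>y + b\<rfloor> \<and> \<lfloor>y + b\<rfloor> \<le> \<lfloor>y\<rfloor> + 1" "b \<le> 0 \<Longrightarrow> \<lfloor>y + b\<rfloor> \<le> \<lfloor>y\<rfloor> \<and> \<lfloor>y\<rfloor> - 1 \<le> \<lfloor>y + b\<rfloor>"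
    using b by linarith+
  then show "0 \<le> b \<Longrightarrow> jump k m = 0 \<or> jump k m = 1" "b \<le> 0 \<Longrightarrow> jump k m = 0 \<or> jump k m = -1"
    unfolding e by linarith+
qed

lemma jump_cases:
  assumes k: "k > 0" shows "jump k m = 0 \<or> jump k m = 1 \<or> jump k m = -1"
  using jump_sign[OF k, of m] by linarith

lemma jump_sum: "(\<Sum>m<n. jump k m) = lattice k n - lattice k 0"
  unfolding jump_def by (rule sum_lessThan_telescope)

text \<open>As all jumps have the same sign, the absolute values telescope too; the two floors
  account for the additional 1.\<close>

lemma jump_abs_sum:
  assumes k: "k > 0" shows "(\<Sum>m<k. \<bar>jump k m\<bar>) \<le> k * \<bar>b\<bar> + 1"
proof -
  have "(\<Sum>m<k. \<bar>jump k m\<bar>) = \<bar>\<Sum>m<k. jump k m\<bar>"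
  proof (cases "0 \<le> b")
    case True
    then have "0 \<le> jump k m" for m using jump_sign(1)[OF k, of m] by linarith
    then show ?thesis by (simp add: sum_nonneg)
  next
    case False
    then have "jump k m \<le> 0" for m using jump_sign(2)[OF k, of m] by linarith
    then show ?thesis by (simp add: sum_nonpos abs_of_nonpos sum_negf)
  qed
  also have "\<dots> = \<bar>lattice k k - lattice k 0\<bar>" unfolding jump_sum ..
  also have "real_of_int \<dots> \<le> k * \<bar>b\<bar> + 1"
  proof -
    have e: "k * line (k / k) = k * line (0 / k) + k * b" using k by (simp add: line_def algebra_simps)
    have "\<bar>k * b\<bar> = k * \<bar>b\<bar>" by (simp add: abs_mult)
    then show ?thesis unfolding lattice_def of_nat_0 e by linarith
  qed
  finally show ?thesis .
qed

lemma stair_on: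
  fixes s :: real
  assumes k: "k > 0" and m: "m < k" "m \<le> k * s" "k * s \<le> real m + 1"
  shows "k * stair k s = lattice k m + real_of_int (jump k m) * (real k * s - real m)"
proof -
  have "(\<Sum>n<k. real_of_int (jump k n) * max 0 (min 1 (real k * s - real n))) =
      (\<Sum>n<k. (if n < m then real_of_int (jump k n) else 0) + (if n = m then real_of_int (jump k m) * (real k * s - real m) else 0))"
  proof (rule sum.cong[OF refl])
    fix n :: nat
    consider "n < m" | "n = m" | "m < n" by linarith
    then show "real_of_int (jump k n) * max 0 (min 1 (real k * s - real n)) =
        (if n < m then real_of_int (jump k n) else 0) + (if n = m then real_of_int (jump k m) * (real k * s - real m) else 0)"
    proof cases
      case 1
      then have "real n + 1 \<le> m" by simp
      then have "max 0 (min 1 (real k * s - real n)) = 1" using m by simp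
      then show ?thesis using 1 by simp
    next
      case 2
      then have "max 0 (min 1 (real k * s - real n)) = k * s - m" using m by simp
      then show ?thesis using 2 by simp
    next
      case 3
      then have "real m + 1 \<le> n" by simp
      then have "max 0 (min 1 (real k * s - real n)) = 0" using m by simp
      then show ?thesis using 3 by simp
    qed
  qed
  also have "\<dots> = (\<Sum>n<k. if n < m then real_of_int (jump k n) else 0) + real_of_int (jump k m) * (real k * s - real m)"
    using m(1) by (simp add: sum.distrib)
  also have "(\<Sum>n<k. if n < m then real_of_int (jump k n) else 0) = (\<Sum>n<m. real_of_int (jump k n))"
    using m(1) by (intro sum.mono_neutral_cong_right) auto
  also have "\<dots> = lattice k m - lattice k 0"
    using jump_sum[of k m] by (simp flip: of_int_sum)
  finally show ?thesis using k by (simp add: stair_def)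
qed

lemma stair_outside:
  fixes s :: real
  assumes k: "k > 0"
  shows "s \<le> 0 \<Longrightarrow> stair k s = lattice k 0 / k" "1 \<le> s \<Longrightarrow> stair k s = lattice k k / k"
proof -
  assume s: "s \<le> 0"
  have "max 0 (min 1 (real k * s - real m)) = 0" for m :: nat
    using mult_nonneg_nonpos[of "real k" s] s by simp
  then show "stair k s = lattice k 0 / k" by (simp add: stair_def)
next
  assume s: "1 \<le> s"
  have "max 0 (min 1 (real k * s - real m)) = 1" if "m < k" for m :: nat
  proof -
    have "real k * 1 \<le> real k * s" using s by (intro mult_left_mono) auto
    moreover have "real m + 1 \<le> real k" using that by simp
    ultimately have "1 \<le> real k * s - real m" by linarith
    then show ?thesis by simp
  qed
  then have "(\<Sum>m<k. real_of_int (jump k m) * max 0 (min 1 (real k * s - real m))) = (\<Sum>m<k. real_of_int (jump k m))"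
    by (intro sum.cong) auto
  also have "\<dots> = lattice k k - lattice k 0"
    using jump_sum[of k k] by (simp flip: of_int_sum)
  finally show "stair k s = lattice k k / k" by (simp add: stair_def)
qed

lemma floor_strip:
  fixes s :: real and k :: nat
  assumes k: "k > 0" and s: "0 < s" "s < 1"
  obtains m where "m < k" "nat \<lfloor>k * s\<rfloor> = m" "m \<le> k * s" "k * s < real m + 1"
proof -
  define m where "m = nat \<lfloor>k * s\<rfloor>"
  have "real m = of_int \<lfloor>k * s\<rfloor>" unfolding m_def using s by simp
  then have m: "m \<le> k * s" "k * s < real m + 1" by linarith+
  have "real k * s < real k * 1" by (rule mult_strict_left_mono) (use s k in auto)
  then have "real m < k" using m by linarith
  then have "m < k" by simp
  then show ?thesis using that m m_def by blast
qed

text \<open>One \<open>1 / k\<close> comes from rounding at the lower end of the strip, the other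
  from a difference of slopes of at most 1 across a strip of height \<open>1 / k\<close>.\<close>

lemma stair_near_line:
  fixes s :: real
  assumes k: "k > 0" and s: "0 < s" "s < 1"
  shows "\<bar>stair k s - line s\<bar> \<le> 2 / k"
proof -
  obtain m where m: "m < k" "m \<le> k * s" "k * s < real m + 1" using floor_strip[OF assms] .
  define \<theta> where "\<theta> = k * s - m"
  have \<theta>: "0 \<le> \<theta>" "\<theta> \<le> 1" using m by (auto simp: \<theta>_def)
  have e: "k * line s = k * line (m / k) + b * \<theta>" using k by (simp add: line_def \<theta>_def field_simps)
  have D: "jump k m * \<theta> - b * \<theta> = (jump k m - b) * \<theta>" by (simp add: left_diff_distrib)
  have "\<bar>jump k m - b\<bar> \<le> 1"
    using jump_sign[OF k, of m] b by (cases "0 \<le> b") auto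
  then have "\<bar>(jump k m - b) * \<theta>\<bar> \<le> 1 * 1" unfolding abs_mult using \<theta> by (intro mult_mono) auto
  moreover have "\<bar>lattice k m - k * line (m / k)\<bar> \<le> 1" unfolding lattice_def by linarith
  ultimately have "\<bar>k * stair k s - k * line s\<bar> \<le> 2"
    using stair_on[OF k m(1,2)] m(3) e D unfolding \<theta>_def[symmetric] by linarith
  also have "\<bar>k * stair k s - k * line s\<bar> = k * \<bar>stair k s - line s\<bar>"
    by (simp add: abs_mult flip: right_diff_distrib)
  finally show ?thesis using k by (simp add: field_simps)
qed

lemma graph_stair:
  assumes k: "k > 0"
  shows "graph i j (stair k) (stair_slope k) ((\<lambda>m. real m / k) ` {..k}) 1 \<sigma>"
proof
  show "continuous_on UNIV (stair k)"
    unfolding stair_def using k by (intro continuous_intros) auto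
  have "(\<lambda>s. real_of_int (jump k (nat \<lfloor>real k * s\<rfloor>))) \<in> borel_measurable borel"
    by (rule measurable_compose[where f="\<lambda>s. \<lfloor>real k * s\<rfloor>" and N="count_space UNIV" and g="\<lambda>n. real_of_int (jump k (nat n))"])
      measurable
  then show "stair_slope k \<in> borel_measurable borel"
    unfolding stair_slope_def by measurable
  show "\<bar>stair_slope k s\<bar> \<le> 1" for s
    using jump_cases[OF k, of "nat \<lfloor>k * s\<rfloor>"] by (auto simp: stair_slope_def)
  show "(stair k has_real_derivative stair_slope k s) (at s)" if s: "s \<notin> (\<lambda>m. real m / k) ` {..k}" for s
  proof -
    have "s \<noteq> 0" using s k by force
    moreover have "s \<noteq> 1" using s k by force
    ultimately consider "s < 0" | "1 < s" | "0 < s" "s < 1" by linarith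
    then show ?thesis
    proof cases
      case 1
      have "\<forall>\<^sub>F u in nhds s. lattice k 0 / k = stair k u"
        using 1 stair_outside(1)[OF k] by (intro eventually_nhds_in_open[of "{..<0}", THEN eventually_mono]) auto
      then have "(stair k has_real_derivative 0) (at s)"
        by (rule DERIV_cong_ev[OF refl _ refl, THEN iffD1]) simp
      then show ?thesis using 1 by (simp add: stair_slope_def)
    next
      case 2
      have "\<forall>\<^sub>F u in nhds s. lattice k k / k = stair k u"
        using 2 stair_outside(2)[OF k] by (intro eventually_nhds_in_open[of "{1<..}", THEN eventually_mono]) auto
      then have "(stair k has_real_derivative 0) (at s)"
        by (rule DERIV_cong_ev[OF refl _ refl, THEN iffD1]) simp
      then show ?thesis using 2 by (simp add: stair_slope_def)
    next
      case 3
      obtain m where m: "m < k" "nat \<lfloor>k * s\<rfloor> = m" "m \<le> k * s" "k * s < real m + 1" using floor_strip[OF k 3] .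
      have "m \<noteq> k * s"
      proof
        assume "m = k * s"
        then have "s = m / k" using k by simp
        then show False using s m(1) by auto
      qed
      then have s': "s \<in> {m / k<..<(real m + 1) / k}" using m k by (simp add: field_simps)
      have "(lattice k m + real_of_int (jump k m) * (real k * u - real m)) / k = stair k u" if "u \<in> {m / k<..<(real m + 1) / k}" for u
      proof -
        have "m \<le> k * u" "k * u \<le> real m + 1" using that k by (auto simp: field_simps)
        from stair_on[OF k m(1) this] show ?thesis using k by (simp add: field_simps)
      qed
      then have "\<forall>\<^sub>F u in nhds s. (lattice k m + real_of_int (jump k m) * (real k * u - real m)) / k = stair k u"
        using s' by (intro eventually_nhds_in_open[of "{m / k<..<(real m + 1) / k}", THEN eventually_mono]) auto
      then have "(stair k has_real_derivative jump k m) (at s)"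
        by (rule DERIV_cong_ev[OF refl _ refl, THEN iffD1]) (use k in \<open>auto intro!: derivative_eq_intros\<close>)
      then show ?thesis using 3 m(2) by (simp add: stair_slope_def)
    qed
  qed
qed (use ij \<sigma> in auto)

definition stair_set :: "nat \<Rightarrow> (real^2) set" where
  "stair_set k = {x \<in> unit_square. 0 < \<sigma> * (x $ i - stair k (x $ j))}"

lemma stair_set_eq:
  assumes "k > 0" shows "stair_set k = graph.side i j (stair k) \<sigma> \<inter> unit_square"
  by (auto simp: stair_set_def graph.side_def[OF graph_stair[OF assms]])

text \<open>Within one strip the staircase lies on a mesh line, where one of the four forms has an
  integer value. A triangle lies in a single strip and that form takes no integer value on it, so
  the whole triangle is on one side.\<close>

lemma stair_set_triangulated:
  assumes k: "k > 0"
  shows "stair_set k \<in> triangulated_sets (periodic_triangulation double_diagonal k)"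
proof (rule triangulated_set_of_open[OF k])
  interpret g: graph i j "stair k" "stair_slope k" "(\<lambda>m. real m / k) ` {..k}" 1 \<sigma>
    by (rule graph_stair[OF k])
  show "open (stair_set k)" unfolding stair_set_eq[OF k] by (intro open_Int g.open_side open_unit_square)
  show "stair_set k \<subseteq> unit_square" by (auto simp: stair_set_def)
  show "interior (closure (stair_set k)) \<subseteq> stair_set k"
    unfolding stair_set_eq[OF k] by (rule g.interior_closure_side)
  fix t assume t: "t \<in> periodic_triangulation double_diagonal k"
  obtain z where z: "t = cell k z" "closed_cell k z \<subseteq> cbox 0 1" using triangle_cases[OF k t] .
  have tsub: "t \<subseteq> unit_square"
  proof -
    have "interior (closed_cell k z) \<subseteq> interior (cbox 0 1)" by (rule interior_mono[OF z(2)])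
    then show ?thesis by (simp add: z(1) interior_closed_cell[OF k] unit_square_eq_box interior_cbox)
  qed
  obtain p q c d :: int where F: "\<And>x. x \<in> cell k z \<Longrightarrow>
    (p < k * x $ i \<and> k * x $ i < p + 1) \<and> (q < k * x $ j \<and> k * x $ j < q + 1) \<and>
    (c < k * x $ i + k * x $ j \<and> k * x $ i + k * x $ j < c + 1) \<and> (d < k * x $ i - k * x $ j \<and> k * x $ i - k * x $ j < d + 1)"
    using cell_forms[OF ij, where k=k and z=z] by blast
  have "y \<in> stair_set k" if xy: "x \<in> t" "x \<in> stair_set k" "y \<in> t" for x y
  proof -
    have sq: "x \<in> unit_square" "y \<in> unit_square" using tsub xy by auto
    have Fx: "x \<in> cell k z" and Fy: "y \<in> cell k z" using xy z(1) by auto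
    obtain m where m: "m < k" "m \<le> k * x $ j" "k * x $ j < real m + 1"
      using floor_strip[OF k, of "x $ j"] sq(1) unfolding unit_square_iff by blast
    have "real_of_int q < real m + 1" "real m < real_of_int q + 1" using F[OF Fx] m by linarith+
    then have q: "q = int m" by linarith
    \<comment> \<open>The integer part of the form that is constant along the staircase in this
      strip: the jumps 0, 1, -1 select \<open>x_i\<close>, \<open>x_i - x_j\<close>,
      \<open>x_i + x_j\<close>.\<close>
    define w where "w = (if jump k m = 0 then p else if jump k m = 1 then d else c)"
    have W: "w < k * x $ i - real_of_int (jump k m) * (k * x $ j)" "k * x $ i - real_of_int (jump k m) * (k * x $ j) < w + 1" if "x \<in> cell k z" for x
      using F[OF that] jump_cases[OF k, of m] by (auto simp: w_def)
    let ?K = "lattice k m - jump k m * int m"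
    have val: "k * (x $ i - stair k (x $ j)) = (k * x $ i - real_of_int (jump k m) * (k * x $ j)) - ?K" if "x \<in> cell k z" for x
    proof -
      have "m \<le> k * x $ j" "k * x $ j \<le> real m + 1" using F[OF that] q by auto
      from stair_on[OF k m(1) this] show ?thesis by (simp add: algebra_simps)
    qed
    have sgn: "0 < \<sigma> * v \<longleftrightarrow> 0 < \<sigma> * (k * v)" for v :: real
    proof -
      have "\<sigma> * (k * v) = k * (\<sigma> * v)" by simp
      then show ?thesis using k by (simp only: zero_less_mult_iff[of "real k"]) auto
    qed
    have int: "0 < \<sigma> * (v - of_int K) \<longleftrightarrow> (if \<sigma> = 1 then K \<le> w else w < K)"
      if "of_int w < v" "v < of_int (w + 1)" for v :: real and K
    proof (cases "\<sigma> = 1")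
      case True
      have "K \<le> w \<longleftrightarrow> of_int K < v" by (rule iffI) (use that in linarith)+
      then show ?thesis using True by simp
    next
      case False
      have "w < K \<longleftrightarrow> v < of_int K" by (rule iffI) (use that in linarith)+
      then show ?thesis using False \<sigma> by auto
    qed
    have iff: "0 < \<sigma> * (x $ i - stair k (x $ j)) \<longleftrightarrow> (if \<sigma> = 1 then ?K \<le> w else w < ?K)" if "x \<in> cell k z" for x
      unfolding sgn[of "x $ i - stair k (x $ j)"] val[OF that] by (rule int[OF W[OF that]])
    show ?thesis using xy(2) sq(2) iff[OF Fx] iff[OF Fy] by (simp add: stair_set_def)
  qed
  then show "t \<subseteq> stair_set k \<or> t \<inter> stair_set k = {}" by blast
qed

lemma perimeter_stair_set:
  assumes k: "k > 0"
  shows "perimeter (stair_set k) unit_square \<le> ennreal (1 + (sqrt 2 - 1) * (\<bar>b\<bar> + 1 / k))"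
  unfolding perimeter_def
proof (rule SUP_least)
  interpret g: graph i j "stair k" "stair_slope k" "(\<lambda>m. real m / k) ` {..k}" 1 \<sigma>
    by (rule graph_stair[OF k])
  fix T :: "real^2 \<Rightarrow> real^2" assume "T \<in> {T. test_field unit_square T \<and> (\<forall>x. norm (T x) \<le> 1)}"
  then have T: "test_field unit_square T" and T1: "\<And>x. norm (T x) \<le> 1" by auto
  let ?I = "\<lambda>m. {real m / k ..< (real m + 1) / k}"
  \<comment> \<open>A majorant of the length density: 1 for the parameter, plus
    \<open>sqrt 2 - 1\<close> on every strip with a jump.\<close>
  define h where "h s = indicator {0<..<1} s + (sqrt 2 - 1) * (\<Sum>m<k. real_of_int \<bar>jump k m\<bar> * indicator (?I m) s)" for s :: real
  let ?f = "\<lambda>s. T (pt i j (stair k s) s) $ i - stair_slope k s * T (pt i j (stair k s) s) $ j"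
  have I: "integrable lborel (indicator (?I m) :: real \<Rightarrow> real)" "(LINT s|lborel. indicator (?I m) s) = 1 / k" for m
  proof -
    have le: "real m / k \<le> (real m + 1) / k" by (simp add: divide_right_mono)
    show "integrable lborel (indicator (?I m) :: real \<Rightarrow> real)" using le by simp
    show "(LINT s|lborel. indicator (?I m) s) = 1 / k" using le k by (simp add: add_divide_distrib)
  qed
  have hi: "integrable lborel h"
    unfolding h_def using I(1) by (intro Bochner_Integration.integrable_add integrable_mult_right Bochner_Integration.integrable_sum) simp_all
  have h0: "0 \<le> (sqrt 2 - 1) * (\<Sum>m<k. real_of_int \<bar>jump k m\<bar> * indicator (?I m) s :: real)" for s
    by (intro mult_nonneg_nonneg sum_nonneg) auto
  have "\<bar>LINT s|lborel. ?f s\<bar> \<le> (LINT s|lborel. h s)"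
  proof (rule abs_integral_le[OF hi])
    show "\<bar>?f s\<bar> \<le> h s" for s
    proof (cases "0 < s \<and> s < 1")
      case False
      then have "pt i j (stair k s) s \<notin> unit_square" using ij by (auto simp: unit_square_iff pt_nth)
      then show ?thesis using h0[of s] False by (simp add: divergence_outside(2)[OF T] h_def)
    next
      case True
      obtain m where m: "m < k" "nat \<lfloor>k * s\<rfloor> = m" "m \<le> k * s" "k * s < real m + 1"
        using floor_strip[OF k, of s] True by blast
      let ?c = "stair_slope k s" and ?v = "axis i 1 - stair_slope k s *\<^sub>R axis j (1::real)"
      have c: "?c = jump k m" using True m(2) by (simp add: stair_slope_def)
      have vn: "?v $ i = 1" "?v $ j = - ?c" using ij by (auto simp: axis_def)
      have "?f s = T (pt i j (stair k s) s) \<bullet> ?v" unfolding inner_real2[OF ij] vn by simp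
      then have "\<bar>?f s\<bar> \<le> norm (T (pt i j (stair k s) s)) * norm ?v" using Cauchy_Schwarz_ineq2 by metis
      also have "\<dots> \<le> 1 * norm ?v" using T1 by (intro mult_right_mono) auto
      also have "norm ?v = sqrt (1 + ?c\<^sup>2)" unfolding norm_real2[OF ij] vn by simp
      also have "\<dots> = 1 + (sqrt 2 - 1) * \<bar>?c\<bar>" unfolding c by (rule sqrt_le_slope) (use jump_cases[OF k, of m] in auto)
      also have "1 * (1 + (sqrt 2 - 1) * \<bar>?c\<bar>) \<le> h s"
      proof -
        have "s \<in> ?I m" using m k by (simp add: field_simps)
        then have "\<bar>?c\<bar> = real_of_int \<bar>jump k m\<bar> * indicator (?I m) s" unfolding c by simp
        also have "\<dots> \<le> (\<Sum>m<k. real_of_int \<bar>jump k m\<bar> * indicator (?I m) s)"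
          using m(1) by (intro member_le_sum[where f="\<lambda>m. real_of_int \<bar>jump k m\<bar> * indicator (?I m) s"]) auto
        finally show ?thesis using True by (simp add: h_def mult_left_mono)
      qed
      finally show ?thesis .
    qed
  qed
  also have "(LINT s|lborel. h s) = 1 + (sqrt 2 - 1) * (\<Sum>m<k. real_of_int \<bar>jump k m\<bar> * (1 / k))"
  proof -
    have Si: "integrable lborel (\<lambda>s. \<Sum>m<k. real_of_int \<bar>jump k m\<bar> * indicator (?I m) s)"
      by (intro Bochner_Integration.integrable_sum integrable_mult_right I(1))
    have "(LINT s|lborel. (\<Sum>m<k. real_of_int \<bar>jump k m\<bar> * indicator (?I m) s)) =
        (\<Sum>m<k. LINT s|lborel. real_of_int \<bar>jump k m\<bar> * indicator (?I m) s)"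
      by (intro Bochner_Integration.integral_sum integrable_mult_right I(1))
    also have "\<dots> = (\<Sum>m<k. real_of_int \<bar>jump k m\<bar> * (1 / k))"
      unfolding integral_mult_right_zero I(2) ..
    finally show ?thesis
      unfolding h_def using Si by (subst Bochner_Integration.integral_add) simp_all
  qed
  also have "\<dots> = 1 + (sqrt 2 - 1) * (real_of_int (\<Sum>m<k. \<bar>jump k m\<bar>) / k)"
    by (simp add: sum_divide_distrib)
  also have "\<dots> \<le> 1 + (sqrt 2 - 1) * ((k * \<bar>b\<bar> + 1) / k)"
    using jump_abs_sum[OF k] by (intro add_left_mono mult_left_mono divide_right_mono) auto
  also have "(real k * \<bar>b\<bar> + 1) / k = \<bar>b\<bar> + 1 / k" using k by (simp add: field_simps)
  finally have *: "\<bar>LINT s|lborel. ?f s\<bar> \<le> 1 + (sqrt 2 - 1) * (\<bar>b\<bar> + 1 / k)" .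
  have "(LINT x:stair_set k|lebesgue. divergence T x) = - \<sigma> * (LINT s|lborel. ?f s)"
    unfolding stair_set_eq[OF k] integral_divergence_Int[OF T] by (rule g.gauss_green[OF T])
  also have "\<dots> \<le> \<bar>LINT s|lborel. ?f s\<bar>" using \<sigma> by auto
  also note *
  finally show "ennreal (LINT x:stair_set k|lebesgue. divergence T x) \<le> ennreal (1 + (sqrt 2 - 1) * (\<bar>b\<bar> + 1 / k))"
    by (rule ennreal_leI)
qed

lemma emeasure_strip:
  assumes \<delta>: "0 \<le> \<delta>"
  shows "emeasure lborel {x :: real^2. x $ j \<in> {0<..<1} \<and> \<bar>x $ i - line (x $ j)\<bar> \<le> \<delta>} = ennreal (2 * \<delta>)" (is "emeasure _ ?S = _")
proof -
  have [measurable]: "?S \<in> sets borel"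
  proof -
    have "closed {x :: real^2. \<bar>x $ i - line (x $ j)\<bar> \<le> \<delta>}" "open {x :: real^2. 0 < x $ j \<and> x $ j < 1}"
      unfolding line_def by (intro closed_Collect_le continuous_intros) (intro open_Collect_conj open_Collect_less continuous_intros)
    then have "{x :: real^2. 0 < x $ j \<and> x $ j < 1} \<inter> {x :: real^2. \<bar>x $ i - line (x $ j)\<bar> \<le> \<delta>} \<in> sets borel"
      by (intro sets.Int) auto
    then show ?thesis by (simp add: Int_def)
  qed
  have int: "integrable lborel (indicator ?S :: real^2 \<Rightarrow> real)"
  proof (rule integrable_bounded_compact_support)
    show "compact (cbox (\<chi> l. - \<delta> - 1) (\<chi> l. \<delta> + 1) :: (real^2) set)" by (rule compact_cbox)
    show "\<bar>indicat_real ?S x\<bar> \<le> 1" for x by (simp add: indicator_def)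
    show "indicat_real ?S x = 0" if "x \<notin> cbox (\<chi> l. - \<delta> - 1) (\<chi> l. \<delta> + 1)" for x
    proof (rule ccontr)
      assume "indicat_real ?S x \<noteq> 0"
      then have x: "0 < x $ j" "x $ j < 1" "\<bar>x $ i - line (x $ j)\<bar> \<le> \<delta>" by (auto simp: indicator_def split: if_splits)
      have "0 < line (x $ j) \<and> line (x $ j) < 1" by (rule line_in) (use x in auto)
      then have "\<forall>l. - \<delta> - 1 \<le> x $ l \<and> x $ l \<le> \<delta> + 1"
        unfolding forall_2_eq[OF ij] using x \<delta> by linarith
      then show False using that by (simp add: mem_box_cart)
    qed
  qed measurable
  have "measure lborel ?S = (LINT x|lborel. indicator ?S x)" by simp
  also have "\<dots> = (LINT s|lborel. LINT t|lborel. indicator ?S (pt i j t s))" by (rule integral_real2(1)[OF ij int])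
  also have "\<dots> = (LINT s|lborel. indicator {0<..<1::real} s * (2 * \<delta>))"
  proof (rule Bochner_Integration.integral_cong[OF refl])
    fix s
    have "(LINT t|lborel. indicat_real ?S (pt i j t s)) = (LINT t|lborel. indicator {0<..<1} s * indicator {line s - \<delta>..line s + \<delta>} t)"
      using ij by (intro Bochner_Integration.integral_cong) (auto simp: indicator_def pt_nth abs_le_iff)
    also have "\<dots> = indicator {0<..<1} s * (2 * \<delta>)" using \<delta> by simp
    finally show "(LINT t|lborel. indicat_real ?S (pt i j t s)) = indicator {0<..<1} s * (2 * \<delta>)" .
  qed
  also have "\<dots> = 2 * \<delta>" by simp
  finally have "measure lborel ?S = 2 * \<delta>" .
  moreover have "emeasure lborel ?S < \<infinity>" using int by (simp add: integrable_indicator_iff)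
  ultimately show ?thesis by (simp add: emeasure_eq_ennreal_measure less_top)
qed

text \<open>The symmetric difference lies in a strip of half width \<open>2 / k\<close> around the
  line. The value at \<open>k = 0\<close> is a placeholder, since the staircases are studied for
  \<open>k > 0\<close>.\<close>

lemma stair_set_tendsto: "L1_converges (\<lambda>k. if k = 0 then {} else stair_set k) half"
  unfolding L1_converges_def
proof (rule tendsto_sandwich[where f="\<lambda>_. 0" and h="\<lambda>k. ennreal (4 / real k)"])
  show "\<forall>\<^sub>F k in sequentially. emeasure lebesgue (sym_diff (if k = 0 then {} else stair_set k) half) \<le> ennreal (4 / real k)"
    using eventually_gt_at_top[of 0]
  proof eventually_elim
    case (elim k)
    let ?S = "{x :: real^2. x $ j \<in> {0<..<1} \<and> \<bar>x $ i - line (x $ j)\<bar> \<le> 2 / k}"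
    have sub: "sym_diff (stair_set k) half \<subseteq> ?S"
    proof
      fix x assume x: "x \<in> sym_diff (stair_set k) half"
      then have sq: "0 < x $ j" "x $ j < 1" by (auto simp: stair_set_def half_def unit_square_iff)
      have "\<bar>stair k (x $ j) - line (x $ j)\<bar> \<le> 2 / k" by (rule stair_near_line[OF elim sq])
      moreover have "0 < \<sigma> * (x $ i - stair k (x $ j)) \<longleftrightarrow> \<not> 0 < \<sigma> * (x $ i - line (x $ j))"
        using x by (auto simp: stair_set_def half_def)
      ultimately have "\<bar>x $ i - line (x $ j)\<bar> \<le> 2 / k" using \<sigma> by auto
      then show "x \<in> ?S" using sq by simp
    qed
    have e: "emeasure lborel ?S = ennreal (4 / k)" using emeasure_strip[of "2 / k"] by simp
    \<comment> \<open>A set outside the sigma-algebra has \<open>emeasure\<close> 0, so the positive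
      value just found already yields measurability.\<close>
    have S: "?S \<in> sets lborel"
    proof (rule ccontr)
      assume "?S \<notin> sets lborel"
      then have "emeasure lborel ?S = 0" by (rule emeasure_notin_sets)
      then show False using e elim by simp
    qed
    have "emeasure lebesgue (sym_diff (stair_set k) half) \<le> emeasure lebesgue ?S"
      using S by (intro emeasure_mono sub sets_completionI_sets)
    also have "\<dots> = emeasure lborel ?S"
    proof -
      have "emeasure lebesgue X = emeasure lborel X" if "X \<in> sets lborel" for X :: "(real^2) set"
        using that by simp
      then show ?thesis using S .
    qed
    also note e
    finally show ?case using elim by simp
  qed
  have "(\<lambda>k. 4 / real k) \<longlonglongrightarrow> 0" by (intro tendsto_divide_0[OF tendsto_const] filterlim_compose[OF filterlim_at_top_imp_at_infinity filterlim_real_sequentially] filterlim_ident)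
  then show "(\<lambda>k. ennreal (4 / real k)) \<longlonglongrightarrow> 0" using tendsto_ennrealI by fastforce
qed auto

text \<open>The liminf inequality is tested on the staircases, whose perimeter bound exceeds the
  claim only by \<open>(sqrt 2 - 1) / k\<close>.\<close>

lemma limit_density_le:
  assumes "limit_density double_diagonal \<phi>"
  shows "\<phi> conormal \<le> 1 + (sqrt 2 - 1) * \<bar>b\<bar>"
proof -
  define E where "E k = (if k = 0 then {} else stair_set k)" for k
  define F where "F k = triangulated_perimeter (periodic_triangulation double_diagonal k) (E k)" for k
  have \<phi>: "\<And>x. 0 \<le> \<phi> x" "\<And>t x. 0 \<le> t \<Longrightarrow> \<phi> (t *\<^sub>R x) = t * \<phi> x"
    and G: "gamma_converges unit_square (\<lambda>k. triangulated_perimeter (periodic_triangulation double_diagonal k))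
       (anisotropic_perimeter unit_square \<phi>)"
    using assms by (auto simp: limit_density_def)
  have "E k \<in> measurable_subsets unit_square" for k
  proof (cases "k = 0")
    case False
    then have "E k = stair_set k" by (simp add: E_def)
    moreover have "open (stair_set k)" using False by (intro open_triangulated[OF stair_set_triangulated]) simp
    ultimately show ?thesis by (auto simp: measurable_subsets_def stair_set_def)
  qed (simp add: E_def measurable_subsets_def)
  moreover have "L1_converges E half" unfolding E_def[abs_def] by (rule stair_set_tendsto)
  ultimately have "anisotropic_perimeter unit_square \<phi> half \<le> liminf F"
    using G half_measurable unfolding gamma_converges_def F_def[abs_def] by blast
  also have "liminf F \<le> liminf (\<lambda>k. ennreal (1 + (sqrt 2 - 1) * (\<bar>b\<bar> + 1 / real k)))"
  proof (rule Liminf_mono)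
    show "\<forall>\<^sub>F k in sequentially. F k \<le> ennreal (1 + (sqrt 2 - 1) * (\<bar>b\<bar> + 1 / real k))"
      using eventually_gt_at_top[of 0]
    proof eventually_elim
      case (elim k)
      then show ?case
        using stair_set_triangulated perimeter_stair_set by (simp add: F_def E_def triangulated_perimeter_def)
    qed
  qed
  also have "\<dots> = ennreal (1 + (sqrt 2 - 1) * \<bar>b\<bar>)"
  proof (rule lim_imp_Liminf)
    have "(\<lambda>k. 1 + (sqrt 2 - 1) * (\<bar>b\<bar> + 1 / real k)) \<longlonglongrightarrow> 1 + (sqrt 2 - 1) * (\<bar>b\<bar> + 0)"
      by (intro tendsto_intros lim_1_over_n)
    then show "(\<lambda>k. ennreal (1 + (sqrt 2 - 1) * (\<bar>b\<bar> + 1 / real k))) \<longlonglongrightarrow> ennreal (1 + (sqrt 2 - 1) * \<bar>b\<bar>)"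
      by (intro tendsto_ennrealI) simp
  qed simp
  finally have "anisotropic_perimeter unit_square \<phi> half \<le> ennreal (1 + (sqrt 2 - 1) * \<bar>b\<bar>)" .
  then have "ennreal (\<phi> conormal) \<le> ennreal (1 + (sqrt 2 - 1) * \<bar>b\<bar>)"
    using anisotropic_perimeter_half[OF \<phi>] by metis
  moreover have "0 \<le> (sqrt 2 - 1) * \<bar>b\<bar>" by (intro mult_nonneg_nonneg) auto
  ultimately show ?thesis by (subst (asm) ennreal_le_iff) auto
qed

end

section \<open>Lower bound: calibration\<close>

lemma sin_abs_le: "\<bar>sin x\<bar> \<le> \<bar>x :: real\<bar>"
proof (cases "0 \<le> x")
  case True
  then show ?thesis using sin_x_le_x[of x] sin_x_ge_neg_x[of x] by (simp add: abs_le_iff)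
next
  case False
  then show ?thesis using sin_x_le_x[of "- x"] sin_x_ge_neg_x[of "- x"] by (simp add: abs_le_iff)
qed

lemma sin_pi_int_shift: "\<bar>sin (pi * (a - of_int N))\<bar> = \<bar>sin (pi * a)\<bar>"
proof -
  have "pi * (a - of_int N) = pi * a - of_int N * pi" by (simp add: algebra_simps)
  moreover have "sin (of_int N * pi) = 0" "\<bar>cos (of_int N * pi)\<bar> = 1"
  proof -
    show s: "sin (of_int N * pi) = 0" by (simp add: sin_zero_iff_int2 exI[of _ N])
    have "(cos (of_int N * pi))\<^sup>2 = 1" using sin_cos_squared_add[of "of_int N * pi"] s by simp
    then have "cos (of_int N * pi) = 1 \<or> cos (of_int N * pi) = -1" by (simp add: power2_eq_1_iff)
    then show "\<bar>cos (of_int N * pi)\<bar> = 1" by (elim disjE) simp_all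
  qed
  ultimately show ?thesis by (simp add: sin_diff abs_mult)
qed

text \<open>An integer \<open>N\<close> between \<open>a\<close> and \<open>b\<close> would make the
  sine at \<open>pi * a\<close> at most \<open>pi\<close> times the distance from \<open>a\<close>
  to \<open>N\<close>, hence smaller than \<open>e\<close>.\<close>

lemma same_floor_of_near:
  fixes a b :: real
  assumes a: "e \<le> \<bar>sin (pi * a)\<bar>" and ab: "pi * \<bar>a - b\<bar> < e"
  shows "\<lfloor>a\<rfloor> = \<lfloor>b\<rfloor>" "b \<notin> \<int>" "a \<notin> \<int>"
proof -
  have no: "\<not> (min a b \<le> of_int N \<and> of_int N \<le> max a b)" for N :: int
  proof
    assume N: "min a b \<le> of_int N \<and> of_int N \<le> max a b"
    have "\<bar>sin (pi * a)\<bar> = \<bar>sin (pi * (a - of_int N))\<bar>" by (simp add: sin_pi_int_shift)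
    also have "\<dots> \<le> \<bar>pi * (a - of_int N)\<bar>" by (rule sin_abs_le)
    also have "\<dots> = pi * \<bar>a - of_int N\<bar>" by (simp add: abs_mult)
    also have "\<dots> \<le> pi * \<bar>a - b\<bar>" using N by (intro mult_left_mono) (auto simp: min_def max_def split: if_splits)
    finally show False using a ab by linarith
  qed
  show "\<lfloor>a\<rfloor> = \<lfloor>b\<rfloor>"
  proof (rule ccontr)
    assume "\<lfloor>a\<rfloor> \<noteq> \<lfloor>b\<rfloor>"
    then have "min a b \<le> of_int (max \<lfloor>a\<rfloor> \<lfloor>b\<rfloor>) \<and> of_int (max \<lfloor>a\<rfloor> \<lfloor>b\<rfloor>) \<le> max a b" by linarith
    then show False using no by blast
  qed
  show "b \<notin> \<int>"
  proof
    assume "b \<in> \<int>"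
    then obtain z where "b = of_int z" by (elim Ints_cases)
    then show False using no[of z] by (simp add: min_le_iff_disj le_max_iff_disj)
  qed
  show "a \<notin> \<int>"
  proof
    assume "a \<in> \<int>"
    then obtain z where "a = of_int z" by (elim Ints_cases)
    then show False using no[of z] by (simp add: min_le_iff_disj le_max_iff_disj)
  qed
qed

lemma AE_off_lines:
  fixes m :: "real^2"
  assumes k: "k > (0::nat)" and m: "m \<noteq> 0"
  shows "AE y in lborel. k * (m \<bullet> y) \<notin> \<int>"
proof -
  have "{y. m \<bullet> y = of_int N / k} \<in> null_sets lebesgue" for N :: int
    using m negligible_hyperplane[of m "of_int N / k"] by (simp add: negligible_iff_null_sets)
  then have "(\<Union>N::int. {y. m \<bullet> y = of_int N / k}) \<in> null_sets lebesgue"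
    by (rule null_sets_UN)
  then have "AE y in lebesgue. y \<notin> (\<Union>N::int. {y. m \<bullet> y = of_int N / k})"
    by (rule AE_not_in)
  then have "AE y in lebesgue. k * (m \<bullet> y) \<notin> \<int>"
    by eventually_elim (use k in \<open>auto elim!: Ints_cases simp: field_simps\<close>)
  then show ?thesis by (simp add: AE_completion_iff)
qed

lemma set_integral_lebesgue_lborel:
  fixes f :: "'a::euclidean_space \<Rightarrow> real"
  assumes "open E" "f \<in> borel_measurable borel"
  shows "(LINT x:E|lebesgue. f x) = (LINT x|lborel. indicator E x * f x)"
proof -
  have [measurable]: "E \<in> sets borel" using assms(1) by simp
  note [measurable] = assms(2)
  have "(LINT x|lebesgue. indicator E x * f x) = (LINT x|lborel. indicator E x * f x)"
    by (rule integral_completion) measurable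
  then show ?thesis by (simp add: set_lebesgue_integral_def)
qed

lemma scalar_test_bounds:
  fixes f :: "'a::euclidean_space \<Rightarrow> real"
  assumes f: "scalar_test \<Omega> f f'"
  obtains C R where "0 \<le> C" "0 < R" "\<And>x. norm (f' x) \<le> C" "\<And>x. R < norm x \<Longrightarrow> f x = 0 \<and> f' x = 0"
proof -
  obtain K where K: "compact K" "\<And>x. x \<notin> K \<Longrightarrow> f x = 0 \<and> f' x = 0"
    using scalar_test_support[OF f] by blast
  obtain R where R: "R > 0" "\<And>x. x \<in> K \<Longrightarrow> norm x \<le> R"
    using compact_imp_bounded[OF K(1)] bounded_pos[of K] by auto
  have "compact (f' ` K)" by (intro compact_continuous_image scalar_test_cont[OF f] K)
  then obtain C where C: "C > 0" "\<And>x. x \<in> K \<Longrightarrow> norm (f' x) \<le> C"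
    using compact_imp_bounded[of "f' ` K"] bounded_pos[of "f' ` K"] by auto
  have "norm (f' x) \<le> C" for x using C K(2)[of x] by (cases "x \<in> K") auto
  moreover have "f x = 0 \<and> f' x = 0" if "R < norm x" for x using R(2)[of x] that by (intro K(2)) auto
  ultimately show ?thesis using that[of C R] C(1) R(1) by simp
qed

lemma difference_quotient_bound:
  fixes f :: "'a::euclidean_space \<Rightarrow> real"
  assumes f: "\<And>x. (f has_derivative (\<lambda>h. f' x \<bullet> h)) (at x)" and C: "\<And>x. norm (f' x) \<le> C" and t: "t > 0"
  shows "\<bar>(f (x + t *\<^sub>R v) - f x) / t\<bar> \<le> C * norm v"
proof -
  have d: "((\<lambda>s. f (x + s *\<^sub>R v)) has_real_derivative f' (x + s *\<^sub>R v) \<bullet> v) (at s)" for s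
  proof -
    have "((\<lambda>s. x + s *\<^sub>R v) has_derivative (\<lambda>h. h *\<^sub>R v)) (at s)" by (auto intro!: derivative_eq_intros)
    from has_derivative_compose[OF this f]
    show ?thesis unfolding has_field_derivative_def by (rule has_derivative_eq_rhs) (simp add: fun_eq_iff)
  qed
  obtain z where "f (x + t *\<^sub>R v) - f (x + 0 *\<^sub>R v) = (t - 0) * (f' (x + z *\<^sub>R v) \<bullet> v)"
    using MVT2[of 0 t "\<lambda>s. f (x + s *\<^sub>R v)" "\<lambda>s. f' (x + s *\<^sub>R v) \<bullet> v"] t d by blast
  then have "(f (x + t *\<^sub>R v) - f x) / t = f' (x + z *\<^sub>R v) \<bullet> v" using t by simp
  also have "\<bar>\<dots>\<bar> \<le> norm (f' (x + z *\<^sub>R v)) * norm v" by (rule Cauchy_Schwarz_ineq2)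
  also have "\<dots> \<le> C * norm v" using C by (intro mult_right_mono) auto
  finally show ?thesis .
qed

text \<open>Near the support of \<open>f\<close> the set \<open>E\<close> is invariant under small translations along \<open>v\<close>.\<close>

lemma tangential_integral_zero:
  assumes k: "k > 0" and E: "E \<in> triangulated_sets (periodic_triangulation double_diagonal k)"
    and f: "scalar_test \<Omega> f f'" and n: "n < 4" and v: "edge_normal n \<bullet> v = 0"
    and e: "e > 0" and vanish: "\<And>x l. l < 4 \<Longrightarrow> l \<noteq> n \<Longrightarrow> \<bar>sin (pi * (k * (edge_normal l \<bullet> x)))\<bar> < e \<Longrightarrow> f x = 0"
  shows "(LINT x|lborel. indicator E x * (f' x \<bullet> v)) = 0"
proof -
  have openE: "open E" by (rule open_triangulated[OF E])
  then have [measurable]: "E \<in> sets borel" by simp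
  obtain C R where C0: "0 \<le> C" and R0: "0 < R" and C1: "\<And>x. norm (f' x) \<le> C"
    and R1: "\<And>x. R < norm x \<Longrightarrow> f x = 0 \<and> f' x = 0"
    by (rule scalar_test_bounds[OF f]) (rule that)
  note C = C0 C1 and R = R0 R1
  have [measurable]: "f \<in> borel_measurable borel" "f' \<in> borel_measurable borel"
    by (intro borel_measurable_continuous_onI scalar_test_cont[OF f] scalar_test_cont0[OF f])+
  define M where "M = (\<Sum>l<4. pi * (k * \<bar>edge_normal l \<bullet> v\<bar>))"
  have M0: "0 \<le> M" unfolding M_def by (intro sum_nonneg) auto
  have M: "pi * (k * \<bar>edge_normal l \<bullet> v\<bar>) \<le> M" if "l < 4" for l
    unfolding M_def using that by (intro member_le_sum[where f="\<lambda>l. pi * (k * \<bar>edge_normal l \<bullet> v\<bar>)"]) auto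
  \<comment> \<open>\<open>M\<close> bounds the change of each phase per unit step along
    \<open>v\<close>, so a step of size \<open>t j\<close> changes all of them by less than
    \<open>e\<close>.\<close>
  define t where "t j = min 1 (e / (M + 1)) / real (Suc j)" for j
  have t: "0 < t j" "t j \<le> 1" "t j * M < e" for j
  proof -
    have p: "0 < min 1 (e / (M + 1))" using e M0 by auto
    show "0 < t j" unfolding t_def using p by simp
    have le: "t j \<le> min 1 (e / (M + 1))"
      unfolding t_def using divide_left_mono[of 1 "real (Suc j)" "min 1 (e / (M + 1))"] p by simp
    then show "t j \<le> 1" by simp
    have "t j * (M + 1) \<le> e / (M + 1) * (M + 1)" using le M0 by (intro mult_right_mono) auto
    also have "\<dots> = e" using M0 by simp
    finally have "t j * M + t j \<le> e" by (simp add: distrib_left)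
    then show "t j * M < e" using \<open>0 < t j\<close> by linarith
  qed
  \<comment> \<open>On the support of \<open>f\<close> the set \<open>E\<close> and its translate
    agree up to a null set, so translating \<open>f\<close> does not change its integral over
    \<open>E\<close>.\<close>
  have shift: "(LINT x|lborel. indicator E x * f (x + t j *\<^sub>R v)) = (LINT x|lborel. indicator E x * f x)" for j
  proof -
    let ?c = "t j *\<^sub>R v"
    have "(LINT x|lborel. indicator E x * f (x + ?c)) = (LINT x|distr lborel borel ((+) (- ?c)). indicator E x * f (x + ?c))"
      by (simp add: lborel_distr_plus)
    also have "\<dots> = (LINT y|lborel. indicator E (- ?c + y) * f (- ?c + y + ?c))"
      by (rule integral_distr) measurable
    also have "\<dots> = (LINT y|lborel. indicator E y * f y)"
    proof (rule integral_cong_AE)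
      show "AE y in lborel. indicator E (- ?c + y) * f (- ?c + y + ?c) = indicator E y * f y"
        using AE_off_lines[OF k edge_normal_nonzero[of n]]
      proof eventually_elim
        case (elim y)
        let ?y = "- ?c + y"
        show ?case
        proof (cases "f y = 0")
          case False
          have far: "e \<le> \<bar>sin (pi * (k * (edge_normal l \<bullet> y)))\<bar>" if "l < 4" "l \<noteq> n" for l
          proof (rule ccontr)
            assume "\<not> ?thesis"
            then have "f y = 0" by (intro vanish[OF that]) simp
            with False show False by simp
          qed
          have near: "pi * \<bar>k * (edge_normal l \<bullet> y) - k * (edge_normal l \<bullet> ?y)\<bar> < e" if "l < 4" for l
          proof -
            have "pi * \<bar>k * (edge_normal l \<bullet> y) - k * (edge_normal l \<bullet> ?y)\<bar> = t j * (pi * (k * \<bar>edge_normal l \<bullet> v\<bar>))"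
            proof -
              have "k * (edge_normal l \<bullet> y) - k * (edge_normal l \<bullet> ?y) = t j * (k * (edge_normal l \<bullet> v))"
                unfolding inner_add_right inner_minus_right inner_scaleR_right by (simp add: algebra_simps)
              then show ?thesis using t(1)[of j] by (simp add: abs_mult)
            qed
            also have "\<dots> \<le> t j * M" using M[OF that] t(1)[of j] by (intro mult_left_mono) auto
            also have "\<dots> < e" by (rule t(3))
            finally show ?thesis .
          qed
          \<comment> \<open>The \<open>n\<close>-th form may be close to an integer, but it is
            constant along \<open>v\<close>; the others are kept away from the integers by
            \<open>vanish\<close>.\<close>
          have eqn: "edge_normal n \<bullet> ?y = edge_normal n \<bullet> y" using v by (simp add: inner_add_right inner_diff_right)
          have fl: "\<lfloor>k * (edge_normal l \<bullet> y)\<rfloor> = \<lfloor>k * (edge_normal l \<bullet> ?y)\<rfloor>" if "l < 4" for l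
          proof (cases "l = n")
            case False
            show ?thesis by (rule same_floor_of_near(1)[OF far[OF that False] near[OF that]])
          qed (simp only: eqn)
          have off: "k * (edge_normal l \<bullet> y) \<notin> \<int>" "k * (edge_normal l \<bullet> ?y) \<notin> \<int>" if "l < 4" for l
          proof -
            have "k * (edge_normal l \<bullet> y) \<notin> \<int> \<and> k * (edge_normal l \<bullet> ?y) \<notin> \<int>"
            proof (cases "l = n")
              case False
              from same_floor_of_near(2,3)[OF far[OF that False] near[OF that]] show ?thesis by blast
            qed (simp only: eqn elim not_False_eq_True simp_thms)
            then show "k * (edge_normal l \<bullet> y) \<notin> \<int>" "k * (edge_normal l \<bullet> ?y) \<notin> \<int>" by blast+
          qed
          have "y \<in> E \<longleftrightarrow> ?y \<in> E"
          proof
            show "?y \<in> E" if "y \<in> E" by (rule triangulated_same_floor[OF k E off(1) off(2) fl that])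
            show "y \<in> E" if "?y \<in> E" by (rule triangulated_same_floor[OF k E off(2) off(1) fl[symmetric] that])
          qed
          then show ?thesis by (simp add: indicator_def)
        qed simp
      qed
    qed measurable
    finally show ?thesis .
  qed
  have int: "integrable lborel (\<lambda>x. indicator E x * f (x + c))" for c
  proof -
    obtain B where B: "\<And>x. \<bar>f x\<bar> \<le> B"
    proof -
      have "compact (f ` cball 0 R)" by (intro compact_continuous_image scalar_test_cont0[OF f] compact_cball)
      then obtain B where B: "B > 0" "\<And>x. x \<in> cball 0 R \<Longrightarrow> \<bar>f x\<bar> \<le> B"
        using compact_imp_bounded[of "f ` cball 0 R"] bounded_pos[of "f ` cball 0 R"] by auto
      have "\<bar>f x\<bar> \<le> B" for x using B R(2)[of x] by (cases "norm x \<le> R") auto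
      then show ?thesis by (rule that)
    qed
    show ?thesis
    proof (rule integrable_bounded_compact_support)
      show "compact (cball (- c) R)" by (rule compact_cball)
      show "\<bar>indicator E x * f (x + c)\<bar> \<le> B" for x
        using B[of "x + c"] order_trans[OF abs_ge_zero B] by (simp add: indicator_def)
      show "indicator E x * f (x + c) = 0" if "x \<notin> cball (- c) R" for x
      proof -
        have "R < norm (x + c)" using that by (simp add: dist_norm norm_minus_commute[of "- c"] add.commute)
        then show ?thesis using R(2) by simp
      qed
    qed measurable
  qed
  have zero: "(LINT x|lborel. indicator E x * ((f (x + t j *\<^sub>R v) - f x) / t j)) = 0" for j
  proof -
    have "(LINT x|lborel. indicator E x * ((f (x + t j *\<^sub>R v) - f x) / t j)) =
        (LINT x|lborel. (indicator E x * f (x + t j *\<^sub>R v) - indicator E x * f (x + 0)) / t j)"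
      by (intro Bochner_Integration.integral_cong) (auto simp: algebra_simps diff_divide_distrib)
    also have "\<dots> = ((LINT x|lborel. indicator E x * f (x + t j *\<^sub>R v)) - (LINT x|lborel. indicator E x * f (x + 0))) / t j"
      unfolding integral_divide_zero by (subst Bochner_Integration.integral_diff[OF int int]) simp
    also have "\<dots> = 0" unfolding shift by simp
    finally show ?thesis .
  qed
  have tlim: "t \<longlonglongrightarrow> 0"
    unfolding t_def by (rule LIMSEQ_Suc[OF lim_const_over_n])
  \<comment> \<open>The difference quotients all have integral 0 over \<open>E\<close>; dominated
    convergence passes this on to the derivative.\<close>
  have "(\<lambda>j. LINT x|lborel. indicator E x * ((f (x + t j *\<^sub>R v) - f x) / t j)) \<longlonglongrightarrow> (LINT x|lborel. indicator E x * (f' x \<bullet> v))"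
  proof (rule integral_dominated_convergence[where w="\<lambda>x. C * norm v * indicator (cball 0 (R + norm v)) x"])
    show "integrable lborel (\<lambda>x :: real^2. C * norm v * indicator (cball 0 (R + norm v)) x)"
    proof (rule integrable_bounded_compact_support)
      show "compact (cball (0 :: real^2) (R + norm v))" by (rule compact_cball)
      show "\<bar>C * norm v * indicator (cball 0 (R + norm v)) x\<bar> \<le> C * norm v" for x :: "real^2"
        using C(1) by (simp add: indicator_def)
    qed (simp_all add: indicator_def)
    show "AE x in lborel. (\<lambda>j. indicator E x * ((f (x + t j *\<^sub>R v) - f x) / t j)) \<longlonglongrightarrow> indicator E x * (f' x \<bullet> v)"
    proof (intro AE_I2 tendsto_mult_left)
      fix x
      have "((\<lambda>s. x + s *\<^sub>R v) has_derivative (\<lambda>h. h *\<^sub>R v)) (at 0)" by (auto intro!: derivative_eq_intros)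
      from has_derivative_compose[OF this scalar_test_deriv[OF f]]
      have "((\<lambda>s. f (x + s *\<^sub>R v)) has_real_derivative f' x \<bullet> v) (at 0)"
        unfolding has_field_derivative_def by (rule has_derivative_eq_rhs) (simp add: fun_eq_iff)
      then have "((\<lambda>h. (f (x + h *\<^sub>R v) - f x) / h) \<longlongrightarrow> f' x \<bullet> v) (at 0)"
        unfolding DERIV_def by simp
      moreover have "filterlim t (at 0) sequentially"
      proof -
        have "t j \<noteq> 0" for j using t(1)[of j] by simp
        then show ?thesis using tlim by (simp add: filterlim_at)
      qed
      ultimately show "(\<lambda>j. (f (x + t j *\<^sub>R v) - f x) / t j) \<longlonglongrightarrow> f' x \<bullet> v"
        by (rule filterlim_compose)
    qed
    show "AE x in lborel. norm (indicator E x * ((f (x + t j *\<^sub>R v) - f x) / t j)) \<le> C * norm v * indicator (cball 0 (R + norm v)) x" for j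
    proof (rule AE_I2)
      fix x
      show "norm (indicator E x * ((f (x + t j *\<^sub>R v) - f x) / t j)) \<le> C * norm v * indicator (cball 0 (R + norm v)) x"
      proof (cases "norm x \<le> R + norm v")
        case True
        then show ?thesis
          using difference_quotient_bound[OF scalar_test_deriv[OF f] C(2) t(1)[of j], where x=x and v=v] C(1) by (simp add: indicator_def)
      next
        case False
        have "norm (t j *\<^sub>R v) \<le> norm v" using t[of j] by (simp add: mult_left_le_one_le)
        then have "R < norm (x + t j *\<^sub>R v)" using False norm_triangle_ineq4[of "x + t j *\<^sub>R v" "t j *\<^sub>R v"] by simp
        moreover have "R < norm x" using False norm_ge_zero[of v] by linarith
        ultimately show ?thesis using R(2) False by simp
      qed
    qed
  qed measurable
  then show ?thesis unfolding zero by (simp add: LIMSEQ_const_iff)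
qed

lemma sum_less_4: "(\<Sum>n<4. f n) = f 0 + f 1 + f 2 + f (3::nat)"
  by (simp add: eval_nat_numeral)

text \<open>A weak Jordan inequality, from the double angle formula with cosines at least
  \<open>sqrt 2 / 2\<close> up to \<open>pi / 4\<close>.\<close>

lemma sin_ge_half:
  fixes z :: real
  assumes z: "0 \<le> z" "z \<le> pi / 2" shows "z / 2 \<le> sin z"
proof (cases "z = 0")
  case False
  then have z0: "0 < z" using z by simp
  obtain \<xi> where \<xi>: "0 < \<xi>" "\<xi> < z / 2" "sin (z / 2) - sin 0 = (z / 2 - 0) * cos \<xi>"
    using MVT2[of 0 "z / 2" sin cos] z0 DERIV_sin by auto
  have c: "sqrt 2 / 2 \<le> cos y" if "0 \<le> y" "y \<le> pi / 4" for y
    using that cos_monotone_0_pi_le[of y "pi / 4"] by (simp add: cos_45)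
  have s: "z / 2 * (sqrt 2 / 2) \<le> sin (z / 2)"
    using \<xi> c[of \<xi>] z z0 by (simp only: sin_zero diff_zero) (intro mult_left_mono, auto)
  have h1: "z / 2 * (sqrt 2 / 2) * (sqrt 2 / 2) \<le> sin (z / 2) * cos (z / 2)"
  proof (rule mult_mono[OF s])
    show "sqrt 2 / 2 \<le> cos (z / 2)" using z z0 by (intro c) auto
    show "0 \<le> sin (z / 2)" using z z0 by (intro sin_ge_zero) auto
  qed simp
  have h2: "z / 2 * (sqrt 2 / 2) * (sqrt 2 / 2) = z / 4" by (simp add: field_simps)
  have "z / 4 \<le> sin (z / 2) * cos (z / 2)" using h1 unfolding h2 .
  moreover have "sin z = 2 * (sin (z / 2) * cos (z / 2))" using sin_double[of "z / 2"] by simp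
  ultimately show ?thesis by linarith
qed simp

text \<open>The converse of \<open>sin_abs_le\<close> at the nearest integer:
  \<open>sin_ge_half\<close> gives the factor \<open>pi / 2\<close>, which is at least 1.\<close>

lemma near_int_of_sin_small:
  fixes a :: real
  shows "\<exists>N::int. \<bar>a - N\<bar> \<le> \<bar>sin (pi * a)\<bar> \<and> N = round a"
proof -
  have r: "\<bar>a - round a\<bar> \<le> 1/2" using of_int_round_abs_le[of a] by (simp add: abs_minus_commute)
  let ?z = "pi * \<bar>a - round a\<bar>"
  have "?z \<le> pi * (1/2)" using r by (intro mult_left_mono) auto
  then have "?z / 2 \<le> sin ?z" by (intro sin_ge_half) auto
  also have "\<dots> \<le> \<bar>sin (pi * (a - round a))\<bar>"
  proof (cases "0 \<le> a - round a")
    case False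
    then have "\<bar>a - round a\<bar> = - (a - round a)" by simp
    then show ?thesis unfolding mult_minus_right by (simp only: sin_minus mult_minus_right abs_ge_minus_self)
  qed simp
  also have "\<dots> = \<bar>sin (pi * a)\<bar>" by (rule sin_pi_int_shift)
  finally have *: "?z / 2 \<le> \<bar>sin (pi * a)\<bar>" .
  have half: "u \<le> v / 2" if "2 * u \<le> v" for u v :: real using that by simp
  have "2 * \<bar>a - round a\<bar> \<le> pi * \<bar>a - round a\<bar>" using pi_ge_two by (intro mult_right_mono) auto
  from order_trans[OF half[OF this] *] have "\<bar>a - round a\<bar> \<le> \<bar>sin (pi * a)\<bar>" .
  then show ?thesis by blast
qed

text \<open>The absolute sine is subadditive, so closeness to the integers passes to sums and
  differences of phases.\<close>

lemma sin_add_abs_le: "\<bar>sin (a + b)\<bar> \<le> \<bar>sin a\<bar> + \<bar>sin (b::real)\<bar>"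
proof -
  have "\<bar>sin a * cos b\<bar> \<le> \<bar>sin a\<bar> * 1" "\<bar>cos a * sin b\<bar> \<le> 1 * \<bar>sin b\<bar>"
    unfolding abs_mult by (intro mult_left_mono mult_right_mono; simp)+
  then show ?thesis unfolding sin_add by linarith
qed

lemma sin_diff_abs_le: "\<bar>sin (a - b)\<bar> \<le> \<bar>sin a\<bar> + \<bar>sin (b::real)\<bar>"
  using sin_add_abs_le[of a "- b"] by simp

lemma sin_double_abs_le: "\<bar>sin (2 * a)\<bar> \<le> 2 * \<bar>sin (a::real)\<bar>"
  using sin_add_abs_le[of a a] by (simp flip: mult_2)

section \<open>Area of the neighbourhoods of the mesh vertices\<close>

text \<open>Mesh vertices have coordinates that are multiples of \<open>1 / (2 k)\<close>; the
  factor 2 is due to the centres of the small squares.\<close>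

definition lattice_nbhd :: "nat \<Rightarrow> real \<Rightarrow> real set" where
  "lattice_nbhd k \<delta> = (\<Union>N\<in>{..2 * k}. {(real N - \<delta>) / (2 * k)..(real N + \<delta>) / (2 * k)})"

lemma mem_lattice_nbhd:
  assumes k: "k > 0" and t: "0 < t" "t < 1" and s: "\<bar>sin (pi * (2 * k * t))\<bar> \<le> \<delta>"
  shows "t \<in> lattice_nbhd k \<delta>"
proof -
  obtain N :: int where N: "\<bar>2 * k * t - N\<bar> \<le> \<delta>" "N = round (2 * k * t)"
    using near_int_of_sin_small[of "2 * k * t"] s by force
  have kt: "0 < 2 * k * t" "2 * k * t < 2 * k" using k t by auto
  have "0 \<le> round (2 * k * t)" using round_mono[of 0 "2 * k * t"] kt by simp
  moreover have "round (2 * k * t) \<le> 2 * int k"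
  proof -
    have "round (2 * k * t) \<le> round (of_int (2 * int k) :: real)" by (rule round_mono) (use kt in simp)
    then show ?thesis by (simp only: round_of_int)
  qed
  ultimately obtain M where M: "N = int M" "M \<le> 2 * k" using N(2) by (metis nonneg_int_cases of_nat_mult of_nat_le_iff of_nat_numeral)
  have "(real M - \<delta>) / (2 * k) \<le> t" "t \<le> (real M + \<delta>) / (2 * k)"
    using N(1) M k by (simp_all add: field_simps abs_le_iff)
  then show ?thesis unfolding lattice_nbhd_def using M(2) by auto
qed

text \<open>There are \<open>2 k + 1\<close> intervals of length \<open>\<delta> / k\<close>, so the
  bound does not depend on \<open>k\<close>.\<close>

lemma lattice_nbhd_measure:
  assumes k: "k > 0" and \<delta>: "0 \<le> \<delta>"
  shows "lattice_nbhd k \<delta> \<in> sets borel" "emeasure lborel (lattice_nbhd k \<delta>) \<le> ennreal (3 * \<delta>)"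
proof -
  show "lattice_nbhd k \<delta> \<in> sets borel" unfolding lattice_nbhd_def by auto
  have len: "(real N + \<delta>) / (2 * k) - (real N - \<delta>) / (2 * k) = \<delta> / k" for N
    using k by (simp add: field_simps)
  have "emeasure lborel (lattice_nbhd k \<delta>) \<le> (\<Sum>N\<in>{..2 * k}. emeasure lborel {(real N - \<delta>) / (2 * k)..(real N + \<delta>) / (2 * k)})"
    unfolding lattice_nbhd_def by (intro emeasure_subadditive_finite) auto
  also have "\<dots> = (\<Sum>N\<in>{..2 * k}. ennreal (\<delta> / k))"
  proof (rule sum.cong[OF refl])
    fix N
    have "(real N - \<delta>) / (2 * k) \<le> (real N + \<delta>) / (2 * k)" using \<delta> by (intro divide_right_mono) auto
    then show "emeasure lborel {(real N - \<delta>) / (2 * k)..(real N + \<delta>) / (2 * k)} = ennreal (\<delta> / k)"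
      by (simp only: emeasure_lborel_Icc len)
  qed
  also have "\<dots> = of_nat (2 * k + 1) * ennreal (\<delta> / k)" by simp
  also have "\<dots> = ennreal (real (2 * k + 1)) * ennreal (\<delta> / k)"
    by (simp only: ennreal_of_nat_eq_real_of_nat)
  also have "\<dots> = ennreal (real (2 * k + 1) * (\<delta> / k))"
    using \<delta> by (intro ennreal_mult[symmetric]) auto
  also have "\<dots> \<le> ennreal (3 * \<delta>)"
  proof (rule ennreal_leI)
    have "\<delta> * 1 \<le> \<delta> * real k" using k \<delta> by (intro mult_left_mono) auto
    then show "real (2 * k + 1) * (\<delta> / k) \<le> 3 * \<delta>" using k by (simp add: field_simps)
  qed
  finally show "emeasure lborel (lattice_nbhd k \<delta>) \<le> ennreal (3 * \<delta>)" .
qed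

text \<open>The order \<open>\<delta>^2\<close> is what beats the gradients of the cutoff functions,
  of order \<open>1 / \<delta>\<close> at fixed \<open>k\<close>.\<close>

lemma emeasure_square_nbhd:
  assumes k: "k > 0" and \<delta>: "0 \<le> \<delta>"
  shows "{x :: real^2. x $ 1 \<in> lattice_nbhd k \<delta> \<and> x $ 2 \<in> lattice_nbhd k \<delta>} \<in> sets borel"
    "emeasure lborel {x :: real^2. x $ 1 \<in> lattice_nbhd k \<delta> \<and> x $ 2 \<in> lattice_nbhd k \<delta>} \<le> ennreal (9 * \<delta>\<^sup>2)"
proof -
  let ?W = "lattice_nbhd k \<delta>"
  let ?S = "{x :: real^2. x $ 1 \<in> ?W \<and> x $ 2 \<in> ?W}"
  note W [measurable] = lattice_nbhd_measure(1)[OF assms]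
  have [measurable]: "(\<lambda>x :: real^2. x $ l) \<in> borel_measurable borel" for l
    by (intro borel_measurable_continuous_onI continuous_intros)
  have "{x \<in> space borel. (x :: real^2) $ 1 \<in> ?W \<and> x $ 2 \<in> ?W} \<in> sets borel" by measurable
  then show S: "?S \<in> sets borel" by simp
  have ne: "(1 :: 2) \<noteq> 2" by simp
  have "emeasure lborel ?S = emeasure (distr lborel borel (\<lambda>(t, s). pt 1 2 t s)) ?S"
    using lborel_real2[OF ne] by simp
  also have "\<dots> = emeasure lborel ((\<lambda>(t, s). pt 1 2 t s) -` ?S \<inter> space lborel)"
    using S borel_measurable_pt2[of "1::2" 2] by (intro emeasure_distr) (simp_all add: case_prod_unfold)
  also have "(\<lambda>(t, s). pt 1 2 t s) -` ?S \<inter> space lborel = ?W \<times> ?W"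
    by (auto simp: pt_nth)
  also have "emeasure lborel (?W \<times> ?W) = emeasure lborel ?W * emeasure lborel ?W"
    unfolding lborel_prod[symmetric] using W by (intro lborel.emeasure_pair_measure_Times) auto
  also have "\<dots> \<le> ennreal (3 * \<delta>) * ennreal (3 * \<delta>)"
    using lattice_nbhd_measure(2)[OF assms] by (intro mult_mono) auto
  also have "\<dots> = ennreal (9 * \<delta>\<^sup>2)" using \<delta> by (simp add: power2_eq_square flip: ennreal_mult)
  finally show "emeasure lborel ?S \<le> ennreal (9 * \<delta>\<^sup>2)" .
qed

text \<open>Cutoff functions \<open>\<beta> l\<close> vanishing near the lines normal to the \<open>l\<close>-th edge direction. The index is
  read modulo 4, so that \<open>n + 1\<close>, \<open>n + 2\<close>, \<open>n + 3\<close> are the directions different from \<open>n\<close>.\<close>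

locale line_cutoffs =
  fixes k :: nat and \<epsilon> :: real
  assumes k: "k > 0" and \<epsilon>: "\<epsilon> > 0"
begin

definition nrm :: "nat \<Rightarrow> real^2" where "nrm l = edge_normal (l mod 4)"

definition phase :: "nat \<Rightarrow> real^2 \<Rightarrow> real" where "phase l x = pi * (k * (nrm l \<bullet> x))"

text \<open>Squaring keeps the argument of \<open>cutoff\<close> differentiable on the lines
  themselves, where the sine changes sign.\<close>

definition \<beta> :: "nat \<Rightarrow> real^2 \<Rightarrow> real" where "\<beta> l x = cutoff ((sin (phase l x))\<^sup>2 / \<epsilon>\<^sup>2)"

definition B :: "nat \<Rightarrow> real^2 \<Rightarrow> real" where
  "B l x = cutoff' ((sin (phase l x))\<^sup>2 / \<epsilon>\<^sup>2) * (2 * sin (phase l x) * cos (phase l x) / \<epsilon>\<^sup>2) * (pi * k)"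

lemma \<beta>_deriv: "(\<beta> l has_derivative (\<lambda>h. B l x * (nrm l \<bullet> h))) (at x)"
proof -
  have p: "(phase l has_derivative (\<lambda>h. pi * (k * (nrm l \<bullet> h)))) (at x)"
    unfolding phase_def by (auto intro!: derivative_eq_intros)
  have "((\<lambda>s. (sin s)\<^sup>2) has_real_derivative 2 * sin s * cos s) (at s)" for s :: real
    by (auto intro!: derivative_eq_intros)
  from DERIV_chain2[OF cutoff_deriv DERIV_cdivide[OF this]]
  have "((\<lambda>s. cutoff ((sin s)\<^sup>2 / \<epsilon>\<^sup>2)) has_derivative
      (\<lambda>h. cutoff' ((sin s)\<^sup>2 / \<epsilon>\<^sup>2) * (2 * sin s * cos s / \<epsilon>\<^sup>2) * h)) (at s)" for s
    unfolding has_field_derivative_def .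
  from has_derivative_compose[OF p this]
  show ?thesis unfolding \<beta>_def[abs_def] B_def by (simp add: mult.assoc)
qed

lemma B_cont: "continuous_on UNIV (B l)"
  unfolding B_def phase_def using \<epsilon> by (intro continuous_intros) auto

lemma \<beta>_cont: "continuous_on UNIV (\<beta> l)"
  by (rule has_derivative_continuous_on) (use \<beta>_deriv has_derivative_at_withinI in blast)

lemma \<beta>_range: "0 \<le> \<beta> l x" "\<beta> l x \<le> 1"
  unfolding \<beta>_def by (rule cutoff_range)+

lemma far_from_line:
  assumes "\<epsilon> \<le> \<bar>sin (phase l x)\<bar>" shows "\<beta> l x = 1" "B l x = 0"
proof -
  have "\<epsilon>\<^sup>2 \<le> (sin (phase l x))\<^sup>2" using assms \<epsilon> by (simp add: abs_le_square_iff[symmetric])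
  then have "1 \<le> (sin (phase l x))\<^sup>2 / \<epsilon>\<^sup>2" using \<epsilon> by simp
  then show "\<beta> l x = 1" "B l x = 0" by (simp_all add: \<beta>_def B_def cutoff_eq_1 cutoff'_eq_0)
qed

lemma near_line:
  assumes "\<bar>sin (phase l x)\<bar> < \<epsilon> / 2" shows "\<beta> l x = 0"
proof -
  have "\<bar>sin (phase l x)\<bar>\<^sup>2 \<le> (\<epsilon> / 2)\<^sup>2" using assms by (intro power_mono) auto
  then have "(sin (phase l x))\<^sup>2 / \<epsilon>\<^sup>2 \<le> (\<epsilon> / 2)\<^sup>2 / \<epsilon>\<^sup>2" by (intro divide_right_mono) auto
  also have "\<dots> \<le> 1/2" using \<epsilon> by (simp add: power2_eq_square)
  finally show ?thesis unfolding \<beta>_def by (rule cutoff_eq_0)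
qed

text \<open>Where \<open>B\<close> is nonzero the sine is below \<open>\<epsilon>\<close>; the
  factor 8 comes from \<open>cutoff'\<close>, and \<open>2 / \<epsilon>\<close> from the derivative
  of the squared sine.\<close>

lemma B_bound: "\<bar>B l x\<bar> \<le> 16 * pi * k / \<epsilon>"
proof (cases "\<epsilon> \<le> \<bar>sin (phase l x)\<bar>")
  case True
  then show ?thesis using far_from_line(2)[OF True] \<epsilon> by simp
next
  case False
  have "\<bar>sin (phase l x)\<bar> * \<bar>cos (phase l x)\<bar> \<le> \<epsilon> * 1" using False \<epsilon> by (intro mult_mono) auto
  then have "2 * (\<bar>sin (phase l x)\<bar> * \<bar>cos (phase l x)\<bar>) / \<epsilon>\<^sup>2 \<le> 2 * (\<epsilon> * 1) / \<epsilon>\<^sup>2"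
    by (intro divide_right_mono mult_left_mono) auto
  also have "\<dots> = 2 / \<epsilon>" using \<epsilon> by (simp add: power2_eq_square)
  finally have "\<bar>cutoff' ((sin (phase l x))\<^sup>2 / \<epsilon>\<^sup>2)\<bar> * (2 * (\<bar>sin (phase l x)\<bar> * \<bar>cos (phase l x)\<bar>) / \<epsilon>\<^sup>2) \<le> 8 * (2 / \<epsilon>)"
    using \<epsilon> cutoff'_bound by (intro mult_mono) auto
  then have "\<bar>cutoff' ((sin (phase l x))\<^sup>2 / \<epsilon>\<^sup>2)\<bar> * (2 * (\<bar>sin (phase l x)\<bar> * \<bar>cos (phase l x)\<bar>) / \<epsilon>\<^sup>2) * (pi * k) \<le> 8 * (2 / \<epsilon>) * (pi * k)"
    by (intro mult_right_mono) auto
  then show ?thesis by (simp add: B_def abs_mult mult.assoc)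
qed

text \<open>\<open>p n\<close> lives near the lines with normal \<open>n\<close> and away from the
  other three families, \<open>q\<close> away from all lines. Together they form a partition of
  unity except near points where two families meet.\<close>

definition p :: "nat \<Rightarrow> real^2 \<Rightarrow> real" where
  "p n x = (1 - \<beta> n x) * (\<beta> (n + 1) x * (\<beta> (n + 2) x * \<beta> (n + 3) x))"

definition p' :: "nat \<Rightarrow> real^2 \<Rightarrow> real^2" where
  "p' n x = (- B n x * (\<beta> (n + 1) x * (\<beta> (n + 2) x * \<beta> (n + 3) x))) *\<^sub>R nrm n +
    (1 - \<beta> n x) *\<^sub>R ((B (n + 1) x * (\<beta> (n + 2) x * \<beta> (n + 3) x)) *\<^sub>R nrm (n + 1) +
      (\<beta> (n + 1) x * (B (n + 2) x * \<beta> (n + 3) x)) *\<^sub>R nrm (n + 2) +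
      (\<beta> (n + 1) x * (\<beta> (n + 2) x * B (n + 3) x)) *\<^sub>R nrm (n + 3))"

definition q :: "real^2 \<Rightarrow> real" where "q x = \<beta> 0 x * (\<beta> 1 x * (\<beta> 2 x * \<beta> 3 x))"

definition q' :: "real^2 \<Rightarrow> real^2" where
  "q' x = (B 0 x * (\<beta> 1 x * (\<beta> 2 x * \<beta> 3 x))) *\<^sub>R nrm 0 + (\<beta> 0 x * (B 1 x * (\<beta> 2 x * \<beta> 3 x))) *\<^sub>R nrm 1 +
    (\<beta> 0 x * (\<beta> 1 x * (B 2 x * \<beta> 3 x))) *\<^sub>R nrm 2 + (\<beta> 0 x * (\<beta> 1 x * (\<beta> 2 x * B 3 x))) *\<^sub>R nrm 3"

lemma p_deriv: "(p n has_derivative (\<lambda>h. p' n x \<bullet> h)) (at x)"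
proof -
  have "((\<lambda>x. (1 - \<beta> n x) * (\<beta> (n + 1) x * (\<beta> (n + 2) x * \<beta> (n + 3) x))) has_derivative (\<lambda>h. p' n x \<bullet> h)) (at x)"
    by (rule has_derivative_eq_rhs[OF has_derivative_mult[OF has_derivative_diff[OF has_derivative_const \<beta>_deriv]
          has_derivative_mult[OF \<beta>_deriv has_derivative_mult[OF \<beta>_deriv \<beta>_deriv]]]])
      (rule ext, simp add: p'_def inner_add_left algebra_simps)
  then show ?thesis by (simp add: p_def[abs_def])
qed

lemma q_deriv: "(q has_derivative (\<lambda>h. q' x \<bullet> h)) (at x)"
proof -
  have "((\<lambda>x. \<beta> 0 x * (\<beta> 1 x * (\<beta> 2 x * \<beta> 3 x))) has_derivative (\<lambda>h. q' x \<bullet> h)) (at x)"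
    by (rule has_derivative_eq_rhs[OF has_derivative_mult[OF \<beta>_deriv
          has_derivative_mult[OF \<beta>_deriv has_derivative_mult[OF \<beta>_deriv \<beta>_deriv]]]])
      (rule ext, simp add: q'_def inner_add_left algebra_simps)
  then show ?thesis by (simp add: q_def[abs_def])
qed

lemma p'_cont: "continuous_on UNIV (p' n)"
  unfolding p'_def by (intro continuous_intros \<beta>_cont B_cont)

lemma q'_cont: "continuous_on UNIV q'"
  unfolding q'_def by (intro continuous_intros \<beta>_cont B_cont)

lemma periodic: "nrm 4 = nrm 0" "nrm 5 = nrm 1" "nrm 6 = nrm 2"
    "\<beta> 4 = \<beta> 0" "\<beta> 5 = \<beta> 1" "\<beta> 6 = \<beta> 2" "B 4 = B 0" "B 5 = B 1" "B 6 = B 2"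
proof -
  show n: "nrm 4 = nrm 0" "nrm 5 = nrm 1" "nrm 6 = nrm 2" by (simp_all add: nrm_def)
  then have "phase 4 = phase 0" "phase 5 = phase 1" "phase 6 = phase 2" by (simp_all add: phase_def[abs_def])
  then show "\<beta> 4 = \<beta> 0" "\<beta> 5 = \<beta> 1" "\<beta> 6 = \<beta> 2" "B 4 = B 0" "B 5 = B 1" "B 6 = B 2"
    by (simp_all add: \<beta>_def[abs_def] B_def[abs_def])
qed

lemma p_nonneg: "0 \<le> p n x" "0 \<le> q x"
  unfolding p_def q_def using \<beta>_range by (auto intro!: mult_nonneg_nonneg)

text \<open>For independent events with probabilities \<open>a\<close>, \<open>b\<close>,
  \<open>c\<close>, \<open>d\<close> the left side is the probability that at most one of them
  fails. The cyclic order of the factors is that of \<open>p\<close>.\<close>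

lemma exactly_one_le:
  fixes a b c d :: real
  assumes "0 \<le> a" "a \<le> 1" "0 \<le> b" "b \<le> 1" "0 \<le> c" "c \<le> 1" "0 \<le> d" "d \<le> 1"
  shows "a * (b * (c * d)) + ((1 - a) * (b * (c * d)) + (1 - b) * (c * (d * a)) + (1 - c) * (d * (a * b)) + (1 - d) * (a * (b * c))) \<le> 1"
proof -
  let ?X = "b * (c * d)" and ?Y = "(1 - b) * (c * d) + b * ((1 - c) * d + c * (1 - d))"
  have "a * (b * (c * d)) + ((1 - a) * (b * (c * d)) + (1 - b) * (c * (d * a)) + (1 - c) * (d * (a * b)) + (1 - d) * (a * (b * c))) = ?X + a * ?Y"
    by (simp add: algebra_simps)
  also have "\<dots> \<le> ?X + 1 * ?Y" using assms by (intro add_left_mono mult_right_mono) auto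
  also have "\<dots> = c * d + b * ((1 - c) * d + c * (1 - d))" by (simp add: algebra_simps)
  also have "\<dots> \<le> c * d + 1 * ((1 - c) * d + c * (1 - d))" using assms by (intro add_left_mono mult_right_mono) auto
  also have "\<dots> = d + c * (1 - d)" by (simp add: algebra_simps)
  also have "\<dots> \<le> d + 1 * (1 - d)" using assms by (intro add_left_mono mult_right_mono) auto
  finally show ?thesis by simp
qed

lemma p_sum_le: "q x + (\<Sum>n<4. p n x) \<le> 1"
  using exactly_one_le[of "\<beta> 0 x" "\<beta> 1 x" "\<beta> 2 x" "\<beta> 3 x"] \<beta>_range
  by (simp add: sum_less_4 p_def q_def periodic add.assoc numeral_2_eq_2[symmetric])

text \<open>The terms of \<open>q'\<close> cancel against the first terms of the
  \<open>p' n\<close>. Every remaining product contains \<open>1 - \<beta> n\<close> and some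
  \<open>B l\<close> of another family, so it can be nonzero only near two families at once.\<close>

lemma gradient_sum: "q' x \<bullet> w + (\<Sum>n<4. p' n x \<bullet> w) =
   (\<Sum>n<4. (1 - \<beta> n x) * (B (n + 1) x * (\<beta> (n + 2) x * \<beta> (n + 3) x) * (nrm (n + 1) \<bullet> w) +
      \<beta> (n + 1) x * (B (n + 2) x * \<beta> (n + 3) x) * (nrm (n + 2) \<bullet> w) +
      \<beta> (n + 1) x * (\<beta> (n + 2) x * B (n + 3) x) * (nrm (n + 3) \<bullet> w)))"
  by (simp add: sum_less_4 p'_def q'_def periodic inner_add_left numeral_2_eq_2[symmetric] algebra_simps)

definition vertex_nbhd :: "(real^2) set" where
  "vertex_nbhd = {x. \<exists>l<4. \<exists>n<4. l \<noteq> n \<and> \<bar>sin (phase l x)\<bar> < \<epsilon> \<and> \<bar>sin (phase n x)\<bar> < \<epsilon>}"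

text \<open>At most one \<open>\<beta> n\<close> differs from 1 here, so only \<open>q\<close> and
  that \<open>p n\<close> can be nonzero, and they add up to
  \<open>\<beta> n + (1 - \<beta> n)\<close>.\<close>

lemma outside_vertex_nbhd:
  assumes x: "x \<notin> vertex_nbhd"
  shows "q x + (\<Sum>n<4. p n x) = 1" "q' x \<bullet> w + (\<Sum>n<4. p' n x \<bullet> w) = 0"
proof -
  obtain n where n: "n < 4" "\<And>l. l < 4 \<Longrightarrow> l \<noteq> n \<Longrightarrow> \<epsilon> \<le> \<bar>sin (phase l x)\<bar>"
  proof (cases "\<exists>n<4. \<bar>sin (phase n x)\<bar> < \<epsilon>")
    case True
    then obtain n where "n < 4" "\<bar>sin (phase n x)\<bar> < \<epsilon>" by blast
    then show ?thesis using that[of n] x unfolding vertex_nbhd_def by force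
  next
    case False
    then show ?thesis using that[of 0] by force
  qed
  have *: "\<beta> l x = 1 \<and> B l x = 0" if "l < 4" "l \<noteq> n" for l
    using far_from_line[OF n(2)[OF that]] by simp
  have "n = 0 \<or> n = 1 \<or> n = 2 \<or> n = 3" using n(1) by linarith
  then have "(\<beta> 1 x = 1 \<and> \<beta> 2 x = 1 \<and> \<beta> 3 x = 1 \<and> B 1 x = 0 \<and> B 2 x = 0 \<and> B 3 x = 0) \<or>
     (\<beta> 0 x = 1 \<and> \<beta> 2 x = 1 \<and> \<beta> 3 x = 1 \<and> B 0 x = 0 \<and> B 2 x = 0 \<and> B 3 x = 0) \<or>
     (\<beta> 0 x = 1 \<and> \<beta> 1 x = 1 \<and> \<beta> 3 x = 1 \<and> B 0 x = 0 \<and> B 1 x = 0 \<and> B 3 x = 0) \<or>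
     (\<beta> 0 x = 1 \<and> \<beta> 1 x = 1 \<and> \<beta> 2 x = 1 \<and> B 0 x = 0 \<and> B 1 x = 0 \<and> B 2 x = 0)"
    by (elim disjE) (simp_all add: *)
  then show "q x + (\<Sum>n<4. p n x) = 1" "q' x \<bullet> w + (\<Sum>n<4. p' n x \<bullet> w) = 0"
    unfolding gradient_sum
    by (elim disjE; simp add: sum_less_4 p_def q_def periodic numeral_2_eq_2[symmetric])+
qed

text \<open>The factor 12 counts the four families with three terms each in
  \<open>gradient_sum\<close>; the cutoff factors are at most 1.\<close>

lemma gradient_sum_bound:
  assumes w: "\<And>l. \<bar>nrm l \<bullet> w\<bar> \<le> W"
  shows "\<bar>q' x \<bullet> w + (\<Sum>n<4. p' n x \<bullet> w)\<bar> \<le> 12 * (16 * pi * k / \<epsilon> * W)"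
proof -
  let ?M = "16 * pi * k / \<epsilon>"
  have M0: "0 \<le> ?M" using \<epsilon> by simp
  have t: "\<bar>b * c * B l x * (nrm m \<bullet> w)\<bar> \<le> ?M * W" if "0 \<le> b" "b \<le> 1" "0 \<le> c" "c \<le> 1" for b c l m
  proof -
    have h: "\<bar>b * c\<bar> * \<bar>B l x\<bar> \<le> 1 * ?M"
      using that mult_mono[of b 1 c 1] B_bound[of l x] M0 by (intro mult_mono) auto
    have "\<bar>b * c\<bar> * \<bar>B l x\<bar> * \<bar>nrm m \<bullet> w\<bar> \<le> 1 * ?M * W"
      by (rule mult_mono[OF h w]) (use M0 in auto)
    then show ?thesis by (simp add: abs_mult)
  qed
  have summand: "\<bar>(1 - \<beta> n x) * (B (n + 1) x * (\<beta> (n + 2) x * \<beta> (n + 3) x) * (nrm (n + 1) \<bullet> w) +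
      \<beta> (n + 1) x * (B (n + 2) x * \<beta> (n + 3) x) * (nrm (n + 2) \<bullet> w) +
      \<beta> (n + 1) x * (\<beta> (n + 2) x * B (n + 3) x) * (nrm (n + 3) \<bullet> w))\<bar> \<le> 3 * (?M * W)" (is "\<bar>_ * ?S\<bar> \<le> _") for n
  proof -
    have "?S = \<beta> (n + 2) x * \<beta> (n + 3) x * B (n + 1) x * (nrm (n + 1) \<bullet> w) + \<beta> (n + 1) x * \<beta> (n + 3) x * B (n + 2) x * (nrm (n + 2) \<bullet> w) +
        \<beta> (n + 1) x * \<beta> (n + 2) x * B (n + 3) x * (nrm (n + 3) \<bullet> w)" by (simp add: mult_ac)
    also have "\<bar>\<dots>\<bar> \<le> 3 * (?M * W)"
    proof -
      have "\<bar>\<beta> (n + 2) x * \<beta> (n + 3) x * B (n + 1) x * (nrm (n + 1) \<bullet> w)\<bar> \<le> ?M * W"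
        "\<bar>\<beta> (n + 1) x * \<beta> (n + 3) x * B (n + 2) x * (nrm (n + 2) \<bullet> w)\<bar> \<le> ?M * W"
        "\<bar>\<beta> (n + 1) x * \<beta> (n + 2) x * B (n + 3) x * (nrm (n + 3) \<bullet> w)\<bar> \<le> ?M * W"
        by (rule t[OF \<beta>_range \<beta>_range])+
      then show ?thesis by linarith
    qed
    finally have S: "\<bar>?S\<bar> \<le> 3 * (?M * W)" .
    have "\<bar>1 - \<beta> n x\<bar> * \<bar>?S\<bar> \<le> 1 * (3 * (?M * W))"
      using S \<beta>_range[of n x] by (intro mult_mono) auto
    then show ?thesis by (simp only: abs_mult mult_1)
  qed
  have "\<bar>q' x \<bullet> w + (\<Sum>n<4. p' n x \<bullet> w)\<bar> \<le> (\<Sum>n<4::nat. 3 * (?M * W))"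
    unfolding gradient_sum by (rule order_trans[OF sum_abs]) (intro sum_mono summand)
  then show ?thesis by (simp add: sum_less_4)
qed

text \<open>Two small sines among the phases \<open>a\<close>, \<open>b\<close>,
  \<open>a + b\<close>, \<open>a - b\<close> force the sines of \<open>2 a\<close> and
  \<open>2 b\<close> to be at most \<open>4 \<epsilon>\<close>. The doubling is due to the pair of
  diagonals, whose phases combine only to \<open>2 a\<close> and \<open>2 b\<close>.\<close>

lemma vertex_nbhd_subset:
  "vertex_nbhd \<inter> unit_square \<subseteq> {x. x $ 1 \<in> lattice_nbhd k (4 * \<epsilon>) \<and> x $ 2 \<in> lattice_nbhd k (4 * \<epsilon>)}"
proof
  fix x assume x: "x \<in> vertex_nbhd \<inter> unit_square"
  then have sq: "0 < x $ 1" "x $ 1 < 1" "0 < x $ 2" "x $ 2 < 1" by (auto simp: unit_square_def)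
  define a where "a = pi * (k * x $ 1)"
  define b where "b = pi * (k * x $ 2)"
  have ph: "phase 0 x = a" "phase (Suc 0) x = b" "phase 2 x = a + b" "phase 3 x = a - b"
    by (simp_all add: phase_def nrm_def edge_normal_inner a_def b_def numeral_2_eq_2[symmetric] algebra_simps)
  obtain l n where ln: "l < 4" "n < 4" "l \<noteq> n" "\<bar>sin (phase l x)\<bar> < \<epsilon>" "\<bar>sin (phase n x)\<bar> < \<epsilon>"
    using x unfolding vertex_nbhd_def by blast
  have "l = 0 \<or> l = Suc 0 \<or> l = 2 \<or> l = 3" "n = 0 \<or> n = Suc 0 \<or> n = 2 \<or> n = 3" using ln by linarith+
  then have pairs: "(\<bar>sin a\<bar> < \<epsilon> \<and> \<bar>sin b\<bar> < \<epsilon>) \<or> (\<bar>sin a\<bar> < \<epsilon> \<and> \<bar>sin (a + b)\<bar> < \<epsilon>) \<or> (\<bar>sin a\<bar> < \<epsilon> \<and> \<bar>sin (a - b)\<bar> < \<epsilon>) \<or>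
      (\<bar>sin b\<bar> < \<epsilon> \<and> \<bar>sin (a + b)\<bar> < \<epsilon>) \<or> (\<bar>sin b\<bar> < \<epsilon> \<and> \<bar>sin (a - b)\<bar> < \<epsilon>) \<or> (\<bar>sin (a + b)\<bar> < \<epsilon> \<and> \<bar>sin (a - b)\<bar> < \<epsilon>)"
    using ln(3,4,5) ph by (elim disjE) simp_all
  have d: "\<bar>sin (2 * a)\<bar> \<le> 2 * \<bar>sin a\<bar>" "\<bar>sin (2 * b)\<bar> \<le> 2 * \<bar>sin b\<bar>"
    "\<bar>sin (2 * (a + b))\<bar> \<le> 2 * \<bar>sin (a + b)\<bar>" "\<bar>sin (2 * (a - b))\<bar> \<le> 2 * \<bar>sin (a - b)\<bar>"
    by (rule sin_double_abs_le)+
  have e: "\<bar>sin (2 * b)\<bar> \<le> \<bar>sin (2 * (a + b))\<bar> + \<bar>sin (2 * a)\<bar>" "\<bar>sin (2 * b)\<bar> \<le> \<bar>sin (2 * a)\<bar> + \<bar>sin (2 * (a - b))\<bar>"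
    "\<bar>sin (2 * a)\<bar> \<le> \<bar>sin (2 * (a + b))\<bar> + \<bar>sin (2 * b)\<bar>" "\<bar>sin (2 * a)\<bar> \<le> \<bar>sin (2 * (a - b))\<bar> + \<bar>sin (2 * b)\<bar>"
    "\<bar>sin (2 * a)\<bar> \<le> \<bar>sin (a + b)\<bar> + \<bar>sin (a - b)\<bar>" "\<bar>sin (2 * b)\<bar> \<le> \<bar>sin (a + b)\<bar> + \<bar>sin (a - b)\<bar>"
  proof -
    have eqs: "2 * (a + b) - 2 * a = 2 * b" "2 * a - 2 * (a - b) = 2 * b" "2 * (a + b) - 2 * b = 2 * a"
      "2 * (a - b) + 2 * b = 2 * a" "a + b + (a - b) = 2 * a" "a + b - (a - b) = 2 * b" by simp_all
    show "\<bar>sin (2 * b)\<bar> \<le> \<bar>sin (2 * (a + b))\<bar> + \<bar>sin (2 * a)\<bar>"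
      using sin_diff_abs_le[of "2 * (a + b)" "2 * a"] unfolding eqs .
    show "\<bar>sin (2 * b)\<bar> \<le> \<bar>sin (2 * a)\<bar> + \<bar>sin (2 * (a - b))\<bar>"
      using sin_diff_abs_le[of "2 * a" "2 * (a - b)"] unfolding eqs .
    show "\<bar>sin (2 * a)\<bar> \<le> \<bar>sin (2 * (a + b))\<bar> + \<bar>sin (2 * b)\<bar>"
      using sin_diff_abs_le[of "2 * (a + b)" "2 * b"] unfolding eqs .
    show "\<bar>sin (2 * a)\<bar> \<le> \<bar>sin (2 * (a - b))\<bar> + \<bar>sin (2 * b)\<bar>"
      using sin_add_abs_le[of "2 * (a - b)" "2 * b"] unfolding eqs .
    show "\<bar>sin (2 * a)\<bar> \<le> \<bar>sin (a + b)\<bar> + \<bar>sin (a - b)\<bar>"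
      using sin_add_abs_le[of "a + b" "a - b"] unfolding eqs .
    show "\<bar>sin (2 * b)\<bar> \<le> \<bar>sin (a + b)\<bar> + \<bar>sin (a - b)\<bar>"
      using sin_diff_abs_le[of "a + b" "a - b"] unfolding eqs .
  qed
  have arith: "A2 \<le> 4 * \<epsilon> \<and> B2 \<le> 4 * \<epsilon>"
    if "(A < \<epsilon> \<and> B < \<epsilon>) \<or> (A < \<epsilon> \<and> S < \<epsilon>) \<or> (A < \<epsilon> \<and> D < \<epsilon>) \<or> (B < \<epsilon> \<and> S < \<epsilon>) \<or> (B < \<epsilon> \<and> D < \<epsilon>) \<or> (S < \<epsilon> \<and> D < \<epsilon>)"
      "A2 \<le> 2 * A" "B2 \<le> 2 * B" "S2 \<le> 2 * S" "D2 \<le> 2 * D" "B2 \<le> S2 + A2" "B2 \<le> A2 + D2"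
      "A2 \<le> S2 + B2" "A2 \<le> D2 + B2" "A2 \<le> S + D" "B2 \<le> S + D" for A B S D A2 B2 S2 D2
    using that(1)
  proof (elim disjE conjE)
    show ?thesis if "A < \<epsilon>" "B < \<epsilon>" using that \<open>A2 \<le> 2 * A\<close> \<open>B2 \<le> 2 * B\<close> \<epsilon> by (intro conjI) linarith+
    show ?thesis if "A < \<epsilon>" "S < \<epsilon>"
      using that \<open>A2 \<le> 2 * A\<close> \<open>S2 \<le> 2 * S\<close> \<open>B2 \<le> S2 + A2\<close> \<epsilon> by (intro conjI) linarith+
    show ?thesis if "A < \<epsilon>" "D < \<epsilon>"
      using that \<open>A2 \<le> 2 * A\<close> \<open>D2 \<le> 2 * D\<close> \<open>B2 \<le> A2 + D2\<close> \<epsilon> by (intro conjI) linarith+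
    show ?thesis if "B < \<epsilon>" "S < \<epsilon>"
      using that \<open>B2 \<le> 2 * B\<close> \<open>S2 \<le> 2 * S\<close> \<open>A2 \<le> S2 + B2\<close> \<epsilon> by (intro conjI) linarith+
    show ?thesis if "B < \<epsilon>" "D < \<epsilon>"
      using that \<open>B2 \<le> 2 * B\<close> \<open>D2 \<le> 2 * D\<close> \<open>A2 \<le> D2 + B2\<close> \<epsilon> by (intro conjI) linarith+
    show ?thesis if "S < \<epsilon>" "D < \<epsilon>"
      using that \<open>A2 \<le> S + D\<close> \<open>B2 \<le> S + D\<close> \<epsilon> by (intro conjI) linarith+
  qed
  have "\<bar>sin (2 * a)\<bar> \<le> 4 * \<epsilon> \<and> \<bar>sin (2 * b)\<bar> \<le> 4 * \<epsilon>"
    by (rule arith[OF pairs d e])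
  moreover have "2 * a = pi * (2 * k * x $ 1)" "2 * b = pi * (2 * k * x $ 2)" by (simp_all add: a_def b_def)
  ultimately show "x \<in> {x. x $ 1 \<in> lattice_nbhd k (4 * \<epsilon>) \<and> x $ 2 \<in> lattice_nbhd k (4 * \<epsilon>)}"
    using mem_lattice_nbhd[OF k sq(1,2)] mem_lattice_nbhd[OF k sq(3,4)] by simp
qed

end

section \<open>The calibration at fixed \<open>k\<close>\<close>

lemma scalar_test_integrable:
  fixes f :: "'a::euclidean_space \<Rightarrow> real"
  assumes f: "scalar_test \<Omega> f f'" and E: "E \<in> sets borel"
  shows "integrable lborel (\<lambda>x. indicator E x * (f' x \<bullet> v))"
proof -
  obtain C R where C0: "0 \<le> C" and R: "0 < R" and C: "\<And>x. norm (f' x) \<le> C"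
    and out: "\<And>x. R < norm x \<Longrightarrow> f x = 0 \<and> f' x = 0"
    by (rule scalar_test_bounds[OF f]) (rule that)
  have [measurable]: "f' \<in> borel_measurable borel"
    by (intro borel_measurable_continuous_onI scalar_test_cont[OF f])
  note [measurable] = E
  show ?thesis
  proof (rule integrable_bounded_compact_support)
    show "compact (cball (0 :: 'a) R)" by (rule compact_cball)
    show "\<bar>indicator E x * (f' x \<bullet> v)\<bar> \<le> C * norm v" for x
    proof -
      have "\<bar>f' x \<bullet> v\<bar> \<le> norm (f' x) * norm v" by (rule Cauchy_Schwarz_ineq2)
      also have "\<dots> \<le> C * norm v" using C by (intro mult_right_mono) auto
      finally show ?thesis using C0 by (simp add: indicator_def)
    qed
    show "indicator E x * (f' x \<bullet> v) = 0" if "x \<notin> cball 0 R" for x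
      using out[of x] that by simp
  qed measurable
qed

context line_cutoffs
begin

lemma p_vanish:
  assumes "l < 4" "n < 4" "l \<noteq> n" "\<beta> l x = 0"
  shows "p n x = 0"
proof -
  have "n = 0 \<or> n = Suc 0 \<or> n = 2 \<or> n = 3" "l = 0 \<or> l = Suc 0 \<or> l = 2 \<or> l = 3" using assms by linarith+
  then show ?thesis using assms(3,4)
    by (elim disjE) (simp_all add: p_def periodic numeral_2_eq_2[symmetric])
qed

lemma q_vanish:
  assumes "l < 4" "\<beta> l x = 0" shows "q x = 0"
proof -
  have "l = 0 \<or> l = Suc 0 \<or> l = 2 \<or> l = 3" using assms by linarith
  then show ?thesis using assms(2) by (elim disjE) (simp_all add: q_def)
qed

lemma near_line_edge:
  assumes "l < 4" "\<bar>sin (pi * (k * (edge_normal l \<bullet> x)))\<bar> < \<epsilon> / 2" shows "\<beta> l x = 0"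
  using assms by (intro near_line) (simp add: phase_def nrm_def)

text \<open>Near each edge the field \<open>T\<close> keeps only the normal component of
  \<open>\<eta> w\<close>. The tangential parts dropped integrate to 0 over \<open>E\<close>, and so
  does the part \<open>q \<eta> w\<close> away from all lines. The remaining error \<open>e\<close>
  lives near the vertices and is bounded by its supremum times their area.\<close>

lemma calibration_estimate:
  assumes E: "E \<in> triangulated_sets (periodic_triangulation double_diagonal k)"
    and \<eta>: "scalar_test unit_square \<eta> \<eta>'" and range: "\<And>x. 0 \<le> \<eta> x" "\<And>x. \<eta> x \<le> 1"
    and w: "\<And>l. l < 4 \<Longrightarrow> \<bar>edge_normal l \<bullet> w\<bar> \<le> norm (edge_normal l)"
    and C: "\<And>x. \<bar>\<eta>' x \<bullet> w\<bar> \<le> C" and W: "\<And>l. \<bar>nrm l \<bullet> w\<bar> \<le> W"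
  obtains S where "ennreal S \<le> perimeter E unit_square"
    "(LINT x|lborel. indicator E x * (\<eta>' x \<bullet> w)) \<le> S + (C + 12 * (16 * pi * k / \<epsilon> * W)) * (9 * (4 * \<epsilon>)\<^sup>2)"
proof -
  have openE: "open E" by (rule open_triangulated[OF E])
  then have Em: "E \<in> sets borel" by simp
  define F where "F n x = p n x * \<eta> x" for n x
  define F' where "F' n x = p n x *\<^sub>R \<eta>' x + \<eta> x *\<^sub>R p' n x" for n x
  define Q where "Q x = q x * \<eta> x" for x
  define Q' where "Q' x = q x *\<^sub>R \<eta>' x + \<eta> x *\<^sub>R q' x" for x
  have F: "scalar_test unit_square (F n) (F' n)" for n
    unfolding F_def[abs_def] F'_def[abs_def] by (rule scalar_test_mult[OF \<eta> p_deriv p'_cont])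
  have Q: "scalar_test unit_square Q Q'"
    unfolding Q_def[abs_def] Q'_def[abs_def] by (rule scalar_test_mult[OF \<eta> q_deriv q'_cont])
  define u where "u n = (1 / norm (edge_normal n)) *\<^sub>R edge_normal n" for n
  define I where "I f' v = (LINT x|lborel. indicator E x * (f' x \<bullet> v))" for f' :: "real^2 \<Rightarrow> real^2" and v
  have I_add: "I f' (a *\<^sub>R v + v') = a * I f' v + I f' v'" if "scalar_test unit_square f f'" for f f' a v v'
  proof -
    have "I f' (a *\<^sub>R v + v') = (LINT x|lborel. a * (indicator E x * (f' x \<bullet> v)) + indicator E x * (f' x \<bullet> v'))"
      unfolding I_def by (intro Bochner_Integration.integral_cong) (simp_all add: inner_add_right algebra_simps)
    also have "\<dots> = (LINT x|lborel. a * (indicator E x * (f' x \<bullet> v))) + (LINT x|lborel. indicator E x * (f' x \<bullet> v'))"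
      by (intro Bochner_Integration.integral_add integrable_mult_right scalar_test_integrable[OF that Em])
    finally show ?thesis unfolding I_def by simp
  qed
  have e2: "0 < \<epsilon> / 2" using \<epsilon> by simp
  \<comment> \<open>\<open>Q\<close> vanishes near all lines, so the exceptional family can be
    chosen freely and both coordinate directions count as tangential.\<close>
  have IQ: "I Q' w = 0"
  proof -
    have wd: "w = w $ 1 *\<^sub>R vector [1, 0] + (w $ 2 *\<^sub>R vector [0, 1] + 0)" by (simp add: vec_eq_iff forall_2)
    have "I Q' (vector [1, 0]) = 0" unfolding I_def
      by (rule tangential_integral_zero[OF k E Q, of "Suc 0", OF _ _ e2])
        (simp_all add: edge_normal_inner Q_def q_vanish[OF _ near_line_edge])
    moreover have "I Q' (vector [0, 1]) = 0" unfolding I_def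
      by (rule tangential_integral_zero[OF k E Q, of 0, OF _ _ e2])
        (simp_all add: edge_normal_inner Q_def q_vanish[OF _ near_line_edge])
    moreover have "I Q' 0 = 0" by (simp add: I_def)
    ultimately have "w $ 1 * I Q' (vector [1, 0]) + (w $ 2 * I Q' (vector [0, 1]) + I Q' 0) = 0" by simp
    then show ?thesis by (subst wd) (simp only: I_add[OF Q])
  qed
  have nn: "norm (edge_normal n) > 0" for n using edge_normal_nonzero[of n] by simp
  \<comment> \<open>\<open>F n\<close> vanishes near the other three families, so the component
    \<open>?v\<close> of \<open>w\<close> along the edges contributes nothing.\<close>
  have IF: "I (F' n) w = (w \<bullet> u n) * I (F' n) (u n)" if n: "n < 4" for n
  proof -
    let ?v = "w - (w \<bullet> u n) *\<^sub>R u n"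
    have "edge_normal n \<bullet> u n = norm (edge_normal n)"
      using nn[of n] by (simp add: u_def dot_square_norm power2_eq_square)
    moreover have "edge_normal n \<bullet> w = norm (edge_normal n) * (w \<bullet> u n)"
      using nn[of n] by (simp add: u_def inner_commute)
    ultimately have perp: "edge_normal n \<bullet> ?v = 0" by (simp add: inner_diff_right)
    have "I (F' n) ?v = 0" unfolding I_def
    proof (rule tangential_integral_zero[OF k E F n perp e2])
      fix x l assume "l < 4" "l \<noteq> n" "\<bar>sin (pi * (k * (edge_normal l \<bullet> x)))\<bar> < \<epsilon> / 2"
      then have "p n x = 0" using p_vanish[OF _ n _ near_line_edge] by blast
      then show "F n x = 0" by (simp add: F_def)
    qed
    moreover have "w = (w \<bullet> u n) *\<^sub>R u n + ?v" by simp
    ultimately show ?thesis using I_add[OF F, of n "w \<bullet> u n" "u n" ?v] by simp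
  qed
  define v where "v n = (w \<bullet> u n) *\<^sub>R u n" for n
  have norm_v: "norm (v n) \<le> 1" if "n < 4" for n
  proof -
    have "norm (u n) = 1" using nn[of n] by (simp add: u_def)
    moreover have "\<bar>w \<bullet> u n\<bar> \<le> 1" using w[OF that] nn[of n] by (simp add: u_def inner_commute)
    ultimately show ?thesis by (simp add: v_def)
  qed
  define T where "T x = ((F 0 x *\<^sub>R v 0 + F 1 x *\<^sub>R v 1) + F 2 x *\<^sub>R v 2) + F 3 x *\<^sub>R v 3" for x
  have T: "test_field unit_square T" and div: "divergence T x = ((F' 0 x \<bullet> v 0 + F' 1 x \<bullet> v 1) + F' 2 x \<bullet> v 2) + F' 3 x \<bullet> v 3" for x
  proof -
    note t = scalar_test_field(1)[OF F] and d = scalar_test_field(2)[OF F]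
    note t1 = test_field_add[OF t[of 0 "v 0"] t[of 1 "v 1"]]
    note t2 = test_field_add[OF t1(1) t[of 2 "v 2"]]
    note t3 = test_field_add[OF t2(1) t[of 3 "v 3"]]
    show "test_field unit_square T" unfolding T_def[abs_def] by (rule t3(1))
    show "divergence T x = ((F' 0 x \<bullet> v 0 + F' 1 x \<bullet> v 1) + F' 2 x \<bullet> v 2) + F' 3 x \<bullet> v 3"
      unfolding T_def[abs_def] t3(2) t2(2) t1(2) d ..
  qed
  \<comment> \<open>The weights \<open>p n\<close> sum to at most 1, and each \<open>v n\<close> has
    norm at most 1 by the assumption on \<open>w\<close>.\<close>
  have T1: "norm (T x) \<le> 1" for x
  proof -
    have nF: "norm (F n x *\<^sub>R v n) \<le> p n x" if "n < 4" for n
    proof -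
      have "norm (F n x *\<^sub>R v n) = p n x * (\<eta> x * norm (v n))"
        using p_nonneg(1)[of n x] range(1)[of x] by (simp add: F_def abs_mult)
      also have "\<dots> \<le> p n x * 1"
        using p_nonneg(1)[of n x] range[of x] norm_v[OF that] by (intro mult_left_mono mult_le_one) auto
      finally show ?thesis by simp
    qed
    have "norm (T x) \<le> ((norm (F 0 x *\<^sub>R v 0) + norm (F 1 x *\<^sub>R v 1)) + norm (F 2 x *\<^sub>R v 2)) + norm (F 3 x *\<^sub>R v 3)"
      unfolding T_def by (intro norm_triangle_mono order_refl)
    also have "\<dots> \<le> p 0 x + p 1 x + p 2 x + p 3 x" by (intro add_mono nF) auto
    also have "\<dots> = (\<Sum>n<4. p n x)" by (simp add: sum_less_4)
    also have "\<dots> \<le> 1" using p_sum_le[of x] p_nonneg(2)[of x] by linarith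
    finally show ?thesis .
  qed
  define S where "S = (LINT x:E|lebesgue. divergence T x)"
  have "ennreal S \<le> perimeter E unit_square"
    unfolding perimeter_def S_def using T T1 by (intro SUP_upper) simp
  moreover have "(LINT x|lborel. indicator E x * (\<eta>' x \<bullet> w)) \<le> S + (C + 12 * (16 * pi * k / \<epsilon> * W)) * (9 * (4 * \<epsilon>)\<^sup>2)"
  proof -
    have cF: "continuous_on UNIV (F' n)" for n by (rule scalar_test_cont[OF F])
    have cQ: "continuous_on UNIV Q'" by (rule scalar_test_cont[OF Q])
    have iF: "integrable lborel (\<lambda>x. indicator E x * (F' n x \<bullet> v))" for n v by (rule scalar_test_integrable[OF F Em])
    have "S = (LINT x|lborel. indicator E x * divergence T x)"
      unfolding S_def
    proof (rule set_integral_lebesgue_lborel[OF openE])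
      show "divergence T \<in> borel_measurable borel"
        unfolding div[abs_def] by (intro borel_measurable_continuous_onI continuous_intros cF)
    qed
    also have "\<dots> = (LINT x|lborel. ((indicator E x * (F' 0 x \<bullet> v 0) + indicator E x * (F' 1 x \<bullet> v 1)) +
        indicator E x * (F' 2 x \<bullet> v 2)) + indicator E x * (F' 3 x \<bullet> v 3))"
      unfolding div by (simp add: distrib_left)
    also have "\<dots> = ((I (F' 0) (v 0) + I (F' 1) (v 1)) + I (F' 2) (v 2)) + I (F' 3) (v 3)"
      unfolding I_def by (subst Bochner_Integration.integral_add; (intro Bochner_Integration.integrable_add iF)?)+ simp
    also have "\<dots> = ((I (F' 0) w + I (F' 1) w) + I (F' 2) w) + I (F' 3) w"
    proof -
      have "I (F' n) (v n) = I (F' n) w" if "n < 4" for n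
      proof -
        have "I (F' n) (v n) = (w \<bullet> u n) * I (F' n) (u n) + I (F' n) 0"
          unfolding v_def using I_add[OF F, of n "w \<bullet> u n" "u n" 0] by simp
        then show ?thesis using IF[OF that] by (simp add: I_def)
      qed
      then show ?thesis by simp
    qed
    finally have S: "S = ((I (F' 0) w + I (F' 1) w) + I (F' 2) w) + I (F' 3) w" .
    \<comment> \<open>The defect of the partition of unity: its failure to sum to 1, and the
      gradients that fail to cancel.\<close>
    define e where "e x = (1 - (q x + (\<Sum>n<4. p n x))) * (\<eta>' x \<bullet> w) - \<eta> x * (q' x \<bullet> w + (\<Sum>n<4. p' n x \<bullet> w))" for x
    have split: "\<eta>' x \<bullet> w = Q' x \<bullet> w + (((F' 0 x \<bullet> w + F' 1 x \<bullet> w) + F' 2 x \<bullet> w) + F' 3 x \<bullet> w) + e x" for x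
      unfolding e_def Q'_def F'_def sum_less_4 by (simp add: inner_add_left algebra_simps)
    let ?A = "\<lambda>x. indicator E x * (Q' x \<bullet> w) + (((indicator E x * (F' 0 x \<bullet> w) + indicator E x * (F' 1 x \<bullet> w)) +
        indicator E x * (F' 2 x \<bullet> w)) + indicator E x * (F' 3 x \<bullet> w))"
    have iQ: "integrable lborel (\<lambda>x. indicator E x * (Q' x \<bullet> w))" by (rule scalar_test_integrable[OF Q Em])
    have iA: "integrable lborel ?A" by (intro Bochner_Integration.integrable_add iF iQ)
    have ie: "integrable lborel (\<lambda>x. indicator E x * e x)"
    proof -
      have "(\<lambda>x. indicator E x * e x) = (\<lambda>x. indicator E x * (\<eta>' x \<bullet> w) - ?A x)"
        unfolding split by (simp add: algebra_simps)
      then show ?thesis using scalar_test_integrable[OF \<eta> Em, of w] iA by (simp only: Bochner_Integration.integrable_diff)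
    qed
    have IA: "(LINT x|lborel. ?A x) = S"
    proof -
      have "(LINT x|lborel. ?A x) = I Q' w + (((I (F' 0) w + I (F' 1) w) + I (F' 2) w) + I (F' 3) w)"
        unfolding I_def by (subst Bochner_Integration.integral_add; (intro Bochner_Integration.integrable_add iF iQ)?)+ simp
      then show ?thesis unfolding S IQ by simp
    qed
    have "(LINT x|lborel. indicator E x * (\<eta>' x \<bullet> w)) = (LINT x|lborel. ?A x + indicator E x * e x)"
      unfolding split by (intro Bochner_Integration.integral_cong) (simp_all add: algebra_simps)
    also have "\<dots> = S + (LINT x|lborel. indicator E x * e x)"
      by (subst Bochner_Integration.integral_add[OF iA ie]) (simp only: IA)
    also have "(LINT x|lborel. indicator E x * e x) \<le> (C + 12 * (16 * pi * k / \<epsilon> * W)) * (9 * (4 * \<epsilon>)\<^sup>2)"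
    proof -
      let ?K = "C + 12 * (16 * pi * k / \<epsilon> * W)"
      let ?Z = "{x :: real^2. x $ 1 \<in> lattice_nbhd k (4 * \<epsilon>) \<and> x $ 2 \<in> lattice_nbhd k (4 * \<epsilon>)}"
      have \<epsilon>4: "0 \<le> 4 * \<epsilon>" using \<epsilon> by simp
      note Z = emeasure_square_nbhd[OF k \<epsilon>4]
      have K0: "0 \<le> ?K" using order_trans[OF abs_ge_zero C] order_trans[OF abs_ge_zero W] \<epsilon> by simp
      have fin: "emeasure lborel ?Z < \<infinity>" using Z(2) by (rule le_less_trans) simp
      have "\<bar>LINT x|lborel. indicator E x * e x\<bar> \<le> (LINT x|lborel. ?K * indicator ?Z x)"
      proof (rule abs_integral_le)
        show "integrable lborel (\<lambda>x. ?K * indicator ?Z x :: real)" using Z(1) fin by (intro integrable_mult_right) simp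
        show "\<bar>indicator E x * e x\<bar> \<le> ?K * indicator ?Z x" for x
        proof (cases "x \<in> E \<and> x \<in> vertex_nbhd")
          case False
          then have "indicator E x * e x = 0"
            using outside_vertex_nbhd(1)[of x] outside_vertex_nbhd(2)[of x w]
            by (cases "x \<in> E") (simp_all add: e_def)
          moreover have "0 \<le> ?K * indicator ?Z x" using K0 by simp
          ultimately show ?thesis by (simp only: abs_zero)
        next
          case True
          then have Zx: "x \<in> ?Z" using vertex_nbhd_subset triangulated_subset_unit_square[OF k E] by blast
          have "0 \<le> (\<Sum>n<4. p n x)" using p_nonneg(1) by (intro sum_nonneg) auto
          then have r: "\<bar>1 - (q x + (\<Sum>n<4. p n x))\<bar> \<le> 1" using p_sum_le[of x] p_nonneg(2)[of x] by linarith
          have "\<bar>1 - (q x + (\<Sum>n<4. p n x))\<bar> * \<bar>\<eta>' x \<bullet> w\<bar> \<le> 1 * C" using r C[of x] by (intro mult_mono) auto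
          moreover have "\<bar>\<eta> x\<bar> * \<bar>q' x \<bullet> w + (\<Sum>n<4. p' n x \<bullet> w)\<bar> \<le> 1 * (12 * (16 * pi * k / \<epsilon> * W))"
            using range[of x] gradient_sum_bound[OF W, of x] by (intro mult_mono) auto
          ultimately have "\<bar>e x\<bar> \<le> ?K"
            unfolding e_def abs_mult[symmetric] by (intro order_trans[OF abs_triangle_ineq4]) linarith
          then show ?thesis using True Zx by simp
        qed
      qed
      also have "\<dots> = ?K * measure lborel ?Z" by simp
      also have "\<dots> \<le> ?K * (9 * (4 * \<epsilon>)\<^sup>2)"
        using K0 Z(2) by (intro mult_left_mono) (auto simp: measure_def intro!: enn2real_leI)
      finally show ?thesis by linarith
    qed
    finally show ?thesis by simp
  qed
  ultimately show ?thesis by (rule that)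
qed

end

text \<open>At cutoff width \<open>r\<close> the error is \<open>A * r^2 + D * r\<close>. The
  coefficient \<open>D\<close> contains \<open>k\<close>, so the width is sent to 0 with
  \<open>k\<close> fixed, before any limit in \<open>k\<close>.\<close>

lemma calibration_le_perimeter:
  assumes k: "k > 0" and E: "E \<in> triangulated_sets (periodic_triangulation double_diagonal k)"
    and \<eta>: "scalar_test unit_square \<eta> \<eta>'" and range: "\<And>x. 0 \<le> \<eta> x" "\<And>x. \<eta> x \<le> 1"
    and w: "\<And>l. l < 4 \<Longrightarrow> \<bar>edge_normal l \<bullet> w\<bar> \<le> norm (edge_normal l)"
  shows "ennreal (LINT x:E|lebesgue. \<eta>' x \<bullet> w) \<le> perimeter E unit_square"
proof -
  obtain C0 R where C0: "\<And>x. norm (\<eta>' x) \<le> C0"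
    by (rule scalar_test_bounds[OF \<eta>]) (rule that)
  define C where "C = C0 * norm w"
  have C: "\<bar>\<eta>' x \<bullet> w\<bar> \<le> C" for x
  proof -
    have "\<bar>\<eta>' x \<bullet> w\<bar> \<le> norm (\<eta>' x) * norm w" by (rule Cauchy_Schwarz_ineq2)
    also have "\<dots> \<le> C" unfolding C_def using C0 by (intro mult_right_mono) auto
    finally show ?thesis .
  qed
  define W where "W = (\<Sum>l<4. \<bar>edge_normal l \<bullet> w\<bar>)"
  have W: "\<bar>edge_normal (l mod 4) \<bullet> w\<bar> \<le> W" for l
    unfolding W_def by (rule member_le_sum[where f="\<lambda>l. \<bar>edge_normal l \<bullet> w\<bar>"]) auto
  define J where "J = (LINT x|lborel. indicator E x * (\<eta>' x \<bullet> w))"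
  \<comment> \<open>\<open>144 = 9 * 4^2\<close>, from the area of the vertex neighbourhood.\<close>
  define A where "A = 144 * C"
  define D where "D = 144 * (12 * (16 * pi * k * W))"
  define r where "r m = inverse (real (Suc m))" for m
  have step: "ennreal (J - (A * (r m * r m) + D * r m)) \<le> perimeter E unit_square" for m
  proof -
    have r: "r m > 0" unfolding r_def by simp
    interpret line_cutoffs k "r m" using k r by unfold_locales
    have Wn: "\<bar>nrm l \<bullet> w\<bar> \<le> W" for l unfolding nrm_def by (rule W)
    obtain S where S: "ennreal S \<le> perimeter E unit_square"
      "(LINT x|lborel. indicator E x * (\<eta>' x \<bullet> w)) \<le> S + (C + 12 * (16 * pi * k / r m * W)) * (9 * (4 * r m)\<^sup>2)"
      by (rule calibration_estimate[OF E \<eta> range w C Wn]) (assumption, rule that)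
    have "(C + 12 * (16 * pi * k / r m * W)) * (9 * (4 * r m)\<^sup>2) = A * (r m * r m) + D * r m"
      using r by (simp add: A_def D_def power2_eq_square field_simps)
    with S(2) have "J - (A * (r m * r m) + D * r m) \<le> S" unfolding J_def by linarith
    from order_trans[OF ennreal_leI[OF this] S(1)] show ?thesis .
  qed
  have "r \<longlonglongrightarrow> 0" unfolding r_def by (rule LIMSEQ_inverse_real_of_nat)
  then have "(\<lambda>m. J - (A * (r m * r m) + D * r m)) \<longlonglongrightarrow> J - (A * (0 * 0) + D * 0)"
    by (intro tendsto_intros)
  then have "(\<lambda>m. ennreal (J - (A * (r m * r m) + D * r m))) \<longlonglongrightarrow> ennreal J"
    by (intro tendsto_ennrealI) simp
  then have "ennreal J \<le> perimeter E unit_square"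
    by (rule LIMSEQ_le_const2) (use step in auto)
  moreover have "(LINT x:E|lebesgue. \<eta>' x \<bullet> w) = J"
    unfolding J_def
    by (intro set_integral_lebesgue_lborel open_triangulated[OF E] borel_measurable_continuous_onI continuous_intros scalar_test_cont[OF \<eta>])
  ultimately show ?thesis by simp
qed

section \<open>The density is the octagon norm\<close>

lemma set_integral_tendsto_L1:
  fixes f :: "'a::euclidean_space \<Rightarrow> real"
  assumes conv: "L1_converges E A" and E: "\<And>k. E k \<in> measurable_subsets \<Omega>" and A: "A \<in> measurable_subsets \<Omega>"
    and \<Omega>: "bounded \<Omega>" and f: "f \<in> borel_measurable borel" and C: "\<And>x. \<bar>f x\<bar> \<le> C"
  shows "(\<lambda>k. LINT x:E k|lebesgue. f x) \<longlonglongrightarrow> (LINT x:A|lebesgue. f x)"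
proof -
  have C0: "0 \<le> C" using order_trans[OF abs_ge_zero C] .
  have Em: "E k \<in> sets lebesgue" "E k \<subseteq> \<Omega>" and Am: "A \<in> sets lebesgue" "A \<subseteq> \<Omega>" for k
    using E A by (auto simp: measurable_subsets_def)
  have fm: "f \<in> borel_measurable lebesgue" using f by (intro measurable_completion) simp
  have int: "integrable lebesgue (\<lambda>x. indicator X x * f x)" if X: "X \<in> sets lebesgue" "X \<subseteq> \<Omega>" for X
  proof (rule integrableI_bounded_set[where A=X and B=C])
    have "X \<in> lmeasurable" using X \<Omega> by (intro bounded_set_imp_lmeasurable bounded_subset[OF \<Omega>])
    from fmeasurableD2[OF this] show "emeasure lebesgue X < \<infinity>" by (simp only: less_top infinity_ennreal_def)
    show "(\<lambda>x. indicator X x * f x) \<in> borel_measurable lebesgue" using X fm by measurable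
  qed (use X C in \<open>auto simp: indicator_def\<close>)
  have bound: "\<bar>(LINT x:E k|lebesgue. f x) - (LINT x:A|lebesgue. f x)\<bar> \<le> C * measure lebesgue (sym_diff (E k) A)" for k
  proof -
    let ?D = "sym_diff (E k) A"
    have D: "?D \<in> lmeasurable"
      using Em Am \<Omega> by (intro bounded_set_imp_lmeasurable bounded_subset[OF \<Omega>]) auto
    have "(LINT x:E k|lebesgue. f x) - (LINT x:A|lebesgue. f x) = (LINT x|lebesgue. indicator (E k) x * f x - indicator A x * f x)"
      using Bochner_Integration.integral_diff[OF int[OF Em] int[OF Am]] by (simp add: set_lebesgue_integral_def)
    also have "\<bar>\<dots>\<bar> \<le> (LINT x|lebesgue. C * indicator ?D x)"
    proof (rule abs_integral_le)
      show "integrable lebesgue (\<lambda>x. C * indicator ?D x :: real)"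
        using D by (intro integrable_mult_right) (simp add: lmeasurable_iff_integrable)
      show "\<bar>indicator (E k) x * f x - indicator A x * f x\<bar> \<le> C * indicator ?D x" for x
        using C[of x] C0 by (auto simp: indicator_def)
    qed
    also have "\<dots> = C * measure lebesgue ?D" by simp
    finally show ?thesis .
  qed
  have "(\<lambda>k. measure lebesgue (sym_diff (E k) A)) \<longlonglongrightarrow> 0"
    unfolding measure_def by (rule tendsto_enn2real) (use conv in \<open>simp_all add: L1_converges_def\<close>)
  then have "(\<lambda>k. C * measure lebesgue (sym_diff (E k) A)) \<longlonglongrightarrow> 0"
    using tendsto_mult_right_zero by blast
  then have "(\<lambda>k. (LINT x:E k|lebesgue. f x) - (LINT x:A|lebesgue. f x)) \<longlonglongrightarrow> 0"
    by (rule Lim_null_comparison[rotated]) (use bound in simp)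
  then show ?thesis by (simp add: LIM_zero_iff)
qed

context half_square
begin

text \<open>The vertex of the Wulff shape dual to \<open>conormal\<close>, up to sign.\<close>

definition calib :: "real^2" where
  "calib = - \<sigma> *\<^sub>R (axis i 1 - ((if 0 \<le> b then 1 else -1) * (sqrt 2 - 1)) *\<^sub>R axis j 1)"

lemma calib_nth: "calib $ i = - \<sigma>" "calib $ j = \<sigma> * ((if 0 \<le> b then 1 else -1) * (sqrt 2 - 1))"
  using ij by (simp_all add: calib_def axis_def)

lemma calib_conormal: "calib \<bullet> conormal = - (1 + (sqrt 2 - 1) * \<bar>b\<bar>)"
proof -
  have "\<sigma> * \<sigma> = 1" using \<sigma> by auto
  have "calib \<bullet> conormal = - (\<sigma> * \<sigma>) - (\<sigma> * \<sigma>) * ((if 0 \<le> b then 1 else -1) * (sqrt 2 - 1) * b)"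
    unfolding inner_real2[OF ij] calib_nth conormal_nth by (simp add: algebra_simps)
  then show ?thesis unfolding \<open>\<sigma> * \<sigma> = 1\<close> by (cases "0 \<le> b") (simp_all add: algebra_simps)
qed

text \<open>The coordinates have absolute values 1 and \<open>sqrt 2 - 1\<close>, so equality holds
  for the normal \<open>e_i\<close> and for one diagonal: \<open>calib\<close> is a corner of the
  admissible octagon.\<close>

lemma edge_normal_calib:
  assumes "l < 4" shows "\<bar>edge_normal l \<bullet> calib\<bar> \<le> norm (edge_normal l)"
proof -
  have a: "\<bar>calib $ i\<bar> = 1" "\<bar>calib $ j\<bar> = sqrt 2 - 1" unfolding calib_nth using \<sigma> by (auto simp: abs_mult)
  have "(i = 1 \<and> j = 2) \<or> (i = 2 \<and> j = 1)" using ij exhaust_2[of i] exhaust_2[of j] by auto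
  then have c: "\<bar>calib $ 1\<bar> \<le> 1" "\<bar>calib $ 2\<bar> \<le> 1" "\<bar>calib $ 1\<bar> + \<bar>calib $ 2\<bar> = sqrt 2"
    using a sqrt2_bounds by auto
  have n: "norm (edge_normal 0) = 1" "norm (edge_normal (Suc 0)) = 1" "norm (edge_normal 2) = sqrt 2" "norm (edge_normal 3) = sqrt 2"
    by (simp_all add: norm_real2[of "1::2" 2] edge_normal_def)
  have "l = 0 \<or> l = Suc 0 \<or> l = 2 \<or> l = 3" using assms by linarith
  then show ?thesis
  proof (elim disjE)
    assume "l = 2"
    then show ?thesis using n c(3) abs_triangle_ineq[of "calib $ 1" "calib $ 2"] by (simp add: edge_normal_inner)
  next
    assume "l = 3"
    then show ?thesis using n c(3) abs_triangle_ineq4[of "calib $ 1" "calib $ 2"] by (simp add: edge_normal_inner)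
  qed (simp_all add: n c edge_normal_inner)
qed

text \<open>The calibration bound holds for every set of the recovery sequence, trivially where the
  energy is infinite, and its left side is continuous under L1 convergence.\<close>

lemma limit_density_ge_test:
  assumes lim: "limit_density double_diagonal \<phi>"
    and \<eta>: "scalar_test unit_square \<eta> \<eta>'" and range: "\<And>x. 0 \<le> \<eta> x" "\<And>x. \<eta> x \<le> 1"
  shows "(1 + (sqrt 2 - 1) * \<bar>b\<bar>) * (LINT s|lborel. \<eta> (seg s)) \<le> \<phi> conormal"
proof -
  have \<phi>: "\<And>x. 0 \<le> \<phi> x" "\<And>t x. 0 \<le> t \<Longrightarrow> \<phi> (t *\<^sub>R x) = t * \<phi> x"
    and G: "gamma_converges unit_square (\<lambda>k. triangulated_perimeter (periodic_triangulation double_diagonal k))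
       (anisotropic_perimeter unit_square \<phi>)"
    using lim by (auto simp: limit_density_def)
  obtain E where E: "\<And>k. E k \<in> measurable_subsets unit_square" and conv: "L1_converges E half"
    and ls: "limsup (\<lambda>k. triangulated_perimeter (periodic_triangulation double_diagonal k) (E k)) \<le> anisotropic_perimeter unit_square \<phi> half"
    using G half_measurable unfolding gamma_converges_def by blast
  obtain C R where C: "\<And>x. norm (\<eta>' x) \<le> C"
    by (rule scalar_test_bounds[OF \<eta>]) (rule that)
  define a where "a k = (LINT x:E k|lebesgue. \<eta>' x \<bullet> calib)" for k
  have bd: "bounded unit_square" unfolding unit_square_eq_box by (rule bounded_box)
  have "a \<longlonglongrightarrow> (LINT x:half|lebesgue. \<eta>' x \<bullet> calib)"
    unfolding a_def
  proof (rule set_integral_tendsto_L1[OF conv E half_measurable bd])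
    show "(\<lambda>x. \<eta>' x \<bullet> calib) \<in> borel_measurable borel"
      by (intro borel_measurable_continuous_onI continuous_intros scalar_test_cont[OF \<eta>])
    show "\<bar>\<eta>' x \<bullet> calib\<bar> \<le> C * norm calib" for x
      using Cauchy_Schwarz_ineq2[of "\<eta>' x" calib] mult_right_mono[OF C[of x] norm_ge_zero[of calib]] by linarith
  qed
  then have "(\<lambda>k. ennreal (a k)) \<longlonglongrightarrow> ennreal (LINT x:half|lebesgue. \<eta>' x \<bullet> calib)" by (rule tendsto_ennrealI)
  then have "ennreal (LINT x:half|lebesgue. \<eta>' x \<bullet> calib) = limsup (\<lambda>k. ennreal (a k))"
    by (intro lim_imp_Limsup[symmetric]) simp_all
  also have "\<dots> \<le> limsup (\<lambda>k. triangulated_perimeter (periodic_triangulation double_diagonal k) (E k))"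
  proof (rule Limsup_mono)
    show "\<forall>\<^sub>F k in sequentially. ennreal (a k) \<le> triangulated_perimeter (periodic_triangulation double_diagonal k) (E k)"
      using eventually_gt_at_top[of 0]
    proof eventually_elim
      case (elim k)
      show ?case
      proof (cases "E k \<in> triangulated_sets (periodic_triangulation double_diagonal k)")
        case True
        then show ?thesis
          unfolding a_def triangulated_perimeter_def
          using calibration_le_perimeter[OF elim True \<eta> range edge_normal_calib] by simp
      qed (simp add: triangulated_perimeter_def)
    qed
  qed
  also note ls
  also have "anisotropic_perimeter unit_square \<phi> half = ennreal (\<phi> conormal)"
    by (rule anisotropic_perimeter_half[OF \<phi>])
  finally have "(LINT x:half|lebesgue. \<eta>' x \<bullet> calib) \<le> \<phi> conormal"
    using \<phi>(1)[of conormal] by (simp only: ennreal_le_iff)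
  moreover have "(LINT x:half|lebesgue. \<eta>' x \<bullet> calib) = (1 + (sqrt 2 - 1) * \<bar>b\<bar>) * (LINT s|lborel. \<eta> (seg s))"
  proof -
    have "(LINT x:half|lebesgue. \<eta>' x \<bullet> calib) = (LINT x:half|lebesgue. divergence (\<lambda>x. \<eta> x *\<^sub>R calib) x)"
      unfolding scalar_test_field(2)[OF \<eta>] ..
    also have "\<dots> = - (LINT s|lborel. (\<eta> (seg s) *\<^sub>R calib) \<bullet> conormal)"
      by (rule divergence_half[OF scalar_test_field(1)[OF \<eta>]])
    also have "\<dots> = (1 + (sqrt 2 - 1) * \<bar>b\<bar>) * (LINT s|lborel. \<eta> (seg s))"
      unfolding inner_scaleR_left calib_conormal integral_mult_left_zero by (simp add: algebra_simps)
    finally show ?thesis .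
  qed
  ultimately show ?thesis by simp
qed

text \<open>A test function vanishes near the frontier of the square and so loses some length of the
  segment; the functions \<open>box_bump\<close> recover it in the limit.\<close>

lemma limit_density_ge:
  assumes lim: "limit_density double_diagonal \<phi>"
  shows "1 + (sqrt 2 - 1) * \<bar>b\<bar> \<le> \<phi> conormal"
proof -
  have lu: "(0 :: real^2) $ 1 \<le> 1 $ 1" "(0 :: real^2) $ 2 \<le> 1 $ 2" by simp_all
  have sub: "box 0 1 \<subseteq> unit_square" by (simp add: unit_square_eq_box)
  have step: "(1 + (sqrt 2 - 1) * \<bar>b\<bar>) * (LINT s|lborel. box_bump 0 1 m (seg s)) \<le> \<phi> conormal" for m
  proof -
    obtain f' where "scalar_test unit_square (box_bump 0 1 m) f'"
      using scalar_test_box_bump[OF lu sub] .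
    then show ?thesis by (rule limit_density_ge_test[OF lim]) (rule box_bump_range)+
  qed
  have bm [measurable]: "box_bump 0 1 m \<in> borel_measurable borel" for m
  proof -
    obtain f' where "scalar_test unit_square (box_bump 0 1 m) f'"
      using scalar_test_box_bump[OF lu sub] .
    from scalar_test_cont0[OF this] show ?thesis by (rule borel_measurable_continuous_onI)
  qed
  have out: "box_bump 0 1 m x = 0" if "x \<notin> unit_square" for m x
  proof -
    obtain f' where f: "scalar_test unit_square (box_bump 0 1 m) f'"
      using scalar_test_box_bump[OF lu sub] .
    show ?thesis using scalar_test_support[OF f] that by blast
  qed
  have "(\<lambda>m. LINT s|lborel. box_bump 0 1 m (seg s)) \<longlonglongrightarrow> (LINT s|lborel. indicator {0<..<1::real} s)"
  proof (rule integral_dominated_convergence[where w="indicator {0<..<1}"])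
    show "AE s in lborel. (\<lambda>m. box_bump 0 1 m (seg s)) \<longlonglongrightarrow> indicator {0<..<1} s"
    proof (rule AE_I2)
      fix s
      have "indicator {0<..<1} s = (indicator (box 0 1) (seg s) :: real)"
        using seg_in[of s] by (simp add: indicator_def unit_square_eq_box)
      then show "(\<lambda>m. box_bump 0 1 m (seg s)) \<longlonglongrightarrow> indicator {0<..<1} s"
        using box_bump_tendsto[OF lu, of "seg s"] by simp
    qed
    show "AE s in lborel. norm (box_bump 0 1 m (seg s)) \<le> indicator {0<..<1} s" for m
    proof (rule AE_I2)
      fix s
      show "norm (box_bump 0 1 m (seg s)) \<le> indicator {0<..<1} s"
        using box_bump_range[of 0 1 m "seg s"] out[of "seg s" m] seg_in[of s] by (cases "0 < s \<and> s < 1") auto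
    qed
  qed (simp_all, measurable)
  then have "(\<lambda>m. (1 + (sqrt 2 - 1) * \<bar>b\<bar>) * (LINT s|lborel. box_bump 0 1 m (seg s))) \<longlonglongrightarrow> (1 + (sqrt 2 - 1) * \<bar>b\<bar>) * 1"
    by (intro tendsto_mult_left) simp
  from LIMSEQ_le_const2[OF this] step show ?thesis by simp
qed

lemma limit_density_conormal:
  assumes "limit_density double_diagonal \<phi>"
  shows "\<phi> conormal = 1 + (sqrt 2 - 1) * \<bar>b\<bar>"
  using limit_density_ge[OF assms] limit_density_le[OF assms] by simp

end

lemma octagon_norm_eq:
  assumes ij: "i \<noteq> j" and le: "\<bar>x $ j\<bar> \<le> \<bar>x $ i\<bar>"
  shows "octagon_norm x = \<bar>x $ i\<bar> + (sqrt 2 - 1) * \<bar>x $ j\<bar>"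
proof -
  have "0 \<le> (2 - sqrt 2) * (\<bar>x $ i\<bar> - \<bar>x $ j\<bar>)" using le sqrt2_bounds by (intro mult_nonneg_nonneg) auto
  then have "\<bar>x $ j\<bar> + (sqrt 2 - 1) * \<bar>x $ i\<bar> \<le> \<bar>x $ i\<bar> + (sqrt 2 - 1) * \<bar>x $ j\<bar>" by (simp add: algebra_simps)
  moreover have "(i = 1 \<and> j = 2) \<or> (i = 2 \<and> j = 1)" using ij exhaust_2[of i] exhaust_2[of j] by auto
  ultimately show ?thesis unfolding octagon_norm_def by (elim disjE) (simp_all add: max_def)
qed

text \<open>Every nonzero vector is a positive multiple of a conormal; taking \<open>i\<close> as
  the axis of the larger coordinate gives \<open>\<bar>b\<bar> \<le> 1\<close>.\<close>

lemma limit_density_eq_octagon_norm: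
  assumes lim: "limit_density double_diagonal \<phi>"
  shows "\<phi> x = octagon_norm x"
proof -
  have hom: "\<phi> (t *\<^sub>R x) = t * \<phi> x" if "0 \<le> t" for t x
    using lim that by (simp add: limit_density_def)
  have main: "\<phi> x = octagon_norm x" if ij: "i \<noteq> j" and le: "\<bar>x $ j\<bar> \<le> \<bar>x $ i\<bar>" for i j
  proof (cases "x $ i = 0")
    case True
    then have "x = 0" using le by (simp add: vec_eq_2_iff[OF ij])
    then show ?thesis using hom[of 0 0] by (simp add: octagon_norm_def)
  next
    case False
    define \<sigma> where "\<sigma> = sgn (x $ i)"
    \<comment> \<open>Chosen so that the \<open>j\<close>-th coordinate
      \<open>- \<sigma> * b\<close> of the conormal equals
      \<open>x $ j / \<bar>x $ i\<bar>\<close>.\<close>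
    define b where "b = - \<sigma> * x $ j / \<bar>x $ i\<bar>"
    have sg: "\<sigma> = 1 \<or> \<sigma> = -1" "\<bar>x $ i\<bar> * \<sigma> = x $ i" "\<sigma> * \<sigma> = 1" using False by (auto simp: \<sigma>_def sgn_if)
    have ab: "\<bar>b\<bar> = \<bar>x $ j\<bar> / \<bar>x $ i\<bar>" using sg(1) by (auto simp: b_def abs_mult)
    interpret half_square i j b \<sigma>
      by unfold_locales (use ij le False sg(1) ab in \<open>auto simp: divide_le_eq\<close>)
    have "- \<sigma> * b = (\<sigma> * \<sigma>) * x $ j / \<bar>x $ i\<bar>" by (simp add: b_def)
    then have b: "- \<sigma> * b = x $ j / \<bar>x $ i\<bar>" unfolding sg(3) by simp
    have "x = \<bar>x $ i\<bar> *\<^sub>R conormal"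
      unfolding vec_eq_2_iff[OF ij] vector_scaleR_component real_scaleR_def conormal_nth sg(2) b using False by simp
    then have "\<phi> x = \<bar>x $ i\<bar> * \<phi> conormal" using hom[of "\<bar>x $ i\<bar>" conormal] by simp
    also have "\<dots> = \<bar>x $ i\<bar> * (1 + (sqrt 2 - 1) * \<bar>b\<bar>)" by (simp add: limit_density_conormal[OF lim])
    also have "\<dots> = \<bar>x $ i\<bar> + (sqrt 2 - 1) * \<bar>x $ j\<bar>" unfolding ab using False by (simp add: distrib_left)
    finally show ?thesis by (simp add: octagon_norm_eq[OF ij le])
  qed
  show ?thesis
    using main[of 1 2] main[of 2 1] by (cases "\<bar>x $ 2\<bar> \<le> \<bar>x $ 1\<bar>") auto
qed

theorem proposition5p9:
  fixes \<phi> :: "real^2 \<Rightarrow> real"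
  assumes "limit_density double_diagonal \<phi>"
  shows "\<phi> -` {1} = frontier (regular_polygon 8 (vector [1, 0])) \<and>
         (\<exists>r>0. wulff_shape \<phi> =
            (\<lambda>x. r *\<^sub>R x) ` rotate2 (pi / 8) ` regular_polygon 8 (vector [1, 0]))"
proof -
  have "\<phi> = octagon_norm" using limit_density_eq_octagon_norm[OF assms] by (rule ext)
  moreover have "0 < 1 / cos (pi / 8)" using cos_gt_zero_pi[of "pi / 8"] by simp
  ultimately show ?thesis using frontier_octagon wulff_octagon_rotation by blast
qed

end
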